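(* Let $G$ be a finite simple graph, let $\pi=\{W_1,\ldots,W_r\}$ be a clique partition of $G$, let $n_1,\ldots,n_r$ be positive integers, let $\Gamma=G^\pi[n_1,\ldots,n_r]$ be the multi-clique-whiskered graph of $G$ with respect to $\pi$, and let $S=\Bbbk[V(\Gamma)]$. Then for every positive integer $j$ the Hilbert series of $H^j_{\mathfrak{m}}(S/I(\Gamma))$ is $$F(H^j_{\mathfrak{m}}(S/I(\Gamma)),t)=\sum_\ell\dim_\Bbbk[H^j_{\mathfrak{m}}(S/I(\Gamma))]_\ell\,t^\ell=\sum_i\ \sum_{\substack{C\in\mathrm{Min}(\Gamma)\\ |C|=|V(\Gamma)|-j}}\binom{|V(G)\setminus C|}{i}\left(\frac{t^{-1}}{1-t^{-1}}\right)^{j-i}.$$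
   Context: $\Bbbk$ is an arbitrary field. A clique partition $\pi=\{W_1,\ldots,W_r\}$ of $G$ is a family of cliques (vertex sets inducing complete subgraphs) whose disjoint union is $V(G)$. The multi-clique-whiskered graph $G^\pi[n_1,\ldots,n_r]$ has vertex set $V(G)\cup\{w_{i,k}:1\le i\le r,\ 1\le k\le n_i\}$ (new vertices $w_{i,k}$) and edge set $E(G)\cup\bigcup_{i=1}^r\{\{x,w_{i,k}\}: x\in W_i,\ 1\le k\le n_i\}$. The edge ideal $I(\Gamma)\subseteq\Bbbk[V(\Gamma)]$ is generated by $uv$, $\{u,v\}\in E(\Gamma)$. $\mathrm{Min}(\Gamma)$ is the set of inclusion-minimal vertex covers of $\Gamma$. $\mathfrak{m}$ is the homogeneous maximal ideal of $S$ (standard grading); the right-hand side is read as a power series in $t^{-1}$. *)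

theory Defs
  imports
    "HOL-Algebra.QuotRing"
    "HOL-Library.Poly_Mapping"
    "HOL-Library.Ramsey"
    "HOL-Library.Disjoint_Sets"
    "HOL-Computational_Algebra.Formal_Laurent_Series"
    "Jordan_Normal_Form.VS_Connect"
begin

hide_const (open) Multiset.mult Polynomial.smult

section \<open>Graphs\<close>

text \<open>A finite simple graph is a finite set \<open>V\<close> with an edge set \<open>E \<subseteq> [V]\<^bsup>2\<^esup>\<close>.
  Cliques are those of \<open>HOL-Library.Ramsey\<close>.\<close>

definition finite_simple_graph :: "'v set \<Rightarrow> 'v set set \<Rightarrow> bool" where
  "finite_simple_graph V E \<longleftrightarrow> finite V \<and> E \<subseteq> nsets V 2"

definition clique_partition :: "'v set \<Rightarrow> 'v set set \<Rightarrow> nat \<Rightarrow> (nat \<Rightarrow> 'v set) \<Rightarrow> bool" where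
  "clique_partition V E r W \<longleftrightarrow>
     (\<forall>i\<in>{1..r}. clique (W i) E) \<and> disjoint_family_on W {1..r} \<and> (\<Union>i\<in>{1..r}. W i) = V"

text \<open>The old vertex \<open>x\<close> is \<open>Inl x\<close>, and the new vertex \<open>w\<^bsub>i,k\<^esub>\<close> is \<open>Inr (i, k)\<close>.\<close>

definition whiskered_vertices ::
    "'v set \<Rightarrow> nat \<Rightarrow> (nat \<Rightarrow> nat) \<Rightarrow> ('v + nat \<times> nat) set" where
  "whiskered_vertices V r n = Inl ` V \<union> {Inr (i, k) | i k. i \<in> {1..r} \<and> k \<in> {1..n i}}"

definition whiskered_edges ::
    "'v set set \<Rightarrow> nat \<Rightarrow> (nat \<Rightarrow> 'v set) \<Rightarrow> (nat \<Rightarrow> nat) \<Rightarrow> ('v + nat \<times> nat) set set" where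
  "whiskered_edges E r W n =
     (\<lambda>e. Inl ` e) ` E \<union>
     {{Inl x, Inr (i, k)} | x i k. i \<in> {1..r} \<and> x \<in> W i \<and> k \<in> {1..n i}}"

definition vertex_cover :: "'x set \<Rightarrow> 'x set set \<Rightarrow> 'x set \<Rightarrow> bool" where
  "vertex_cover V E C \<longleftrightarrow> C \<subseteq> V \<and> (\<forall>e\<in>E. e \<inter> C \<noteq> {})"

definition minimal_vertex_covers :: "'x set \<Rightarrow> 'x set set \<Rightarrow> 'x set set" where
  "minimal_vertex_covers V E = {C. vertex_cover V E C \<and> (\<forall>D. D \<subset> C \<longrightarrow> \<not> vertex_cover V E D)}"


section \<open>Quotients and localizations of modules\<close>

text \<open>The \<open>mult\<close> and \<open>one\<close> slots of a \<open>module\<close> record play no role for modules that are not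
  algebras; they are left \<^const>\<open>undefined\<close>.\<close>

definition regular_module :: "('r, 'c) ring_scheme \<Rightarrow> ('r, 'r) module" where
  "regular_module R = \<lparr>carrier = carrier R, mult = mult R, one = \<one>\<^bsub>R\<^esub>, zero = \<zero>\<^bsub>R\<^esub>,
     add = add R, smult = mult R\<rparr>"

definition quotient_module :: "('r, 'm) module \<Rightarrow> 'm set \<Rightarrow> ('r, 'm set) module" where
  "quotient_module M N = \<lparr>carrier = a_rcosets\<^bsub>M\<^esub> N, mult = undefined, one = undefined,
     zero = N, add = set_add M, smult = (\<lambda>a X. \<Union>x\<in>X. N +>\<^bsub>M\<^esub> (a \<odot>\<^bsub>M\<^esub> x))\<rparr>"

text \<open>\<open>fraction M U m u\<close> is the fraction \<open>m / u\<close> in the localization of \<open>M\<close> at the multiplicative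
  set \<open>U\<close>. The operations of \<open>localization\<close> are unions over all representatives.\<close>

definition fraction_rel :: "('r, 'm) module \<Rightarrow> 'r set \<Rightarrow> (('m \<times> 'r) \<times> ('m \<times> 'r)) set" where
  "fraction_rel M U = {((m, u), (m', u')). m \<in> carrier M \<and> u \<in> U \<and> m' \<in> carrier M \<and> u' \<in> U \<and>
     (\<exists>w\<in>U. w \<odot>\<^bsub>M\<^esub> (u' \<odot>\<^bsub>M\<^esub> m) = w \<odot>\<^bsub>M\<^esub> (u \<odot>\<^bsub>M\<^esub> m'))}"

definition fraction :: "('r, 'm) module \<Rightarrow> 'r set \<Rightarrow> 'm \<Rightarrow> 'r \<Rightarrow> ('m \<times> 'r) set" where
  "fraction M U m u = fraction_rel M U `` {(m, u)}"

definition localization ::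
    "('r, 'c) ring_scheme \<Rightarrow> ('r, 'm) module \<Rightarrow> 'r set \<Rightarrow> ('r, ('m \<times> 'r) set) module" where
  "localization R M U = \<lparr>carrier = (carrier M \<times> U) // fraction_rel M U,
     mult = undefined, one = undefined,
     zero = fraction M U \<zero>\<^bsub>M\<^esub> \<one>\<^bsub>R\<^esub>,
     add = (\<lambda>X Y. \<Union>(m, u)\<in>X. \<Union>(m', u')\<in>Y.
              fraction M U (u' \<odot>\<^bsub>M\<^esub> m \<oplus>\<^bsub>M\<^esub> u \<odot>\<^bsub>M\<^esub> m') (u \<otimes>\<^bsub>R\<^esub> u')),
     smult = (\<lambda>a X. \<Union>(m, u)\<in>X. fraction M U (a \<odot>\<^bsub>M\<^esub> m) u)\<rparr>"

text \<open>The canonical map from the localization at a subset of \<open>U\<close> to the localization at \<open>U\<close>.\<close>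

definition localization_map ::
    "('r, 'm) module \<Rightarrow> 'r set \<Rightarrow> ('m \<times> 'r) set \<Rightarrow> ('m \<times> 'r) set" where
  "localization_map M U X = (\<Union>(m, u)\<in>X. fraction M U m u)"


section \<open>Local cohomology\<close>

text \<open>The local cohomology of \<open>M\<close> with support in the ideal generated by \<open>x\<^sub>0, \<dots>, x\<^sub>n\<close> is the
  cohomology of the Cech complex
  \<open>0 \<longrightarrow> M \<longrightarrow> \<Oplus>\<^bsub>i\<^esub> M\<^bsub>x\<^sub>i\<^esub> \<longrightarrow> \<Oplus>\<^bsub>i<k\<^esub> M\<^bsub>x\<^sub>i x\<^sub>k\<^esub> \<longrightarrow> \<dots>\<close>.
  The elements are given as a list \<open>xs\<close>, and the summands of the \<open>p\<close>-th term are indexed by the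
  \<open>p\<close>-element sets of positions in \<open>xs\<close>. The summand of \<open>\<sigma>\<close> is the localization at the
  multiplicative set generated by the \<open>x\<^sub>i\<close> with \<open>i \<in> \<sigma>\<close>, which inverts the same elements as the
  powers of their product, and makes the transition maps plain inclusions of denominators.\<close>

definition cech_denominators :: "('r, 'c) ring_scheme \<Rightarrow> 'r list \<Rightarrow> nat set \<Rightarrow> 'r set" where
  "cech_denominators R xs \<sigma> = {finprod R (\<lambda>i. (xs ! i) [^]\<^bsub>R\<^esub> (a i :: nat)) \<sigma> | a. True}"

definition cech_indices :: "'r list \<Rightarrow> nat \<Rightarrow> nat set set" where
  "cech_indices xs p = {\<sigma>. \<sigma> \<subseteq> {..<length xs} \<and> card \<sigma> = p}"

definition cech_summand ::
    "('r, 'c) ring_scheme \<Rightarrow> ('r, 'm) module \<Rightarrow> 'r list \<Rightarrow> nat set \<Rightarrow> ('r, ('m \<times> 'r) set) module" where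
  "cech_summand R M xs \<sigma> = localization R M (cech_denominators R xs \<sigma>)"

definition cech_module ::
    "('r, 'c) ring_scheme \<Rightarrow> ('r, 'm) module \<Rightarrow> 'r list \<Rightarrow> nat
      \<Rightarrow> ('r, nat set \<Rightarrow> ('m \<times> 'r) set) module" where
  "cech_module R M xs p = \<lparr>carrier = (\<Pi>\<^sub>E \<sigma>\<in>cech_indices xs p. carrier (cech_summand R M xs \<sigma>)),
     mult = undefined, one = undefined,
     zero = (\<lambda>\<sigma>\<in>cech_indices xs p. \<zero>\<^bsub>cech_summand R M xs \<sigma>\<^esub>),
     add = (\<lambda>f g. \<lambda>\<sigma>\<in>cech_indices xs p. f \<sigma> \<oplus>\<^bsub>cech_summand R M xs \<sigma>\<^esub> g \<sigma>),
     smult = (\<lambda>a f. \<lambda>\<sigma>\<in>cech_indices xs p. a \<odot>\<^bsub>cech_summand R M xs \<sigma>\<^esub> f \<sigma>)\<rparr>"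

definition cech_differential ::
    "('r, 'c) ring_scheme \<Rightarrow> ('r, 'm) module \<Rightarrow> 'r list \<Rightarrow> nat
      \<Rightarrow> (nat set \<Rightarrow> ('m \<times> 'r) set) \<Rightarrow> (nat set \<Rightarrow> ('m \<times> 'r) set)" where
  "cech_differential R M xs p f = (\<lambda>\<tau>\<in>cech_indices xs (Suc p).
     finsum (cech_summand R M xs \<tau>)
       (\<lambda>i. let y = localization_map M (cech_denominators R xs \<tau>) (f (\<tau> - {i}))
            in if even (card {k\<in>\<tau>. k < i}) then y else \<ominus>\<^bsub>cech_summand R M xs \<tau>\<^esub> y)
       \<tau>)"

definition cech_cocycles ::
    "('r, 'c) ring_scheme \<Rightarrow> ('r, 'm) module \<Rightarrow> 'r list \<Rightarrow> nat
      \<Rightarrow> (nat set \<Rightarrow> ('m \<times> 'r) set) set" where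
  "cech_cocycles R M xs p =
     {f \<in> carrier (cech_module R M xs p).
        cech_differential R M xs p f = \<zero>\<^bsub>cech_module R M xs (Suc p)\<^esub>}"

definition cech_coboundaries ::
    "('r, 'c) ring_scheme \<Rightarrow> ('r, 'm) module \<Rightarrow> 'r list \<Rightarrow> nat
      \<Rightarrow> (nat set \<Rightarrow> ('m \<times> 'r) set) set" where
  "cech_coboundaries R M xs p = (case p of
       0 \<Rightarrow> {\<zero>\<^bsub>cech_module R M xs 0\<^esub>}
     | Suc q \<Rightarrow> cech_differential R M xs q ` carrier (cech_module R M xs q))"

definition local_cohomology ::
    "('r, 'c) ring_scheme \<Rightarrow> 'r list \<Rightarrow> ('r, 'm) module \<Rightarrow> nat
      \<Rightarrow> ('r, (nat set \<Rightarrow> ('m \<times> 'r) set) set) module" where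
  "local_cohomology R xs M j =
     quotient_module ((cech_module R M xs j)\<lparr>carrier := cech_cocycles R M xs j\<rparr>)
       (cech_coboundaries R M xs j)"


subsection \<open>Grading\<close>

text \<open>A grading is given by its family of homogeneous components: \<open>A\<close> for the ring and \<open>D\<close> for
  the module. The fraction \<open>m / u\<close> of homogeneous elements has degree \<open>deg m - deg u\<close>, and the
  degree \<open>l\<close> part of the cohomology consists of the classes of the cocycles that are homogeneous
  of degree \<open>l\<close>.\<close>

definition localization_component ::
    "(int \<Rightarrow> 'r set) \<Rightarrow> ('r, 'm) module \<Rightarrow> (int \<Rightarrow> 'm set) \<Rightarrow> 'r set \<Rightarrow> int
      \<Rightarrow> ('m \<times> 'r) set set" where
  "localization_component A M D U l =
     {fraction M U m u | m u d e. m \<in> D d \<and> u \<in> U \<and> u \<in> A e \<and> l = d - e}"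

definition cech_component ::
    "('r, 'c) ring_scheme \<Rightarrow> (int \<Rightarrow> 'r set) \<Rightarrow> 'r list \<Rightarrow> ('r, 'm) module \<Rightarrow> (int \<Rightarrow> 'm set)
      \<Rightarrow> nat \<Rightarrow> int \<Rightarrow> (nat set \<Rightarrow> ('m \<times> 'r) set) set" where
  "cech_component R A xs M D p l =
     (\<Pi>\<^sub>E \<sigma>\<in>cech_indices xs p. localization_component A M D (cech_denominators R xs \<sigma>) l)"

definition local_cohomology_component ::
    "('r, 'c) ring_scheme \<Rightarrow> (int \<Rightarrow> 'r set) \<Rightarrow> 'r list \<Rightarrow> ('r, 'm) module \<Rightarrow> (int \<Rightarrow> 'm set)
      \<Rightarrow> nat \<Rightarrow> int \<Rightarrow> (nat set \<Rightarrow> ('m \<times> 'r) set) set set" where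
  "local_cohomology_component R A xs M D j l =
     (\<lambda>f. cech_coboundaries R M xs j +>\<^bsub>cech_module R M xs j\<^esub> f) `
       (cech_cocycles R M xs j \<inter> cech_component R A xs M D j l)"


section \<open>Polynomial rings and edge ideals\<close>

type_synonym ('x, 'k) mpol = "('x \<Rightarrow>\<^sub>0 nat) \<Rightarrow>\<^sub>0 'k"

definition polynomial_ring :: "'x set \<Rightarrow> ('x, 'k :: field) mpol ring" where
  "polynomial_ring V =
     class_ring\<lparr>carrier := {p. \<forall>a\<in>Poly_Mapping.keys p. Poly_Mapping.keys a \<subseteq> V}\<rparr>"

definition pvar :: "'x \<Rightarrow> ('x, 'k :: field) mpol" where
  "pvar v = Poly_Mapping.single (Poly_Mapping.single v 1) 1"

definition pconst :: "'k \<Rightarrow> ('x, 'k :: field) mpol" where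
  "pconst c = Poly_Mapping.single 0 c"

definition polynomial_component :: "'x set \<Rightarrow> int \<Rightarrow> ('x, 'k :: field) mpol set" where
  "polynomial_component V d =
     {p \<in> carrier (polynomial_ring V). \<forall>a\<in>Poly_Mapping.keys p.
        int (\<Sum>v\<in>Poly_Mapping.keys a. Poly_Mapping.lookup a v) = d}"

definition edge_ideal :: "'x set \<Rightarrow> 'x set set \<Rightarrow> ('x, 'k :: field) mpol set" where
  "edge_ideal V E = genideal (polynomial_ring V) {pvar u * pvar v | u v. {u, v} \<in> E}"

definition residue_module ::
    "'x set \<Rightarrow> ('x, 'k :: field) mpol set \<Rightarrow> (('x, 'k) mpol, ('x, 'k) mpol set) module" where
  "residue_module V I = quotient_module (regular_module (polynomial_ring V)) I"

definition residue_component ::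
    "'x set \<Rightarrow> ('x, 'k :: field) mpol set \<Rightarrow> int \<Rightarrow> ('x, 'k) mpol set set" where
  "residue_component V I d = (\<lambda>p. I +>\<^bsub>polynomial_ring V\<^esub> p) ` polynomial_component V d"

text \<open>For a list \<open>vs\<close> enumerating the variables, the local cohomology of \<open>S / I\<close> with support in
  the homogeneous maximal ideal of \<open>S\<close>, and its degree \<open>l\<close> part as a vector space over the
  coefficient field.\<close>

definition residue_local_cohomology ::
    "'x list \<Rightarrow> ('x, 'k :: field) mpol set \<Rightarrow> nat
      \<Rightarrow> (('x, 'k) mpol, (nat set \<Rightarrow> (('x, 'k) mpol set \<times> ('x, 'k) mpol) set) set) module" where
  "residue_local_cohomology vs I j =
     local_cohomology (polynomial_ring (set vs)) (map pvar vs) (residue_module (set vs) I) j"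

definition residue_local_cohomology_degree ::
    "'x list \<Rightarrow> ('x, 'k :: field) mpol set \<Rightarrow> nat \<Rightarrow> int
      \<Rightarrow> ('k, (nat set \<Rightarrow> (('x, 'k) mpol set \<times> ('x, 'k) mpol) set) set) module" where
  "residue_local_cohomology_degree vs I j l =
     (let H = residue_local_cohomology vs I j in
      \<lparr>carrier = local_cohomology_component (polynomial_ring (set vs)) (polynomial_component (set vs))
         (map pvar vs) (residue_module (set vs) I) (residue_component (set vs) I) j l,
       mult = undefined, one = undefined, zero = \<zero>\<^bsub>H\<^esub>, add = add H,
       smult = (\<lambda>c x. pconst c \<odot>\<^bsub>H\<^esub> x)\<rparr>)"


section \<open>Hilbert series\<close>

text \<open>A two-sided formal series in \<open>t\<close> is given by its coefficient function: the value at \<open>l\<close> is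
  the coefficient of \<open>t\<^sup>l\<close>. Note that \<open>vectorspace.dim\<close> is only meaningful together with
  \<open>vectorspace.fin_dim\<close>.\<close>

definition hilbert_series :: "(int \<Rightarrow> ('k :: field, 'm) module) \<Rightarrow> int \<Rightarrow> rat" where
  "hilbert_series H = (\<lambda>l. of_nat (vectorspace.dim class_ring (H l)))"

text \<open>A Laurent series in \<open>t\<^bsup>-1\<^esup>\<close> read as a two-sided series in \<open>t\<close>.\<close>

definition series_in_inverse_variable :: "rat fls \<Rightarrow> int \<Rightarrow> rat" where
  "series_in_inverse_variable f = (\<lambda>l. fls_nth f (- l))"

end

theory Submission
  imports Defs "HOL-Library.Function_Algebras"
begin

text \<open>
  Let \<open>D\<close> be the simplicial complex of independent sets of \<open>\<Gamma>\<close>, so that \<open>I(\<Gamma>)\<close> is spanned by the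
  monomials whose support is not in \<open>D\<close>. The localization of \<open>S / I(\<Gamma>)\<close> at the variables in a set
  \<open>\<sigma>\<close> has as basis the Laurent monomials \<open>x\<^sup>a\<close> such that the support of \<open>a\<close> together with \<open>\<sigma>\<close> is a
  face and all negative entries of \<open>a\<close> lie in \<open>\<sigma>\<close> (\<open>fraction_eq_local_class\<close>,
  \<open>localization_carrier\<close>). The Cech complex therefore splits by exponents: its part of exponent \<open>a\<close>
  is the simplicial cochain complex of the family \<open>cells a\<close> of all \<open>\<sigma>\<close> that allow \<open>a\<close>
  (\<open>differential_cochain\<close>).

  Each of these complexes is reduced by a matching. If \<open>a\<close> has a positive entry at \<open>v\<close>, then adding and
  removing \<open>v\<close> matches all cells. Otherwise the cells are sorted by their set \<open>A\<close> of old vertices. A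
  cell with old vertices \<open>A\<close> consists of \<open>A\<close> and some of the whiskers not adjacent to \<open>A\<close>, including
  those in the support of \<open>a\<close>; if a whisker not adjacent to \<open>A\<close> is outside the support, then adding
  and removing it matches all cells over \<open>A\<close>. The unmatched cells are the facets \<open>F\<close> of \<open>D\<close> that
  contain the support of \<open>a\<close> and whose whiskers all lie in it. Since they are maximal, all cochains on
  them are cocycles, and clearing the layers in the order of \<open>card A\<close> shows that they represent a
  basis of the cohomology (\<open>reduce_to_critical\<close>, \<open>critical_coboundary_zero\<close>).

  Hence the part of degree \<open>l\<close> of the \<open>j\<close>-th local cohomology has as dimension the number of pairs
  \<open>(F, a)\<close> with \<open>F\<close> a facet of \<open>j\<close> elements, \<open>a \<le> 0\<close> of total degree \<open>l\<close>, and support of \<open>a\<close>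
  between the whiskers in \<open>F\<close> and \<open>F\<close> (\<open>cohomology_degree_dim\<close>). If \<open>F - T\<close> is the support, with
  \<open>T\<close> a set of old vertices in \<open>F\<close>, then the number of such \<open>a\<close> is the coefficient of \<open>t\<^sup>l\<close> in the power
  of \<open>t\<^bsup>-1\<^esup> / (1 - t\<^bsup>-1\<^esup>)\<close> with exponent \<open>j - card T\<close> (\<open>card_negative_compositions\<close>). Grouping the
  sets \<open>T\<close> by cardinality yields the binomial coefficients, and the facets are the complements of
  the minimal vertex covers.
\<close>

abbreviation (input) keys :: "('a \<Rightarrow>\<^sub>0 'b :: zero) \<Rightarrow> 'a set" where
  "keys \<equiv> Poly_Mapping.keys"

abbreviation (input) lookup :: "('a \<Rightarrow>\<^sub>0 'b :: zero) \<Rightarrow> 'a \<Rightarrow> 'b" where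
  "lookup \<equiv> Poly_Mapping.lookup"


section \<open>Cochains on families of finite sets\<close>

text \<open>The sign of deleting \<open>i\<close> from \<open>\<tau>\<close> in the simplicial coboundary, for the usual order of the vertices.\<close>

definition incidence_sign :: "nat \<Rightarrow> nat set \<Rightarrow> 'k :: comm_ring_1" where
  "incidence_sign i \<tau> = (-1) ^ card {k\<in>\<tau>. k < i}"

text \<open>The simplicial coboundary of cochains that live on the family \<open>Q\<close> only: a cochain is a function
  that vanishes outside \<open>Q\<close>, and the coboundary is set to \<open>0\<close> there.\<close>

definition cell_coboundary ::
    "nat set set \<Rightarrow> (nat set \<Rightarrow> 'k :: comm_ring_1) \<Rightarrow> nat set \<Rightarrow> 'k" where
  "cell_coboundary Q f \<tau> =
     (if \<tau> \<in> Q then \<Sum>i\<in>\<tau>. incidence_sign i \<tau> * f (\<tau> - {i}) else 0)"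

text \<open>\<open>f\<close> vanishes outside \<open>Q\<close>.\<close>

definition supported_on :: "('a \<Rightarrow> 'k :: zero) \<Rightarrow> 'a set \<Rightarrow> bool" where
  "supported_on f Q \<longleftrightarrow> (\<forall>\<sigma>. \<sigma> \<notin> Q \<longrightarrow> f \<sigma> = 0)"

lemma incidence_sign_square [simp]: "incidence_sign i \<tau> * incidence_sign i \<tau> = 1"
  by (simp add: incidence_sign_def flip: power_add mult_2)

lemma incidence_sign_cong:
  "{k\<in>\<tau>. k < i} = {k\<in>\<rho>. k < i} \<Longrightarrow> incidence_sign i \<tau> = incidence_sign i \<rho>"
  by (simp add: incidence_sign_def)

lemma incidence_sign_swap_less:
  assumes "finite \<tau>" "i \<in> \<tau>" "k \<in> \<tau>" "i < k"
  shows "incidence_sign i \<tau> * incidence_sign k (\<tau> - {i}) =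
    - (incidence_sign k \<tau> * incidence_sign i (\<tau> - {k}) :: 'k :: comm_ring_1)"
proof -
  have i: "incidence_sign i (\<tau> - {k}) = (incidence_sign i \<tau> :: 'k)"
    using assms by (intro incidence_sign_cong) auto
  have "{l\<in>\<tau>. l < k} = insert i {l\<in>\<tau> - {i}. l < k}"
    using assms by auto
  moreover have "finite {l\<in>\<tau> - {i}. l < k}" "i \<notin> {l\<in>\<tau> - {i}. l < k}"
    using assms by auto
  ultimately have "card {l\<in>\<tau>. l < k} = Suc (card {l\<in>\<tau> - {i}. l < k})"
    by (metis card_insert_disjoint)
  then have k: "incidence_sign k \<tau> = (- incidence_sign k (\<tau> - {i}) :: 'k)"
    by (simp add: incidence_sign_def)
  show ?thesis
    by (simp add: i k)
qed

lemma incidence_sign_swap: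
  assumes "finite \<tau>" "i \<in> \<tau>" "k \<in> \<tau>" "i \<noteq> k"
  shows "incidence_sign i \<tau> * incidence_sign k (\<tau> - {i}) =
    - (incidence_sign k \<tau> * incidence_sign i (\<tau> - {k}) :: 'k :: comm_ring_1)"
proof (cases "i < k")
  case True
  then show ?thesis
    using assms incidence_sign_swap_less by blast
next
  case False
  then have "k < i"
    using assms by simp
  then have "incidence_sign k \<tau> * incidence_sign i (\<tau> - {k}) =
    - (incidence_sign i \<tau> * incidence_sign k (\<tau> - {i}) :: 'k)"
    using assms incidence_sign_swap_less[of \<tau> k i] by blast
  then show ?thesis
    by simp
qed

lemma sign_exchange:
  fixes a b c e :: "'k :: comm_ring_1"
  assumes "a * a = 1" "e * e = 1" "e * b = - (c * a)"
  shows "a * b = - (c * e)"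
proof -
  have "a * b = (e * e) * (a * b)"
    using assms(2) by simp
  also have "\<dots> = (e * b) * (a * e)"
    by (simp only: ac_simps)
  also have "\<dots> = - ((a * a) * (c * e))"
    unfolding assms(3) by (simp add: ac_simps)
  finally show ?thesis
    using assms(1) by simp
qed

lemma sum_alternating_pairs:
  fixes t :: "nat \<Rightarrow> nat \<Rightarrow> 'k :: comm_ring_1"
  assumes "finite \<tau>" and "\<And>i k. i \<in> \<tau> \<Longrightarrow> k \<in> \<tau> \<Longrightarrow> i \<noteq> k \<Longrightarrow> t i k = - t k i"
  shows "(\<Sum>i\<in>\<tau>. \<Sum>k\<in>\<tau> - {i}. t i k) = 0"
proof -
  have "(\<Sum>i\<in>\<tau>. \<Sum>k\<in>\<tau> - {i}. t i k) =
      (\<Sum>i\<in>\<tau>. (\<Sum>k | k \<in> \<tau> \<and> k < i. t i k) + (\<Sum>k | k \<in> \<tau> \<and> i < k. t i k))"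
  proof (intro sum.cong refl)
    fix i
    have "\<tau> - {i} = {k. k \<in> \<tau> \<and> k < i} \<union> {k. k \<in> \<tau> \<and> i < k}"
      by auto
    moreover have "{k. k \<in> \<tau> \<and> k < i} \<inter> {k. k \<in> \<tau> \<and> i < k} = {}"
      by auto
    ultimately show "(\<Sum>k\<in>\<tau> - {i}. t i k) =
        (\<Sum>k | k \<in> \<tau> \<and> k < i. t i k) + (\<Sum>k | k \<in> \<tau> \<and> i < k. t i k)"
      using assms(1) sum.union_disjoint[of "{k. k \<in> \<tau> \<and> k < i}" "{k. k \<in> \<tau> \<and> i < k}" "t i"] by simp
  qed
  also have "\<dots> = (\<Sum>i\<in>\<tau>. \<Sum>k | k \<in> \<tau> \<and> k < i. t i k) + (\<Sum>i\<in>\<tau>. \<Sum>k | k \<in> \<tau> \<and> i < k. t i k)"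
    by (rule sum.distrib)
  also have "(\<Sum>i\<in>\<tau>. \<Sum>k | k \<in> \<tau> \<and> i < k. t i k) = (\<Sum>k\<in>\<tau>. \<Sum>i | i \<in> \<tau> \<and> i < k. t i k)"
    using assms(1) by (rule sum.swap_restrict) (rule assms(1))
  also have "\<dots> = (\<Sum>k\<in>\<tau>. \<Sum>i | i \<in> \<tau> \<and> i < k. - t k i)"
    by (intro sum.cong refl assms(2)) auto
  finally show ?thesis
    by (simp only: sum_negf add.right_inverse)
qed

text \<open>Families of finite sets that contain with two sets everything in between. This is what makes the
  coboundary square to zero: they are the differences of two simplicial complexes.\<close>

locale cell_family =
  fixes Q :: "nat set set"
  assumes finite_cell: "\<sigma> \<in> Q \<Longrightarrow> finite \<sigma>"
    and convex: "\<sigma> \<in> Q \<Longrightarrow> \<tau> \<in> Q \<Longrightarrow> \<sigma> \<subseteq> \<rho> \<Longrightarrow> \<rho> \<subseteq> \<tau> \<Longrightarrow> \<rho> \<in> Q"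
begin

lemma coboundary_supported: "supported_on (cell_coboundary Q f) Q"
  by (simp add: supported_on_def cell_coboundary_def)

lemma coboundary_add:
  "cell_coboundary Q (\<lambda>\<sigma>. f \<sigma> + g \<sigma>) \<tau> = cell_coboundary Q f \<tau> + cell_coboundary Q g \<tau>"
  by (simp add: cell_coboundary_def sum.distrib algebra_simps)

lemma coboundary_diff:
  "cell_coboundary Q (\<lambda>\<sigma>. f \<sigma> - g \<sigma>) \<tau> = cell_coboundary Q f \<tau> - cell_coboundary Q g \<tau>"
  by (simp add: cell_coboundary_def sum_subtractf algebra_simps)

lemma coboundary_coboundary:
  fixes f :: "nat set \<Rightarrow> 'k :: comm_ring_1"
  assumes "supported_on f Q"
  shows "cell_coboundary Q (cell_coboundary Q f) \<tau> = 0"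
proof (cases "\<tau> \<in> Q")
  case True
  have fin: "finite \<tau>"
    using True finite_cell by blast
  have "cell_coboundary Q (cell_coboundary Q f) \<tau> =
      (\<Sum>i\<in>\<tau>. incidence_sign i \<tau> * cell_coboundary Q f (\<tau> - {i}))"
    using True by (simp add: cell_coboundary_def[of _ "cell_coboundary Q f"])
  also have "\<dots> = (\<Sum>i\<in>\<tau>. \<Sum>k\<in>\<tau> - {i}.
      incidence_sign i \<tau> * incidence_sign k (\<tau> - {i}) * f (\<tau> - {i} - {k}))"
  proof (intro sum.cong refl)
    fix i assume "i \<in> \<tau>"
    have "f (\<tau> - {i} - {k}) = 0" if "\<tau> - {i} \<notin> Q" for k
      using that convex[of "\<tau> - {i} - {k}" \<tau> "\<tau> - {i}"] True assms by (auto simp: supported_on_def)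
    then show "incidence_sign i \<tau> * cell_coboundary Q f (\<tau> - {i}) = (\<Sum>k\<in>\<tau> - {i}.
      incidence_sign i \<tau> * incidence_sign k (\<tau> - {i}) * f (\<tau> - {i} - {k}))"
      by (simp add: cell_coboundary_def sum_distrib_left mult.assoc)
  qed
  also have "\<dots> = 0"
  proof (rule sum_alternating_pairs[OF fin])
    fix i k assume "i \<in> \<tau>" "k \<in> \<tau>" "i \<noteq> k"
    moreover have "\<tau> - {i} - {k} = \<tau> - {k} - {i}"
      by auto
    ultimately show "incidence_sign i \<tau> * incidence_sign k (\<tau> - {i}) * f (\<tau> - {i} - {k}) =
       - (incidence_sign k \<tau> * incidence_sign i (\<tau> - {k}) * f (\<tau> - {k} - {i}))"
      using incidence_sign_swap[OF fin, of i k, where 'k = 'k] by simp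
  qed
  finally show ?thesis .
qed (simp add: cell_coboundary_def)

end


section \<open>Contracting layers by toggling a vertex\<close>

text \<open>If toggling \<open>w\<close> preserves \<open>L\<close>, then a cocycle \<open>f\<close> on \<open>L\<close> is the coboundary of the cochain \<open>h\<close>
  that evaluates \<open>f\<close>, with a sign, after adding \<open>w\<close>.\<close>

lemma toggle_contraction:
  fixes f :: "nat set \<Rightarrow> 'k :: comm_ring_1"
  assumes fin: "\<And>\<rho>. \<rho> \<in> L \<Longrightarrow> finite \<rho>"
    and toggle: "\<And>\<rho>. \<rho> \<in> L \<Longrightarrow> insert w \<rho> \<in> L \<and> \<rho> - {w} \<in> L"
    and cocycle: "\<And>\<rho>. \<rho> \<in> L \<Longrightarrow> (\<Sum>i | i \<in> \<rho> \<and> \<rho> - {i} \<in> L. incidence_sign i \<rho> * f (\<rho> - {i})) = 0"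
    and h: "\<And>\<rho>. \<rho> \<in> L \<Longrightarrow>
      h \<rho> = (if w \<in> \<rho> then 0 else incidence_sign w (insert w \<rho>) * f (insert w \<rho>))"
    and "\<tau> \<in> L"
  shows "(\<Sum>i | i \<in> \<tau> \<and> \<tau> - {i} \<in> L. incidence_sign i \<tau> * h (\<tau> - {i})) = f \<tau>"
proof (cases "w \<in> \<tau>")
  case True
  have "(\<Sum>i | i \<in> \<tau> \<and> \<tau> - {i} \<in> L. incidence_sign i \<tau> * h (\<tau> - {i})) =
      (\<Sum>i\<in>{w}. incidence_sign i \<tau> * h (\<tau> - {i}))"
    using True fin[OF \<open>\<tau> \<in> L\<close>] toggle[OF \<open>\<tau> \<in> L\<close>] by (intro sum.mono_neutral_right) (auto simp: h)
  also have "\<dots> = incidence_sign w \<tau> * (incidence_sign w \<tau> * f \<tau>)"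
    using True toggle[OF \<open>\<tau> \<in> L\<close>] by (simp add: h insert_absorb)
  finally show ?thesis
    by (simp flip: mult.assoc)
next
  case False
  define T where "T = {i. i \<in> \<tau> \<and> \<tau> - {i} \<in> L}"
  let ?\<tau>' = "insert w \<tau>"
  have finT: "finite T" "w \<notin> T"
    using False fin[OF \<open>\<tau> \<in> L\<close>] by (auto simp: T_def)
  have toggle_face: "?\<tau>' - {i} \<in> L \<longleftrightarrow> \<tau> - {i} \<in> L" if "i \<in> \<tau>" for i
  proof -
    have "?\<tau>' - {i} = insert w (\<tau> - {i})" "\<tau> - {i} = ?\<tau>' - {i} - {w}"
      using that False by auto
    then show ?thesis
      using toggle by metis
  qed
  have "{i. i \<in> ?\<tau>' \<and> ?\<tau>' - {i} \<in> L} = insert w T"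
    using False \<open>\<tau> \<in> L\<close> toggle_face by (auto simp: T_def)
  moreover have "?\<tau>' \<in> L"
    using toggle \<open>\<tau> \<in> L\<close> by blast
  ultimately have "(\<Sum>i\<in>insert w T. incidence_sign i ?\<tau>' * f (?\<tau>' - {i})) = 0"
    using cocycle[of ?\<tau>'] by simp
  then have *: "incidence_sign w ?\<tau>' * f \<tau> + (\<Sum>i\<in>T. incidence_sign i ?\<tau>' * f (?\<tau>' - {i})) = 0"
    using finT False by simp
  have "(\<Sum>i\<in>T. incidence_sign i \<tau> * h (\<tau> - {i})) =
      (\<Sum>i\<in>T. - (incidence_sign w ?\<tau>' * (incidence_sign i ?\<tau>' * f (?\<tau>' - {i}))))"
  proof (intro sum.cong refl)
    fix i assume i: "i \<in> T"
    then have iw: "insert w (\<tau> - {i}) = ?\<tau>' - {i}" and "?\<tau>' - {w} = \<tau>"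
      using False by (auto simp: T_def)
    then have "incidence_sign i ?\<tau>' * incidence_sign w (?\<tau>' - {i}) =
        - (incidence_sign w ?\<tau>' * incidence_sign i \<tau> :: 'k)"
      using incidence_sign_swap[of ?\<tau>' i w, where 'k = 'k] fin[OF \<open>\<tau> \<in> L\<close>] i False
      by (auto simp: T_def)
    then have "incidence_sign i \<tau> * incidence_sign w (?\<tau>' - {i}) =
        - (incidence_sign w ?\<tau>' * incidence_sign i ?\<tau>' :: 'k)"
      by (rule sign_exchange[OF incidence_sign_square incidence_sign_square])
    then show "incidence_sign i \<tau> * h (\<tau> - {i}) =
        - (incidence_sign w ?\<tau>' * (incidence_sign i ?\<tau>' * f (?\<tau>' - {i})))"
      using i False iw by (simp add: T_def h flip: mult.assoc)
  qed
  also have "\<dots> = - (incidence_sign w ?\<tau>' * (\<Sum>i\<in>T. incidence_sign i ?\<tau>' * f (?\<tau>' - {i})))"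
    by (simp add: sum_negf sum_distrib_left)
  also have "(\<Sum>i\<in>T. incidence_sign i ?\<tau>' * f (?\<tau>' - {i})) = - (incidence_sign w ?\<tau>' * f \<tau>)"
    using * by (simp add: eq_neg_iff_add_eq_0 add.commute)
  finally show ?thesis
    by (simp add: T_def flip: mult.assoc)
qed

text \<open>The sets of \<open>Q\<close> with the same intersection \<open>A\<close> with \<open>Y\<close> form a layer. A toggle element of the layer
  is a vertex outside \<open>Y\<close> that can be added to and removed from each of its sets without leaving \<open>Q\<close>.\<close>

definition toggle_element :: "nat set set \<Rightarrow> nat set \<Rightarrow> nat set \<Rightarrow> nat \<Rightarrow> bool" where
  "toggle_element Q Y A w \<longleftrightarrow> w \<notin> Y \<and> (\<forall>\<rho>\<in>Q. \<rho> \<inter> Y = A \<longrightarrow> insert w \<rho> \<in> Q \<and> \<rho> - {w} \<in> Q)"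

text \<open>The sets in those layers that have no toggle element.\<close>

definition critical_cells :: "nat set set \<Rightarrow> nat set \<Rightarrow> nat set set" where
  "critical_cells Q Y = {\<sigma> \<in> Q. \<nexists>w. toggle_element Q Y (\<sigma> \<inter> Y) w}"

text \<open>Layers are ordered by the size of their labels \<open>A \<subseteq> Y\<close>. The maximality of critical cells
  excludes any interaction between a critical cell and a later layer.\<close>

locale layered_cell_family = cell_family +
  fixes Y :: "nat set"
  assumes finite_labels: "finite Y"
    and critical_maximal: "\<sigma> \<in> critical_cells Q Y \<Longrightarrow> \<tau> \<in> Q \<Longrightarrow> \<sigma> \<subseteq> \<tau> \<Longrightarrow> \<tau> = \<sigma>"
begin

abbreviation "C \<equiv> critical_cells Q Y"

lemma coboundary_critical:
  assumes "supported_on f C"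
  shows "cell_coboundary Q f \<tau> = 0"
proof (cases "\<tau> \<in> Q")
  case True
  have "f (\<tau> - {i}) = 0" if "i \<in> \<tau>" for i
    using that critical_maximal[of "\<tau> - {i}" \<tau>] True assms by (auto simp: supported_on_def)
  then show ?thesis
    by (simp add: cell_coboundary_def)
qed (simp add: cell_coboundary_def)

text \<open>Induction over the layers: once \<open>f\<close> is a coboundary on all noncritical cells of smaller label, the
  remaining difference is supported, in the earlier layers, on critical cells. As these are maximal,
  its coboundary on a layer involves this layer only, and the toggle element of the layer provides
  a correction.\<close>

lemma clear_layers:
  fixes f :: "nat set \<Rightarrow> 'k :: comm_ring_1"
  assumes f: "supported_on f Q" and df: "\<And>\<tau>. \<tau> \<in> Q - C \<Longrightarrow> cell_coboundary Q f \<tau> = 0"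
  shows "\<exists>g. supported_on g Q \<and>
    (\<forall>\<sigma>\<in>Q - C. card (\<sigma> \<inter> Y) < m \<longrightarrow> f \<sigma> = cell_coboundary Q g \<sigma>)"
proof (induction m)
  case 0
  show ?case
    by (intro exI[of _ "\<lambda>_. 0"]) (simp add: supported_on_def)
next
  case (Suc m)
  then obtain g where g: "supported_on g Q"
    and fg: "\<And>\<sigma>. \<sigma> \<in> Q - C \<Longrightarrow> card (\<sigma> \<inter> Y) < m \<Longrightarrow> f \<sigma> = cell_coboundary Q g \<sigma>"
    by blast
  define f' where "f' = (\<lambda>\<sigma>. f \<sigma> - cell_coboundary Q g \<sigma>)"
  have f': "supported_on f' Q"
    using f coboundary_supported[of g] by (simp add: f'_def supported_on_def)
  have df': "cell_coboundary Q f' \<tau> = 0" if "\<tau> \<in> Q - C" for \<tau>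
    using that by (simp add: f'_def coboundary_diff df coboundary_coboundary[OF g])
  define w where "w = (\<lambda>A. SOME w. toggle_element Q Y A w)"
  define h where "h = (\<lambda>\<sigma>. if \<sigma> \<in> Q - C \<and> card (\<sigma> \<inter> Y) = m \<and> w (\<sigma> \<inter> Y) \<notin> \<sigma>
    then incidence_sign (w (\<sigma> \<inter> Y)) (insert (w (\<sigma> \<inter> Y)) \<sigma>) * f' (insert (w (\<sigma> \<inter> Y)) \<sigma>) else 0)"
  have h: "supported_on h Q"
    by (simp add: h_def supported_on_def)
  have smaller: "card ((\<tau> - {i}) \<inter> Y) < card (\<tau> \<inter> Y)" if "i \<in> \<tau> \<inter> Y" for \<tau> i
    using that finite_labels by (intro psubset_card_mono) auto
  have "f' \<sigma> = cell_coboundary Q h \<sigma>" if \<sigma>: "\<sigma> \<in> Q - C" and le: "card (\<sigma> \<inter> Y) \<le> m" for \<sigma>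
  proof (cases "card (\<sigma> \<inter> Y) = m")
    case False
    then have "card ((\<sigma> - {i}) \<inter> Y) < m" for i
    proof -
      have "card ((\<sigma> - {i}) \<inter> Y) \<le> card (\<sigma> \<inter> Y)"
        using finite_labels by (intro card_mono) auto
      then show ?thesis
        using False le by linarith
    qed
    then have "h (\<sigma> - {i}) = 0" for i
      by (simp add: h_def less_imp_neq)
    then show ?thesis
      using False le \<sigma> by (simp add: cell_coboundary_def f'_def fg)
  next
    case True
    define L where "L = {\<rho> \<in> Q. \<rho> \<inter> Y = \<sigma> \<inter> Y}"
    let ?w = "w (\<sigma> \<inter> Y)"
    have "toggle_element Q Y (\<sigma> \<inter> Y) ?w"
      unfolding w_def by (rule someI_ex) (use \<sigma> in \<open>auto simp: critical_cells_def\<close>)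
    then have wY: "?w \<notin> Y" and tog: "\<And>\<rho>. \<rho> \<in> L \<Longrightarrow> insert ?w \<rho> \<in> Q \<and> \<rho> - {?w} \<in> Q"
      by (auto simp: toggle_element_def L_def)
    have LC: "\<rho> \<in> Q - C" if "\<rho> \<in> L" for \<rho>
      using that \<sigma> by (auto simp: L_def critical_cells_def)
    have L_faces: "\<tau> - {i} \<in> L \<longleftrightarrow> \<tau> - {i} \<in> Q \<and> i \<notin> Y" if "\<tau> \<in> L" "i \<in> \<tau>" for \<tau> i
      using that by (auto simp: L_def)
    have "(\<Sum>i | i \<in> \<sigma> \<and> \<sigma> - {i} \<in> L. incidence_sign i \<sigma> * h (\<sigma> - {i})) = f' \<sigma>"
    proof (rule toggle_contraction[where w = ?w])
      show "insert ?w \<rho> \<in> L \<and> \<rho> - {?w} \<in> L" if "\<rho> \<in> L" for \<rho>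
        using that tog[OF that] wY by (auto simp: L_def)
      show "finite \<rho>" if "\<rho> \<in> L" for \<rho>
        using that finite_cell by (auto simp: L_def)
      show "\<sigma> \<in> L"
        using \<sigma> by (simp add: L_def)
      show "h \<rho> = (if ?w \<in> \<rho> then 0 else incidence_sign ?w (insert ?w \<rho>) * f' (insert ?w \<rho>))"
        if "\<rho> \<in> L" for \<rho>
        using that LC[OF that] True by (simp add: h_def L_def)
      show "(\<Sum>i | i \<in> \<rho> \<and> \<rho> - {i} \<in> L. incidence_sign i \<rho> * f' (\<rho> - {i})) = 0" if "\<rho> \<in> L" for \<rho>
      proof -
        have rank: "card (\<rho> \<inter> Y) = m"
          using that True by (simp add: L_def)
        \<comment> \<open>Deleting a label lands in an earlier layer, where \<open>f'\<close> lives on critical cells; but these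
          are maximal, hence not faces of \<open>\<rho>\<close>.\<close>
        have "f' (\<rho> - {i}) = 0" if i: "i \<in> \<rho>" "\<rho> - {i} \<notin> L" for i
        proof (cases "\<rho> - {i} \<in> Q")
          case in_Q: True
          then have "i \<in> Y"
            using L_faces[OF \<open>\<rho> \<in> L\<close> i(1)] i(2) by blast
          then have "card ((\<rho> - {i}) \<inter> Y) < m"
            using smaller[of i \<rho>] i(1) rank by simp
          moreover have "\<rho> - {i} \<notin> C"
            using critical_maximal[of "\<rho> - {i}" \<rho>] \<open>\<rho> \<in> L\<close> i(1) by (auto simp: L_def)
          ultimately show ?thesis
            using in_Q fg by (simp add: f'_def)
        qed (use f' in \<open>simp add: supported_on_def\<close>)
        then have "(\<Sum>i | i \<in> \<rho> \<and> \<rho> - {i} \<in> L. incidence_sign i \<rho> * f' (\<rho> - {i})) =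
            (\<Sum>i\<in>\<rho>. incidence_sign i \<rho> * f' (\<rho> - {i}))"
          using that finite_cell by (intro sum.mono_neutral_left) (auto simp: L_def)
        also have "\<dots> = 0"
          using df'[OF LC[OF that]] that by (simp add: cell_coboundary_def L_def)
        finally show ?thesis .
      qed
    qed
    moreover have "(\<Sum>i | i \<in> \<sigma> \<and> \<sigma> - {i} \<in> L. incidence_sign i \<sigma> * h (\<sigma> - {i})) =
        (\<Sum>i\<in>\<sigma>. incidence_sign i \<sigma> * h (\<sigma> - {i}))"
    proof (rule sum.mono_neutral_left)
      show "finite \<sigma>"
        using \<sigma> finite_cell by blast
      have "h (\<sigma> - {i}) = 0" if "i \<in> \<sigma>" "\<sigma> - {i} \<notin> L" for i
      proof (cases "i \<in> Y")
        case True
        then show ?thesis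
          using smaller[of i \<sigma>] that(1) \<open>card (\<sigma> \<inter> Y) = m\<close> by (simp add: h_def)
      next
        case False
        then have "\<sigma> - {i} \<notin> Q"
          using L_faces[of \<sigma> i] that \<sigma> by (auto simp: L_def)
        then show ?thesis
          by (simp add: h_def)
      qed
      then show "\<forall>i\<in>\<sigma> - {i. i \<in> \<sigma> \<and> \<sigma> - {i} \<in> L}. incidence_sign i \<sigma> * h (\<sigma> - {i}) = 0"
        by simp
    qed simp
    ultimately show ?thesis
      using \<sigma> by (simp add: cell_coboundary_def)
  qed
  then have "f \<sigma> = cell_coboundary Q (\<lambda>\<sigma>. g \<sigma> + h \<sigma>) \<sigma>"
    if "\<sigma> \<in> Q - C" "card (\<sigma> \<inter> Y) < Suc m" for \<sigma>
    using that by (simp add: coboundary_add f'_def diff_eq_eq add.commute)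
  moreover have "supported_on (\<lambda>\<sigma>. g \<sigma> + h \<sigma>) Q"
    using g h by (simp add: supported_on_def)
  ultimately show ?case
    by (intro exI[of _ "\<lambda>\<sigma>. g \<sigma> + h \<sigma>"]) blast
qed

text \<open>Existence of a representative that is supported on the critical cells.\<close>

lemma reduce_to_critical:
  fixes f :: "nat set \<Rightarrow> 'k :: comm_ring_1"
  assumes "supported_on f Q" and "\<And>\<tau>. \<tau> \<in> Q - C \<Longrightarrow> cell_coboundary Q f \<tau> = 0"
  shows "\<exists>g. supported_on g Q \<and> supported_on (\<lambda>\<sigma>. f \<sigma> - cell_coboundary Q g \<sigma>) C"
proof -
  obtain g where g: "supported_on g Q"
    and fg: "\<forall>\<sigma>\<in>Q - C. card (\<sigma> \<inter> Y) < Suc (card Y) \<longrightarrow> f \<sigma> = cell_coboundary Q g \<sigma>"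
    using clear_layers[OF assms] by blast
  have "card (\<sigma> \<inter> Y) < Suc (card Y)" for \<sigma>
    using finite_labels by (simp add: card_mono less_Suc_eq_le)
  then have "f \<sigma> = cell_coboundary Q g \<sigma>" if "\<sigma> \<notin> C" for \<sigma>
    using that fg assms(1) coboundary_supported[of g] by (cases "\<sigma> \<in> Q") (auto simp: supported_on_def)
  then show ?thesis
    using g by (auto simp: supported_on_def)
qed

text \<open>Uniqueness of the representative. Applying the reduction to \<open>g\<close> itself changes it by a coboundary
  into a cochain on critical cells, and the coboundary of the latter vanishes.\<close>

lemma critical_coboundary_zero:
  fixes g :: "nat set \<Rightarrow> 'k :: comm_ring_1"
  assumes g: "supported_on g Q" and dg: "supported_on (cell_coboundary Q g) C"
  shows "cell_coboundary Q g \<tau> = 0"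
proof -
  obtain h where h: "supported_on h Q" and gh: "supported_on (\<lambda>\<sigma>. g \<sigma> - cell_coboundary Q h \<sigma>) C"
    using reduce_to_critical[OF g] dg by (auto simp: supported_on_def)
  show ?thesis
    using coboundary_critical[OF gh, of \<tau>] coboundary_coboundary[OF h, of \<tau>]
    by (simp add: coboundary_diff)
qed

end


section \<open>Transport of structure\<close>

lemma sum_fun_apply: "(\<Sum>i\<in>S. f i) x = (\<Sum>i\<in>S. f i x)"
  by (induction S rule: infinite_finite_induct) auto

text \<open>A structure whose carrier and addition are the image of an additive subgroup \<open>A\<close> of a type; \<open>K\<close>
  need not be injective.\<close>

locale additive_image =
  fixes A :: "'a :: ab_group_add set" and G (structure) and K
  assumes zero_mem: "0 \<in> A" and add_mem: "x \<in> A \<Longrightarrow> y \<in> A \<Longrightarrow> x + y \<in> A"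
    and uminus_mem: "x \<in> A \<Longrightarrow> - x \<in> A"
    and carrier_image: "carrier G = K ` A"
    and image_add: "x \<in> A \<Longrightarrow> y \<in> A \<Longrightarrow> K x \<oplus> K y = K (x + y)"
    and image_zero: "\<zero> = K 0"
begin

lemma abelian_group: "abelian_group G"
proof (rule abelian_groupI)
  fix x assume "x \<in> carrier G"
  then obtain a where "a \<in> A" "x = K a"
    by (auto simp: carrier_image)
  then show "\<exists>y\<in>carrier G. y \<oplus> x = \<zero>"
    by (intro bexI[of _ "K (- a)"]) (simp_all add: image_add uminus_mem image_zero carrier_image)
qed (auto simp: carrier_image image_zero image_add add_mem zero_mem ac_simps)

lemma finsum_image: "\<phi> \<in> S \<rightarrow> A \<Longrightarrow> finite S \<Longrightarrow> finsum G (\<lambda>i. K (\<phi> i)) S = K (\<Sum>i\<in>S. \<phi> i)"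
proof -
  interpret abelian_group G
    by (rule abelian_group)
  have "finsum G (\<lambda>i. K (\<phi> i)) S = K (\<Sum>i\<in>S. \<phi> i) \<and> (\<Sum>i\<in>S. \<phi> i) \<in> A"
    if "finite S" "\<phi> \<in> S \<rightarrow> A"
    using that
  proof (induction S)
    case (insert i S)
    then have "(\<lambda>i. K (\<phi> i)) \<in> S \<rightarrow> carrier G" "K (\<phi> i) \<in> carrier G"
      by (auto simp: carrier_image)
    then show ?case
      using insert by (simp add: image_add add_mem)
  qed (simp add: image_zero zero_mem)
  then show "\<phi> \<in> S \<rightarrow> A \<Longrightarrow> finite S \<Longrightarrow> ?thesis"
    by blast
qed

lemma minus_image: "x \<in> A \<Longrightarrow> \<ominus> K x = K (- x)"
proof -
  interpret abelian_group G
    by (rule abelian_group)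
  assume "x \<in> A"
  then show ?thesis
    by (intro minus_equality) (auto simp: image_add uminus_mem carrier_image image_zero)
qed

end

lemma vectorspace_image:
  assumes "vectorspace K V" and inj: "inj_on T (carrier V)" and image: "T ` carrier V = carrier W"
    and add: "\<And>x y. x \<in> carrier V \<Longrightarrow> y \<in> carrier V \<Longrightarrow> T (x \<oplus>\<^bsub>V\<^esub> y) = T x \<oplus>\<^bsub>W\<^esub> T y"
    and smult: "\<And>c x. c \<in> carrier K \<Longrightarrow> x \<in> carrier V \<Longrightarrow> T (c \<odot>\<^bsub>V\<^esub> x) = c \<odot>\<^bsub>W\<^esub> T x"
    and zero: "T \<zero>\<^bsub>V\<^esub> = \<zero>\<^bsub>W\<^esub>" and fin_dim_V: "vectorspace.fin_dim K V"
  shows "vectorspace.fin_dim K W" and "vectorspace.dim K W = vectorspace.dim K V"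
proof -
  interpret V: vectorspace K V
    by fact
  note image_eqs = image[symmetric] add[symmetric] smult[symmetric] zero[symmetric]
  have "abelian_group W"
  proof (rule abelian_groupI)
    fix x assume "x \<in> carrier W"
    then obtain a where "a \<in> carrier V" "x = T a"
      by (auto simp flip: image)
    then show "\<exists>y\<in>carrier W. y \<oplus>\<^bsub>W\<^esub> x = \<zero>\<^bsub>W\<^esub>"
      by (intro bexI[of _ "T (\<ominus>\<^bsub>V\<^esub> a)"]) (auto simp: image_eqs V.l_neg)
  qed (auto simp: image_eqs V.a_ac)
  then have "module K W"
    by (intro module.intro module_axioms.intro V.R.is_cring)
      (auto simp: image_eqs V.smult_l_distr V.smult_r_distr V.smult_assoc1)
  then have "vectorspace K W"
    by (intro vectorspace.intro V.field_axioms)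
  then interpret linear_map K V W T
    using assms(1) image add smult
    by (intro linear_map.intro mod_hom.intro mod_hom_axioms.intro)
      (auto simp: vectorspace_def module_hom_def)
  show "vectorspace.fin_dim K W"
    by (rule surj_fin_dim[OF fin_dim_V image])
  show "vectorspace.dim K W = vectorspace.dim K V"
    by (rule dim_eq[OF fin_dim_V inj image, symmetric])
qed


section \<open>Polynomials and their Laurent coefficients\<close>

lemma polynomial_ring_simps [simp]:
  "p \<in> carrier (polynomial_ring V) \<longleftrightarrow> (\<forall>a\<in>keys p. keys a \<subseteq> V)"
  "p \<oplus>\<^bsub>polynomial_ring V\<^esub> q = p + q" "p \<otimes>\<^bsub>polynomial_ring V\<^esub> q = p * q"
  "\<zero>\<^bsub>polynomial_ring V\<^esub> = 0" "\<one>\<^bsub>polynomial_ring V\<^esub> = 1"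
  by (simp_all add: polynomial_ring_def)

lemma keys_add_exponent: "keys (a + b :: 'x \<Rightarrow>\<^sub>0 nat) = keys a \<union> keys b"
  by (auto simp: in_keys_iff lookup_add)

lemma polynomial_ring_add_closed:
  "p \<in> carrier (polynomial_ring V) \<Longrightarrow> q \<in> carrier (polynomial_ring V) \<Longrightarrow>
   p + q \<in> carrier (polynomial_ring V)"
  using keys_add[of p q] by auto

lemma polynomial_ring_mult_closed:
  assumes "p \<in> carrier (polynomial_ring V)" "q \<in> carrier (polynomial_ring V)"
  shows "p * q \<in> carrier (polynomial_ring V)"
proof -
  have "keys a \<subseteq> V" if a: "a \<in> keys (p * q)" for a
  proof -
    obtain b c where "a = b + c" "b \<in> keys p" "c \<in> keys q"
      using a keys_mult[of p q] by blast
    then show ?thesis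
      using assms by (auto simp: keys_add_exponent)
  qed
  then show ?thesis
    by simp
qed

lemma cring_polynomial_ring: "cring (polynomial_ring V :: ('x, 'k :: field) mpol ring)"
proof (rule cringI)
  show "abelian_group (polynomial_ring V :: ('x, 'k) mpol ring)"
  proof (rule abelian_groupI)
    show "\<zero>\<^bsub>polynomial_ring V\<^esub> \<in> carrier (polynomial_ring V :: ('x, 'k) mpol ring)"
      by simp
  next
    fix p :: "('x, 'k) mpol" assume "p \<in> carrier (polynomial_ring V)"
    then show "\<exists>q\<in>carrier (polynomial_ring V). q \<oplus>\<^bsub>polynomial_ring V\<^esub> p = \<zero>\<^bsub>polynomial_ring V\<^esub>"
      by (intro bexI[of _ "- p"]) (auto simp: in_keys_iff)
  qed (auto simp: ac_simps simp del: polynomial_ring_simps(1) intro: polynomial_ring_add_closed)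
  show "comm_monoid (polynomial_ring V :: ('x, 'k) mpol ring)"
  proof (rule comm_monoidI)
    show "\<one>\<^bsub>polynomial_ring V\<^esub> \<in> carrier (polynomial_ring V :: ('x, 'k) mpol ring)"
      by simp
  qed (auto simp: ac_simps simp del: polynomial_ring_simps(1) intro: polynomial_ring_mult_closed)
qed (simp add: algebra_simps)

lemma polynomial_ring_minus [simp]:
  fixes p q :: "('x, 'k :: field) mpol"
  assumes "p \<in> carrier (polynomial_ring V)" "q \<in> carrier (polynomial_ring V)"
  shows "p \<ominus>\<^bsub>polynomial_ring V\<^esub> q = p - q"
proof -
  interpret cring "polynomial_ring V :: ('x, 'k) mpol ring"
    by (rule cring_polynomial_ring)
  have "- q \<in> carrier (polynomial_ring V)"
    using assms(2) by (auto simp: in_keys_iff)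
  then have "\<ominus>\<^bsub>polynomial_ring V\<^esub> q = - q"
    using assms(2) by (intro minus_equality) auto
  then show ?thesis
    by (simp add: a_minus_def)
qed

lemma lookup_monomial_mult: "lookup (Poly_Mapping.single b c * p) (b + e) = c * lookup p e"
  for b :: "'x \<Rightarrow>\<^sub>0 nat"
  by (simp add: lookup_mult lookup_single when_mult)

lemma keys_monomial_mult:
  "k \<in> keys (Poly_Mapping.single b c * p) \<Longrightarrow> \<exists>e\<in>keys p. k = b + e" for b :: "'x \<Rightarrow>\<^sub>0 nat"
  using keys_mult[of "Poly_Mapping.single b c" p] by (auto split: if_splits)

text \<open>Exponents of monomials as exponents of Laurent monomials.\<close>

definition int_exponent :: "('x \<Rightarrow>\<^sub>0 nat) \<Rightarrow> 'x \<Rightarrow> int" where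
  "int_exponent e = (\<lambda>v. int (lookup e v))"

text \<open>The coefficient of a Laurent monomial in a polynomial; it is \<open>0\<close> if the exponent has a negative
  entry.\<close>

definition laurent_coeff :: "('x, 'k :: zero) mpol \<Rightarrow> ('x \<Rightarrow> int) \<Rightarrow> 'k" where
  "laurent_coeff p a = (if a \<in> range int_exponent then lookup p (the_inv int_exponent a) else 0)"

lemma inj_int_exponent: "inj int_exponent"
  by (rule injI) (auto simp: int_exponent_def fun_eq_iff intro: poly_mapping_eqI)

lemma int_exponent_add: "int_exponent (a + b) = int_exponent a + int_exponent b"
  by (simp add: int_exponent_def fun_eq_iff lookup_add)

lemma int_exponent_zero [simp]: "int_exponent 0 = 0"
  by (simp add: int_exponent_def fun_eq_iff)

lemma laurent_coeff_int_exponent [simp]: "laurent_coeff p (int_exponent e) = lookup p e"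
  by (simp add: laurent_coeff_def the_inv_f_f[OF inj_int_exponent])

lemma laurent_coeff_nonzero: "laurent_coeff p a \<noteq> 0 \<Longrightarrow> \<exists>e\<in>keys p. a = int_exponent e"
  by (auto simp: laurent_coeff_def the_inv_f_f[OF inj_int_exponent] in_keys_iff split: if_splits)

lemma laurent_coeff_add: "laurent_coeff (p + q) a = laurent_coeff p a + laurent_coeff q a"
  by (simp add: laurent_coeff_def lookup_add)

lemma laurent_coeff_zero [simp]: "laurent_coeff 0 a = 0"
  by (simp add: laurent_coeff_def)

lemma laurent_coeff_monomial_mult:
  "laurent_coeff (Poly_Mapping.single b c * p) a = c * laurent_coeff p (a - int_exponent b)"
proof (cases "\<exists>e. a = int_exponent (b + e)")
  case True
  then obtain e where "a = int_exponent (b + e)"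
    by blast
  then show ?thesis
    by (simp add: lookup_monomial_mult int_exponent_add)
      (simp add: lookup_monomial_mult flip: int_exponent_add)
next
  case False
  have "laurent_coeff p (a - int_exponent b) = 0"
  proof (rule ccontr)
    assume "laurent_coeff p (a - int_exponent b) \<noteq> 0"
    then obtain e where "a - int_exponent b = int_exponent e"
      using laurent_coeff_nonzero by blast
    then have "a = int_exponent (b + e)"
      by (simp add: int_exponent_add algebra_simps)
    with False show False
      by blast
  qed
  moreover have "laurent_coeff (Poly_Mapping.single b c * p) a = 0"
    using False laurent_coeff_nonzero keys_monomial_mult by metis
  ultimately show ?thesis
    by simp
qed

lemma laurent_coeff_single:
  "laurent_coeff (Poly_Mapping.single e c) a = (if a = int_exponent e then c else 0)"
  by (auto simp: laurent_coeff_def the_inv_f_f[OF inj_int_exponent] lookup_single when_def inj_eq[OF inj_int_exponent])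

text \<open>The multiplicative set generated by the variables in \<open>S\<close>.\<close>

definition monomials :: "'x set \<Rightarrow> ('x, 'k :: field) mpol set" where
  "monomials S = {Poly_Mapping.single b 1 | b. keys b \<subseteq> S}"


section \<open>Localizations of a Stanley-Reisner ring\<close>

text \<open>The Stanley-Reisner ideal of \<open>D\<close>, described as the span of its monomials.\<close>

lemma ideal_nonfaces:
  assumes "\<And>F G. F \<in> D \<Longrightarrow> G \<subseteq> F \<Longrightarrow> G \<in> D"
  shows "ideal {p \<in> carrier (polynomial_ring X). \<forall>e\<in>keys p. keys e \<notin> D}
    (polynomial_ring X :: ('x, 'k :: field) mpol ring)"
    (is "ideal ?I ?R")
proof -
  interpret cring ?R
    by (rule cring_polynomial_ring)
  have mult: "q * p \<in> ?I" if "p \<in> ?I" "q \<in> carrier ?R" for p q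
  proof -
    have "keys e \<notin> D" if e: "e \<in> keys (q * p)" for e
    proof -
      obtain b c where "e = b + c" "c \<in> keys p"
        using e keys_mult[of q p] by blast
      then show ?thesis
        using \<open>p \<in> ?I\<close> assms[of "keys e" "keys c"] by (auto simp: keys_add_exponent)
    qed
    then show ?thesis
      using that polynomial_ring_mult_closed[of q X p] by simp
  qed
  show ?thesis
  proof (rule idealI)
    show "subgroup ?I (add_monoid ?R)"
    proof (rule add.subgroupI)
      show "\<ominus>\<^bsub>?R\<^esub> p \<in> ?I" if "p \<in> ?I" for p
      proof -
        have "\<ominus>\<^bsub>?R\<^esub> p = - p"
          using that by (intro minus_equality) (auto simp: in_keys_iff)
        then show ?thesis
          using that by (auto simp: in_keys_iff)
      qed
      show "p \<oplus>\<^bsub>?R\<^esub> q \<in> ?I" if "p \<in> ?I" "q \<in> ?I" for p q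
        using that keys_add[of p q] by (simp; blast)
      show "?I \<noteq> {}"
        by (auto intro!: exI[of _ 0])
    qed auto
    show "q \<otimes>\<^bsub>?R\<^esub> p \<in> ?I" "p \<otimes>\<^bsub>?R\<^esub> q \<in> ?I" if "p \<in> ?I" "q \<in> carrier ?R" for p q
      using mult[OF that] by (simp_all add: mult.commute)
  qed (rule ring_axioms)
qed

text \<open>\<open>I\<close> is the Stanley-Reisner ideal of the simplicial complex \<open>D\<close> on the vertex set \<open>X\<close>. Not every
  vertex has to be a face.\<close>

locale stanley_reisner =
  fixes X :: "'x set" and D :: "'x set set" and I :: "('x, 'k :: field) mpol set"
  assumes finite_vertices: "finite X"
    and face_vertices: "F \<in> D \<Longrightarrow> F \<subseteq> X"
    and face_mono: "F \<in> D \<Longrightarrow> G \<subseteq> F \<Longrightarrow> G \<in> D"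
    and ideal_eq: "I = {p \<in> carrier (polynomial_ring X). \<forall>e\<in>keys p. keys e \<notin> D}"
begin

abbreviation "R \<equiv> polynomial_ring X :: ('x, 'k) mpol ring"

abbreviation "M \<equiv> residue_module X I"

lemma ideal: "ideal I R"
  unfolding ideal_eq by (rule ideal_nonfaces) (rule face_mono)

sublocale R: cring R
  by (rule cring_polynomial_ring)

sublocale I: ideal I R
  by (rule ideal)

lemma residue_eq_iff:
  assumes "p \<in> carrier R" "q \<in> carrier R"
  shows "I +>\<^bsub>R\<^esub> p = I +>\<^bsub>R\<^esub> q \<longleftrightarrow> (\<forall>e. keys e \<in> D \<longrightarrow> lookup p e = lookup q e)"
proof -
  have "I +>\<^bsub>R\<^esub> p = I +>\<^bsub>R\<^esub> q \<longleftrightarrow> p - q \<in> I"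
    using R.quotient_eq_iff_same_a_r_cos[OF ideal assms] assms by simp
  also have "\<dots> \<longleftrightarrow> (\<forall>e. keys e \<in> D \<longrightarrow> lookup p e = lookup q e)"
  proof -
    have "p - q \<in> carrier R"
      using R.minus_closed[OF assms] assms by simp
    then show ?thesis
      by (auto simp: ideal_eq in_keys_iff lookup_minus)
  qed
  finally show ?thesis .
qed

lemma residue_carrier: "carrier M = (\<lambda>p. I +>\<^bsub>R\<^esub> p) ` carrier R"
  unfolding residue_module_def quotient_module_def regular_module_def
  by (auto simp: A_RCOSETS_def' a_r_coset_def')

lemma residue_add:
  assumes "p \<in> carrier R" "q \<in> carrier R"
  shows "(I +>\<^bsub>R\<^esub> p) \<oplus>\<^bsub>M\<^esub> (I +>\<^bsub>R\<^esub> q) = I +>\<^bsub>R\<^esub> (p + q)"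
proof -
  have "(I +>\<^bsub>R\<^esub> p) \<oplus>\<^bsub>M\<^esub> (I +>\<^bsub>R\<^esub> q) = (I +>\<^bsub>R\<^esub> p) <+>\<^bsub>R\<^esub> (I +>\<^bsub>R\<^esub> q)"
    unfolding residue_module_def quotient_module_def regular_module_def by (simp add: set_add_def')
  then show ?thesis
    using I.a_rcos_sum[OF assms] by simp
qed

lemma residue_zero: "\<zero>\<^bsub>M\<^esub> = I +>\<^bsub>R\<^esub> 0"
proof -
  have "I +>\<^bsub>R\<^esub> \<zero>\<^bsub>R\<^esub> = I"
    by (rule R.a_coset_add_zero) (rule I.a_subset)
  then show ?thesis
    by (simp add: residue_module_def quotient_module_def)
qed

lemma residue_smult:
  assumes "q \<in> carrier R" "p \<in> carrier R"
  shows "q \<odot>\<^bsub>M\<^esub> (I +>\<^bsub>R\<^esub> p) = I +>\<^bsub>R\<^esub> (q * p)"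
proof -
  have "I +>\<^bsub>R\<^esub> (q * x) = I +>\<^bsub>R\<^esub> (q * p)" if x: "x \<in> I +>\<^bsub>R\<^esub> p" for x
  proof -
    obtain i where i: "i \<in> I" "x = i + p"
      using x by (auto simp: a_r_coset_def')
    then have "q * i \<in> I"
      using I.I_l_closed[of i q] assms(1) by simp
    have "x \<in> carrier R"
      using i I.a_subset assms(2) polynomial_ring_add_closed[of i X p] by blast
    then have "q * x \<in> carrier R" "q * p \<in> carrier R"
      using assms polynomial_ring_mult_closed by blast+
    moreover have "q * x - q * p \<in> I"
      using \<open>q * i \<in> I\<close> by (simp add: i algebra_simps)
    ultimately show ?thesis
      using R.quotient_eq_iff_same_a_r_cos[OF ideal, of "q * x" "q * p"] by simp
  qed
  moreover have "p \<in> I +>\<^bsub>R\<^esub> p"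
    using I.a_rcos_self[OF assms(2)] .
  ultimately have "(\<Union>x\<in>I +>\<^bsub>R\<^esub> p. I +>\<^bsub>R\<^esub> (q * x)) = I +>\<^bsub>R\<^esub> (q * p)"
    by blast
  then show ?thesis
    unfolding residue_module_def quotient_module_def regular_module_def by (simp add: a_r_coset_def')
qed

text \<open>The coefficient of the Laurent monomial \<open>x\<^sup>a\<close> in the fraction \<open>p / x\<^sup>b\<close>, in the localization at the
  variables in \<open>S\<close>. Exponents whose support together with \<open>S\<close> is not a face do not contribute,
  as the corresponding monomials vanish in the localization.\<close>

definition local_coeff :: "'x set \<Rightarrow> ('x, 'k) mpol \<Rightarrow> ('x \<Rightarrow>\<^sub>0 nat) \<Rightarrow> ('x \<Rightarrow> int) \<Rightarrow> 'k" where
  "local_coeff S p b a = (if {v. a v \<noteq> 0} \<union> S \<in> D then laurent_coeff p (a + int_exponent b) else 0)"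

text \<open>The exponents of the Laurent monomials that form a basis of the localization at \<open>S\<close>.\<close>

definition local_exponents :: "'x set \<Rightarrow> ('x \<Rightarrow> int) set" where
  "local_exponents S = {a. {v. a v \<noteq> 0} \<union> S \<in> D \<and> {v. a v < 0} \<subseteq> S}"

text \<open>The coefficient functions of elements of the localization at \<open>S\<close>.\<close>

definition local_space :: "'x set \<Rightarrow> (('x \<Rightarrow> int) \<Rightarrow> 'k) set" where
  "local_space S = {\<phi>. finite {a. \<phi> a \<noteq> 0} \<and> supported_on \<phi> (local_exponents S)}"

text \<open>The element of the localization with coefficient function \<open>\<phi>\<close>, as the set of all fractions that
  represent it.\<close>

definition local_class ::
    "'x set \<Rightarrow> (('x \<Rightarrow> int) \<Rightarrow> 'k) \<Rightarrow> (('x, 'k) mpol set \<times> ('x, 'k) mpol) set" where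
  "local_class S \<phi> = {(I +>\<^bsub>R\<^esub> p, Poly_Mapping.single b 1) | p b.
     p \<in> carrier R \<and> keys b \<subseteq> S \<and> local_coeff S p b = \<phi>}"

lemma local_coeff_add:
  "local_coeff S (Poly_Mapping.single b' 1 * p + Poly_Mapping.single b 1 * p') (b + b') =
   local_coeff S p b + local_coeff S p' b'"
proof
  fix a
  have "a + int_exponent (b + b') - int_exponent b' = a + int_exponent b"
    "a + int_exponent (b + b') - int_exponent b = a + int_exponent b'"
    by (simp_all add: int_exponent_add fun_eq_iff)
  then show "local_coeff S (Poly_Mapping.single b' 1 * p + Poly_Mapping.single b 1 * p') (b + b') a =
      (local_coeff S p b + local_coeff S p' b') a"
    by (simp only: local_coeff_def laurent_coeff_add laurent_coeff_monomial_mult plus_fun_apply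
        mult_1 split: if_split) simp
qed

lemma local_coeff_const_mult: "local_coeff S (pconst c * p) b = (\<lambda>a. c * local_coeff S p b a)"
  by (auto simp: local_coeff_def fun_eq_iff pconst_def laurent_coeff_monomial_mult)

lemma local_coeff_in_local_space:
  assumes "keys b \<subseteq> S"
  shows "local_coeff S p b \<in> local_space S"
proof -
  have *: "\<exists>e\<in>keys p. a = int_exponent e - int_exponent b" if a: "local_coeff S p b a \<noteq> 0" for a
  proof -
    obtain e where "e \<in> keys p" "a + int_exponent b = int_exponent e"
      using a laurent_coeff_nonzero[of p "a + int_exponent b"]
      by (auto simp: local_coeff_def split: if_splits)
    then show ?thesis
      by (intro bexI[of _ e]) (auto simp: algebra_simps)
  qed
  then have "{a. local_coeff S p b a \<noteq> 0} \<subseteq> (\<lambda>e. int_exponent e - int_exponent b) ` keys p"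
    by auto
  then have "finite {a. local_coeff S p b a \<noteq> 0}"
    by (rule finite_subset) simp
  moreover have "a \<in> local_exponents S" if "local_coeff S p b a \<noteq> 0" for a
  proof -
    have "{v. a v < 0} \<subseteq> keys b"
      using *[OF that] by (auto simp: int_exponent_def in_keys_iff)
    then show ?thesis
      using that assms by (auto simp: local_exponents_def local_coeff_def split: if_splits)
  qed
  ultimately show ?thesis
    by (auto simp: local_space_def supported_on_def)
qed

lemma local_space_zero: "0 \<in> local_space S"
  by (simp add: local_space_def supported_on_def)

lemma local_space_add: "\<phi> \<in> local_space S \<Longrightarrow> \<psi> \<in> local_space S \<Longrightarrow> \<phi> + \<psi> \<in> local_space S"
proof -
  assume *: "\<phi> \<in> local_space S" "\<psi> \<in> local_space S"
  have "finite {a. (\<phi> + \<psi>) a \<noteq> 0}"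
    by (rule finite_subset[of _ "{a. \<phi> a \<noteq> 0} \<union> {a. \<psi> a \<noteq> 0}"])
      (use * in \<open>auto simp: local_space_def\<close>)
  then show ?thesis
    using * by (simp add: local_space_def supported_on_def)
qed

lemma local_space_uminus: "\<phi> \<in> local_space S \<Longrightarrow> - \<phi> \<in> local_space S"
  by (simp add: local_space_def supported_on_def)

lemma local_space_smult: "\<phi> \<in> local_space S \<Longrightarrow> (\<lambda>a. c * \<phi> a) \<in> local_space S"
  using finite_subset[of "{a. c * \<phi> a \<noteq> 0}" "{a. \<phi> a \<noteq> 0}"]
  by (auto simp: local_space_def supported_on_def)

text \<open>All Laurent monomials that occur in \<open>\<phi>\<close> have total degree \<open>l\<close>.\<close>

definition homogeneous :: "int \<Rightarrow> (('x \<Rightarrow> int) \<Rightarrow> 'k) \<Rightarrow> bool" where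
  "homogeneous l \<phi> \<longleftrightarrow> (\<forall>a. \<phi> a \<noteq> 0 \<longrightarrow> (\<Sum>v\<in>X. a v) = l)"

lemma exponent_degree:
  "keys e \<subseteq> X \<Longrightarrow> int (\<Sum>v\<in>keys e. lookup e v) = (\<Sum>v\<in>X. int_exponent e v)"
  using finite_vertices
  by (simp add: int_exponent_def, intro sum.mono_neutral_left) (auto simp: in_keys_iff)

lemma polynomial_component_iff:
  "p \<in> polynomial_component X d \<longleftrightarrow>
    p \<in> carrier R \<and> (\<forall>e\<in>keys p. (\<Sum>v\<in>X. int_exponent e v) = d)"
  using exponent_degree by (auto simp: polynomial_component_def simp del: of_nat_sum)

lemma homogeneous_local_coeff:
  assumes "p \<in> polynomial_component X d"
  shows "homogeneous (d - (\<Sum>v\<in>X. int_exponent b v)) (local_coeff S p b)"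
  unfolding homogeneous_def
proof (intro allI impI)
  fix a assume "local_coeff S p b a \<noteq> 0"
  then obtain e where "e \<in> keys p" "a + int_exponent b = int_exponent e"
    using laurent_coeff_nonzero[of p "a + int_exponent b"]
    by (auto simp: local_coeff_def split: if_splits)
  moreover have "(\<Sum>v\<in>X. (a + int_exponent b) v) = (\<Sum>v\<in>X. a v) + (\<Sum>v\<in>X. int_exponent b v)"
    by (simp add: sum.distrib)
  ultimately show "(\<Sum>v\<in>X. a v) = d - (\<Sum>v\<in>X. int_exponent b v)"
    using assms by (auto simp: polynomial_component_iff)
qed

text \<open>Every coefficient function comes from a fraction, and a homogeneous one from a fraction of
  homogeneous elements. The induction adds one Laurent monomial at a time.\<close>

lemma exists_fraction:
  assumes "S \<subseteq> X" "\<phi> \<in> local_space S"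
  shows "\<exists>p b. p \<in> carrier R \<and> keys b \<subseteq> S \<and> local_coeff S p b = \<phi> \<and>
    (\<forall>l. homogeneous l \<phi> \<longrightarrow> p \<in> polynomial_component X (l + (\<Sum>v\<in>X. int_exponent b v)))"
proof -
  have "finite {a. \<phi> a \<noteq> 0}" "{a. \<phi> a \<noteq> 0} \<subseteq> local_exponents S"
    using assms(2) by (auto simp: local_space_def supported_on_def)
  then show ?thesis
  proof (induction "{a. \<phi> a \<noteq> 0}" arbitrary: \<phi> rule: finite_induct)
    case empty
    then have "\<phi> = 0"
      by (auto simp: fun_eq_iff)
    then show ?case
      by (intro exI[of _ 0]) (auto simp: local_coeff_def polynomial_component_iff fun_eq_iff)
  next
    case (insert a A)
    let ?\<psi> = "\<phi>(a := 0)"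
    have "A = {a. ?\<psi> a \<noteq> 0}"
      using insert.hyps by auto
    moreover have "{a. ?\<psi> a \<noteq> 0} \<subseteq> local_exponents S"
      using insert.prems by auto
    ultimately obtain p b where p: "p \<in> carrier R" "keys b \<subseteq> S" "local_coeff S p b = ?\<psi>"
      and ph: "\<And>l. homogeneous l ?\<psi> \<Longrightarrow> p \<in> polynomial_component X (l + (\<Sum>v\<in>X. int_exponent b v))"
      using insert.hyps(3)[of ?\<psi>] by blast
    have a: "{v. a v \<noteq> 0} \<union> S \<in> D" "{v. a v < 0} \<subseteq> S" "\<phi> a \<noteq> 0"
      using insert.prems insert.hyps(4) by (auto simp: local_exponents_def)
    have supp: "{v. a v \<noteq> 0} \<subseteq> X"
      using face_vertices[OF a(1)] by blast
    \<comment> \<open>The negative part of \<open>a\<close> goes to the denominator, the positive part to the numerator.\<close>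
    define b' where "b' = Abs_poly_mapping (\<lambda>v. nat (- a v))"
    define e where "e = Abs_poly_mapping (\<lambda>v. nat (a v))"
    have "finite {v. nat (- a v) \<noteq> 0}" "finite {v. nat (a v) \<noteq> 0}"
      by (rule finite_subset[OF _ finite_vertices], use supp in auto)+
    then have b'_e: "lookup b' = (\<lambda>v. nat (- a v))" "lookup e = (\<lambda>v. nat (a v))"
      by (simp_all add: b'_def e_def)
    then have keys: "keys b' \<subseteq> S" "keys e \<subseteq> X"
      using a(2) supp by (auto simp: in_keys_iff)
    have a_eq: "int_exponent e = a + int_exponent b'"
      by (auto simp: int_exponent_def b'_e fun_eq_iff)
    define q where "q = (Poly_Mapping.single e (\<phi> a) :: ('x, 'k) mpol)"
    have "local_coeff S q b' a' = (if a' = a then \<phi> a else 0)" for a'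
      using a(1) by (auto simp: local_coeff_def q_def laurent_coeff_single a_eq)
    then have "local_coeff S p b + local_coeff S q b' = \<phi>"
      by (intro ext) (simp add: p(3))
    then have coeff: "local_coeff S (Poly_Mapping.single b' 1 * p + Poly_Mapping.single b 1 * q) (b + b') = \<phi>"
      by (simp add: local_coeff_add)
    have subX: "keys b \<subseteq> X" "keys b' \<subseteq> X"
      using p(2) keys(1) assms(1) by auto
    have q: "q \<in> carrier R"
      using keys(2) by (simp add: q_def)
    have mem: "Poly_Mapping.single b' 1 * p + Poly_Mapping.single b 1 * q \<in> carrier R"
      by (intro polynomial_ring_add_closed polynomial_ring_mult_closed p q) (use subX in auto)
    have hom: "Poly_Mapping.single b' 1 * p + Poly_Mapping.single b 1 * q \<in>
        polynomial_component X (l + (\<Sum>v\<in>X. int_exponent (b + b') v))" if l: "homogeneous l \<phi>" for l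
    proof -
      have "homogeneous l ?\<psi>"
        using l by (simp add: homogeneous_def)
      then have "p \<in> polynomial_component X (l + (\<Sum>v\<in>X. int_exponent b v))"
        by (rule ph)
      then have degp: "(\<Sum>v\<in>X. int_exponent (b' + k) v) = l + (\<Sum>v\<in>X. int_exponent (b + b') v)"
        if "k \<in> keys p" for k
        using that by (simp add: polynomial_component_iff int_exponent_add sum.distrib)
      have "(\<Sum>v\<in>X. a v) = l"
        using l a(3) by (simp add: homogeneous_def)
      then have degq: "(\<Sum>v\<in>X. int_exponent (b + e) v) = l + (\<Sum>v\<in>X. int_exponent (b + b') v)"
        by (simp add: int_exponent_add a_eq sum.distrib)
      have "(\<Sum>v\<in>X. int_exponent k v) = l + (\<Sum>v\<in>X. int_exponent (b + b') v)"
        if k: "k \<in> keys (Poly_Mapping.single b' 1 * p + Poly_Mapping.single b 1 * q)" for k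
      proof -
        consider "k \<in> keys (Poly_Mapping.single b' 1 * p)" | "k \<in> keys (Poly_Mapping.single b 1 * q)"
          using k keys_add[of "Poly_Mapping.single b' 1 * p"] by blast
        then show ?thesis
        proof cases
          case 1
          then show ?thesis
            using keys_monomial_mult[of k b' 1 p] degp by blast
        next
          case 2
          then obtain k' where "k' \<in> keys q" "k = b + k'"
            using keys_monomial_mult[of k b 1 q] by blast
          then show ?thesis
            using degq by (simp add: q_def split: if_splits)
        qed
      qed
      then show ?thesis
        using mem by (simp add: polynomial_component_iff)
    qed
    have "keys (b + b') \<subseteq> S"
      using p(2) keys(1) by (simp add: keys_add_exponent)
    with mem coeff hom show ?case
      by blast
  qed
qed

text \<open>Equality of fractions is equality of coefficient functions; this identifies the localization with
  \<open>local_space S\<close>.\<close>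

lemma fraction_rel_iff:
  assumes "S \<subseteq> X" "p \<in> carrier R" "p' \<in> carrier R" "keys b \<subseteq> S" "keys b' \<subseteq> S"
  shows "((I +>\<^bsub>R\<^esub> p, Poly_Mapping.single b 1), (I +>\<^bsub>R\<^esub> p', Poly_Mapping.single b' 1))
      \<in> fraction_rel M (monomials S) \<longleftrightarrow> local_coeff S p b = local_coeff S p' b'"
    (is "?lhs \<longleftrightarrow> ?rhs")
proof -
  let ?q = "\<lambda>c. Poly_Mapping.single c 1 * (Poly_Mapping.single b' 1 * p)"
  let ?q' = "\<lambda>c. Poly_Mapping.single c 1 * (Poly_Mapping.single b 1 * p')"
  have mono: "Poly_Mapping.single c 1 \<in> carrier R" if "keys c \<subseteq> S" for c
    using that assms(1) by auto
  have mem: "Poly_Mapping.single b' 1 * p \<in> carrier R" "Poly_Mapping.single b 1 * p' \<in> carrier R"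
    by (intro polynomial_ring_mult_closed mono assms)+
  have q: "?q c \<in> carrier R" "?q' c \<in> carrier R" if "keys c \<subseteq> S" for c
    by (intro polynomial_ring_mult_closed mono that mem)+
  have residues: "I +>\<^bsub>R\<^esub> p \<in> carrier M" "I +>\<^bsub>R\<^esub> p' \<in> carrier M"
    using assms by (auto simp only: residue_carrier)
  have smult: "Poly_Mapping.single c 1 \<odot>\<^bsub>M\<^esub> (Poly_Mapping.single d 1 \<odot>\<^bsub>M\<^esub> (I +>\<^bsub>R\<^esub> r)) =
      I +>\<^bsub>R\<^esub> (Poly_Mapping.single c 1 * (Poly_Mapping.single d 1 * r))"
    if "keys c \<subseteq> S" "keys d \<subseteq> S" "r \<in> carrier R" for c d r
    by (subst residue_smult[OF mono[OF that(2)] that(3)])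
      (rule residue_smult[OF mono[OF that(1)] polynomial_ring_mult_closed[OF mono[OF that(2)] that(3)]])
  have "?lhs \<longleftrightarrow> (\<exists>c. keys c \<subseteq> S \<and> I +>\<^bsub>R\<^esub> ?q c = I +>\<^bsub>R\<^esub> ?q' c)"
    unfolding fraction_rel_def using residues assms(2-5)
    by (auto simp only: mem_Collect_eq prod.case monomials_def bex_simps) (use smult assms in metis)+
  also have "\<dots> \<longleftrightarrow> (\<exists>c. keys c \<subseteq> S \<and> (\<forall>e. keys e \<in> D \<longrightarrow> lookup (?q c) e = lookup (?q' c) e))"
    using residue_eq_iff[OF q] by blast
  also have "\<dots> \<longleftrightarrow> ?rhs"
  proof
    assume "\<exists>c. keys c \<subseteq> S \<and> (\<forall>e. keys e \<in> D \<longrightarrow> lookup (?q c) e = lookup (?q' c) e)"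
    then obtain c where c: "keys c \<subseteq> S"
      and eq: "\<And>e. keys e \<in> D \<Longrightarrow> lookup (?q c) e = lookup (?q' c) e"
      by blast
    have "laurent_coeff p (a + int_exponent b) = laurent_coeff p' (a + int_exponent b')"
      if face: "{v. a v \<noteq> 0} \<union> S \<in> D" for a
    proof -
      let ?a = "a + int_exponent b + int_exponent b' + int_exponent c"
      have "laurent_coeff (?q c) ?a = laurent_coeff (?q' c) ?a"
      proof (cases "?a \<in> range int_exponent")
        case True
        then obtain e where e: "?a = int_exponent e"
          by blast
        have "keys e \<subseteq> {v. a v \<noteq> 0} \<union> S"
        proof
          fix v assume "v \<in> keys e"
          then have "?a v \<noteq> 0"
            unfolding e by (simp add: int_exponent_def in_keys_iff)
          then have "a v \<noteq> 0 \<or> v \<in> keys b \<or> v \<in> keys b' \<or> v \<in> keys c"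
            by (auto simp: int_exponent_def in_keys_iff)
          then show "v \<in> {v. a v \<noteq> 0} \<union> S"
            using c assms by blast
        qed
        then have "keys e \<in> D"
          using face_mono[OF face] by blast
        then show ?thesis
          unfolding e by (simp add: eq)
      qed (simp add: laurent_coeff_def)
      moreover have "?a - int_exponent c - int_exponent b' = a + int_exponent b"
        "?a - int_exponent c - int_exponent b = a + int_exponent b'"
        by (simp_all add: fun_eq_iff)
      ultimately show ?thesis
        by (simp only: laurent_coeff_monomial_mult mult_1)
    qed
    then show ?rhs
      by (auto simp: local_coeff_def fun_eq_iff)
  next
    assume ?rhs
    \<comment> \<open>Multiplying by the product of the variables in \<open>S\<close> forces all occurring supports to
      contain \<open>S\<close>.\<close>
    define c where "c = (Abs_poly_mapping (\<lambda>v. if v \<in> S then 1 else 0) :: 'x \<Rightarrow>\<^sub>0 nat)"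
    have "finite S"
      using assms(1) finite_vertices by (rule finite_subset)
    then have lookup_c: "lookup c = (\<lambda>v. if v \<in> S then 1 else 0)"
      by (simp add: c_def)
    then have keys_c: "keys c = S"
      by (auto simp: in_keys_iff split: if_splits)
    have "lookup (?q c) e = lookup (?q' c) e" if e: "keys e \<in> D" for e
    proof (rule ccontr)
      assume neq: "lookup (?q c) e \<noteq> lookup (?q' c) e"
      let ?a = "int_exponent e - int_exponent c - int_exponent b - int_exponent b'"
      have "lookup (?q c) e = laurent_coeff (?q c) (int_exponent e)"
        "lookup (?q' c) e = laurent_coeff (?q' c) (int_exponent e)"
        by (simp_all only: laurent_coeff_int_exponent)
      moreover have "int_exponent e - int_exponent c - int_exponent b' = ?a + int_exponent b"
        "int_exponent e - int_exponent c - int_exponent b = ?a + int_exponent b'"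
        by (simp_all add: fun_eq_iff)
      ultimately have coeffs: "lookup (?q c) e = laurent_coeff p (?a + int_exponent b)"
        "lookup (?q' c) e = laurent_coeff p' (?a + int_exponent b')"
        by (simp_all only: laurent_coeff_monomial_mult mult_1)
      have "e \<in> keys (?q c) \<or> e \<in> keys (?q' c)"
        using neq by (auto simp: in_keys_iff)
      then have "\<exists>f. e = c + f"
        using keys_monomial_mult[of e c 1] by blast
      then have "S \<subseteq> keys e"
        using keys_c keys_add_exponent by fastforce
      moreover have "?a v = 0" if "v \<notin> keys e \<union> S" for v
      proof -
        have "v \<notin> keys e" "v \<notin> keys c" "v \<notin> keys b" "v \<notin> keys b'"
          using that keys_c assms(4,5) by auto
        then show ?thesis
          by (simp add: int_exponent_def in_keys_iff)
      qed
      then have "{v. ?a v \<noteq> 0} \<subseteq> keys e \<union> S"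
        by blast
      ultimately have "{v. ?a v \<noteq> 0} \<union> S \<in> D"
        using face_mono[OF e] by blast
      moreover have "local_coeff S p b ?a = local_coeff S p' b' ?a"
        using \<open>?rhs\<close> by simp
      ultimately have "lookup (?q c) e = lookup (?q' c) e"
        unfolding coeffs by (simp only: local_coeff_def if_True)
      with neq show False
        by contradiction
    qed
    then show "\<exists>c. keys c \<subseteq> S \<and> (\<forall>e. keys e \<in> D \<longrightarrow> lookup (?q c) e = lookup (?q' c) e)"
      using keys_c by blast
  qed
  finally show ?thesis .
qed

lemma fraction_eq_local_class:
  assumes "S \<subseteq> X" "p \<in> carrier R" "keys b \<subseteq> S"
  shows "fraction M (monomials S) (I +>\<^bsub>R\<^esub> p) (Poly_Mapping.single b 1) = local_class S (local_coeff S p b)"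
proof (intro equalityI subsetI)
  fix x assume "x \<in> fraction M (monomials S) (I +>\<^bsub>R\<^esub> p) (Poly_Mapping.single b 1)"
  then have x: "((I +>\<^bsub>R\<^esub> p, Poly_Mapping.single b 1), x) \<in> fraction_rel M (monomials S)"
    by (simp add: fraction_def)
  then obtain p' b' where p': "p' \<in> carrier R" "keys b' \<subseteq> S" "x = (I +>\<^bsub>R\<^esub> p', Poly_Mapping.single b' 1)"
    unfolding fraction_rel_def residue_carrier monomials_def by blast
  then have "local_coeff S p' b' = local_coeff S p b"
    using x fraction_rel_iff[OF assms(1,2) p'(1) assms(3) p'(2)] by simp
  then show "x \<in> local_class S (local_coeff S p b)"
    using p' unfolding local_class_def by blast
next
  fix x assume "x \<in> local_class S (local_coeff S p b)"
  then obtain p' b' where "p' \<in> carrier R" "keys b' \<subseteq> S" "x = (I +>\<^bsub>R\<^esub> p', Poly_Mapping.single b' 1)"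
    "local_coeff S p' b' = local_coeff S p b"
    unfolding local_class_def by blast
  then show "x \<in> fraction M (monomials S) (I +>\<^bsub>R\<^esub> p) (Poly_Mapping.single b 1)"
    using fraction_rel_iff[OF assms(1,2) _ assms(3), of p' b'] by (simp add: fraction_def)
qed

lemma local_class_witness:
  assumes "S \<subseteq> X" "\<phi> \<in> local_space S"
  obtains p b where "p \<in> carrier R" "keys b \<subseteq> S" "local_coeff S p b = \<phi>"
    "local_class S \<phi> = fraction M (monomials S) (I +>\<^bsub>R\<^esub> p) (Poly_Mapping.single b 1)"
    "(I +>\<^bsub>R\<^esub> p, Poly_Mapping.single b 1) \<in> local_class S \<phi>"
proof -
  obtain p b where *: "p \<in> carrier R" "keys b \<subseteq> S" "local_coeff S p b = \<phi>"
    using exists_fraction[OF assms] by blast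
  show thesis
  proof (rule that[OF *])
    show "local_class S \<phi> = fraction M (monomials S) (I +>\<^bsub>R\<^esub> p) (Poly_Mapping.single b 1)"
      using fraction_eq_local_class[OF assms(1) *(1,2)] *(3) by simp
    show "(I +>\<^bsub>R\<^esub> p, Poly_Mapping.single b 1) \<in> local_class S \<phi>"
      unfolding local_class_def using * by blast
  qed
qed

lemma inj_local_class:
  assumes "S \<subseteq> X"
  shows "inj_on (local_class S) (local_space S)"
proof (rule inj_onI)
  fix \<phi> \<psi> assume "\<phi> \<in> local_space S" "\<psi> \<in> local_space S" and eq: "local_class S \<phi> = local_class S \<psi>"
  obtain p b where p: "p \<in> carrier R" "keys b \<subseteq> S" "local_coeff S p b = \<phi>"
    and "(I +>\<^bsub>R\<^esub> p, Poly_Mapping.single b 1) \<in> local_class S \<phi>"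
    using local_class_witness[OF assms \<open>\<phi> \<in> local_space S\<close>] by metis
  then have "(I +>\<^bsub>R\<^esub> p, Poly_Mapping.single b 1) \<in> local_class S \<psi>"
    by (simp only: eq)
  then obtain p' b' where p': "p' \<in> carrier R" "keys b' \<subseteq> S" "local_coeff S p' b' = \<psi>"
    and res: "I +>\<^bsub>R\<^esub> p = I +>\<^bsub>R\<^esub> p'" and b: "Poly_Mapping.single b (1 :: 'k) = Poly_Mapping.single b' 1"
    unfolding local_class_def by blast
  have "b = b'"
    using arg_cong[OF b, of Poly_Mapping.keys] by simp
  have "fraction M (monomials S) (I +>\<^bsub>R\<^esub> p) (Poly_Mapping.single b 1) = local_class S \<phi>"
    using fraction_eq_local_class[OF assms p(1,2)] p(3) by simp
  have "((I +>\<^bsub>R\<^esub> p, Poly_Mapping.single b 1), (I +>\<^bsub>R\<^esub> p, Poly_Mapping.single b 1))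
      \<in> fraction_rel M (monomials S)"
    using fraction_rel_iff[OF assms p(1) p(1) p(2) p(2)] by simp
  then have "((I +>\<^bsub>R\<^esub> p, Poly_Mapping.single b 1), (I +>\<^bsub>R\<^esub> p', Poly_Mapping.single b' 1))
      \<in> fraction_rel M (monomials S)"
    by (simp only: res \<open>b = b'\<close>)
  then show "\<phi> = \<psi>"
    using fraction_rel_iff[OF assms p(1) p'(1) p(2) p'(2)] p(3) p'(3) by simp
qed

lemma localization_carrier:
  assumes "S \<subseteq> X"
  shows "carrier (localization R M (monomials S)) = local_class S ` local_space S"
proof (intro equalityI subsetI)
  fix x assume "x \<in> carrier (localization R M (monomials S))"
  then obtain m u where "m \<in> carrier M" "u \<in> monomials S" "x = fraction_rel M (monomials S) `` {(m, u)}"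
    by (auto simp: localization_def quotient_def)
  then obtain p b where "p \<in> carrier R" "keys b \<subseteq> S"
    "x = fraction M (monomials S) (I +>\<^bsub>R\<^esub> p) (Poly_Mapping.single b 1)"
    unfolding residue_carrier monomials_def fraction_def by blast
  then show "x \<in> local_class S ` local_space S"
    using fraction_eq_local_class[OF assms, of p b] local_coeff_in_local_space by blast
next
  fix x assume "x \<in> local_class S ` local_space S"
  then obtain \<phi> where \<phi>: "\<phi> \<in> local_space S" "x = local_class S \<phi>"
    by blast
  then obtain p b where "p \<in> carrier R" "keys b \<subseteq> S"
    "x = fraction M (monomials S) (I +>\<^bsub>R\<^esub> p) (Poly_Mapping.single b 1)"
    using local_class_witness[OF assms \<phi>(1)] \<phi>(2) by metis
  moreover from this have "(I +>\<^bsub>R\<^esub> p, Poly_Mapping.single b 1) \<in> carrier M \<times> monomials S"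
    unfolding residue_carrier monomials_def by blast
  ultimately show "x \<in> carrier (localization R M (monomials S))"
    by (auto simp: localization_def fraction_def intro!: quotientI)
qed

lemma local_class_add:
  assumes "S \<subseteq> X" "\<phi> \<in> local_space S" "\<psi> \<in> local_space S"
  shows "local_class S \<phi> \<oplus>\<^bsub>localization R M (monomials S)\<^esub> local_class S \<psi> = local_class S (\<phi> + \<psi>)"
proof -
  have *: "fraction M (monomials S) (u' \<odot>\<^bsub>M\<^esub> m \<oplus>\<^bsub>M\<^esub> u \<odot>\<^bsub>M\<^esub> m') (u \<otimes>\<^bsub>R\<^esub> u') = local_class S (\<phi> + \<psi>)"
    if "(m, u) \<in> local_class S \<phi>" "(m', u') \<in> local_class S \<psi>" for m u m' u'
  proof -
    from that(1) obtain p b where p: "p \<in> carrier R" "keys b \<subseteq> S" "local_coeff S p b = \<phi>"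
      and m: "m = I +>\<^bsub>R\<^esub> p" and u: "u = Poly_Mapping.single b 1"
      unfolding local_class_def by blast
    from that(2) obtain p' b' where p': "p' \<in> carrier R" "keys b' \<subseteq> S" "local_coeff S p' b' = \<psi>"
      and m': "m' = I +>\<^bsub>R\<^esub> p'" and u': "u' = Poly_Mapping.single b' 1"
      unfolding local_class_def by blast
    have uu: "u \<in> carrier R" "u' \<in> carrier R"
      using p(2) p'(2) assms(1) by (auto simp: u u')
    then have prods: "u' * p \<in> carrier R" "u * p' \<in> carrier R"
      using p(1) p'(1) polynomial_ring_mult_closed by blast+
    have "u' \<odot>\<^bsub>M\<^esub> m \<oplus>\<^bsub>M\<^esub> u \<odot>\<^bsub>M\<^esub> m' = I +>\<^bsub>R\<^esub> (u' * p + u * p')"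
      unfolding m m' residue_smult[OF uu(2) p(1)] residue_smult[OF uu(1) p'(1)] residue_add[OF prods] ..
    moreover have "u \<otimes>\<^bsub>R\<^esub> u' = Poly_Mapping.single (b + b') 1"
      by (simp add: u u' mult_single)
    moreover have "keys (b + b') \<subseteq> S"
      using p(2) p'(2) by (simp add: keys_add_exponent)
    ultimately have "fraction M (monomials S) (u' \<odot>\<^bsub>M\<^esub> m \<oplus>\<^bsub>M\<^esub> u \<odot>\<^bsub>M\<^esub> m') (u \<otimes>\<^bsub>R\<^esub> u') =
        local_class S (local_coeff S (u' * p + u * p') (b + b'))"
      using fraction_eq_local_class[OF assms(1) polynomial_ring_add_closed[OF prods]] by simp
    then show ?thesis
      by (simp only: u u' local_coeff_add p(3) p'(3))
  qed
  have "\<exists>x. x \<in> local_class S \<phi>" "\<exists>x. x \<in> local_class S \<psi>"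
    using local_class_witness[OF assms(1,2)] local_class_witness[OF assms(1,3)] by metis+
  then have "(\<Union>(m, u)\<in>local_class S \<phi>. \<Union>(m', u')\<in>local_class S \<psi>.
      fraction M (monomials S) (u' \<odot>\<^bsub>M\<^esub> m \<oplus>\<^bsub>M\<^esub> u \<odot>\<^bsub>M\<^esub> m') (u \<otimes>\<^bsub>R\<^esub> u')) = local_class S (\<phi> + \<psi>)"
    using * by fast
  then show ?thesis
    by (simp add: localization_def)
qed

lemma local_class_zero:
  assumes "S \<subseteq> X"
  shows "\<zero>\<^bsub>localization R M (monomials S)\<^esub> = local_class S 0"
proof -
  have "\<zero>\<^bsub>localization R M (monomials S)\<^esub> =
      fraction M (monomials S) (I +>\<^bsub>R\<^esub> 0) (Poly_Mapping.single 0 1)"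
    by (simp add: localization_def residue_zero)
  also have "\<dots> = local_class S (local_coeff S 0 0)"
    by (rule fraction_eq_local_class[OF assms]) auto
  also have "local_coeff S 0 0 = 0"
    by (simp add: local_coeff_def fun_eq_iff)
  finally show ?thesis .
qed

lemma local_class_smult:
  assumes "S \<subseteq> X" "\<phi> \<in> local_space S"
  shows "pconst c \<odot>\<^bsub>localization R M (monomials S)\<^esub> local_class S \<phi> = local_class S (\<lambda>a. c * \<phi> a)"
proof -
  have c: "pconst c \<in> carrier R"
    by (simp add: pconst_def)
  have *: "fraction M (monomials S) (pconst c \<odot>\<^bsub>M\<^esub> m) u = local_class S (\<lambda>a. c * \<phi> a)"
    if "(m, u) \<in> local_class S \<phi>" for m u
  proof -
    from that obtain p b where p: "p \<in> carrier R" "keys b \<subseteq> S" "local_coeff S p b = \<phi>"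
      and m: "m = I +>\<^bsub>R\<^esub> p" and u: "u = Poly_Mapping.single b 1"
      unfolding local_class_def by blast
    show ?thesis
      unfolding m u residue_smult[OF c p(1)]
        fraction_eq_local_class[OF assms(1) polynomial_ring_mult_closed[OF c p(1)] p(2)]
      by (simp add: local_coeff_const_mult p(3))
  qed
  have "\<exists>x. x \<in> local_class S \<phi>"
    using local_class_witness[OF assms] by metis
  then have "(\<Union>(m, u)\<in>local_class S \<phi>. fraction M (monomials S) (pconst c \<odot>\<^bsub>M\<^esub> m) u) =
      local_class S (\<lambda>a. c * \<phi> a)"
    using * by fast
  then show ?thesis
    by (simp add: localization_def)
qed

lemma additive_image_localization:
  assumes "S \<subseteq> X"
  shows "additive_image (local_space S) (localization R M (monomials S)) (local_class S)"
  by unfold_locales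
    (simp_all add: local_space_zero local_space_add local_space_uminus localization_carrier[OF assms]
      local_class_add[OF assms] local_class_zero[OF assms])

text \<open>The canonical map into the localization at \<open>S\<close>, in terms of coefficient functions.\<close>

definition restrict_coeffs :: "'x set \<Rightarrow> (('x \<Rightarrow> int) \<Rightarrow> 'k) \<Rightarrow> ('x \<Rightarrow> int) \<Rightarrow> 'k" where
  "restrict_coeffs S \<phi> = (\<lambda>a. if {v. a v \<noteq> 0} \<union> S \<in> D then \<phi> a else 0)"

lemma restrict_coeffs_in_local_space:
  assumes "\<phi> \<in> local_space S" "S \<subseteq> T"
  shows "restrict_coeffs T \<phi> \<in> local_space T"
proof -
  have "finite {a. restrict_coeffs T \<phi> a \<noteq> 0}"
    by (rule finite_subset[of _ "{a. \<phi> a \<noteq> 0}"])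
      (use assms in \<open>auto simp: restrict_coeffs_def local_space_def\<close>)
  moreover have "a \<in> local_exponents T" if "restrict_coeffs T \<phi> a \<noteq> 0" for a
    using that assms
    by (auto simp: restrict_coeffs_def local_space_def supported_on_def local_exponents_def split: if_splits)
  ultimately show ?thesis
    by (auto simp: local_space_def supported_on_def)
qed

lemma localization_map_local_class:
  assumes "S \<subseteq> T" "T \<subseteq> X" "\<phi> \<in> local_space S"
  shows "localization_map M (monomials T) (local_class S \<phi>) = local_class T (restrict_coeffs T \<phi>)"
proof -
  have "S \<subseteq> X"
    using assms by blast
  have *: "fraction M (monomials T) m u = local_class T (restrict_coeffs T \<phi>)"
    if "(m, u) \<in> local_class S \<phi>" for m u
  proof -
    from that obtain p b where p: "p \<in> carrier R" "keys b \<subseteq> S" "local_coeff S p b = \<phi>"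
      and m: "m = I +>\<^bsub>R\<^esub> p" and u: "u = Poly_Mapping.single b 1"
      unfolding local_class_def by blast
    have "local_coeff T p b = restrict_coeffs T \<phi>"
    proof
      fix a :: "'x \<Rightarrow> int"
      have "{v. a v \<noteq> 0} \<union> S \<in> D" if "{v. a v \<noteq> 0} \<union> T \<in> D"
        using face_mono[OF that, of "{v. a v \<noteq> 0} \<union> S"] assms(1) by blast
      then show "local_coeff T p b a = restrict_coeffs T \<phi> a"
        by (auto simp: local_coeff_def restrict_coeffs_def simp flip: p(3))
    qed
    then show ?thesis
      unfolding m u using fraction_eq_local_class[OF assms(2) p(1), of b] p(2) assms(1) by auto
  qed
  have "\<exists>x. x \<in> local_class S \<phi>"
    using local_class_witness[OF \<open>S \<subseteq> X\<close> assms(3)] by metis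
  then show ?thesis
    unfolding localization_map_def using * by fast
qed

lemma localization_component_local_class:
  assumes "S \<subseteq> X"
  shows "localization_component (polynomial_component X) M (residue_component X I) (monomials S) l =
    local_class S ` {\<phi> \<in> local_space S. homogeneous l \<phi>}"
proof (intro equalityI subsetI)
  fix x assume "x \<in> localization_component (polynomial_component X) M (residue_component X I) (monomials S) l"
  then obtain d e p b where p: "p \<in> polynomial_component X d" and b: "keys b \<subseteq> S"
    and e: "Poly_Mapping.single b (1 :: 'k) \<in> polynomial_component X e" and l: "l = d - e"
    and x: "x = fraction M (monomials S) (I +>\<^bsub>R\<^esub> p) (Poly_Mapping.single b 1)"
    unfolding localization_component_def residue_component_def monomials_def by blast
  have "p \<in> carrier R"
    using p by (simp add: polynomial_component_iff)
  moreover have "e = (\<Sum>v\<in>X. int_exponent b v)"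
    using e by (simp add: polynomial_component_iff)
  ultimately show "x \<in> local_class S ` {\<phi> \<in> local_space S. homogeneous l \<phi>}"
    using x fraction_eq_local_class[OF assms, of p b] b local_coeff_in_local_space[OF b, of p]
      homogeneous_local_coeff[OF p, of b S] l
    by blast
next
  fix x assume "x \<in> local_class S ` {\<phi> \<in> local_space S. homogeneous l \<phi>}"
  then obtain \<phi> where \<phi>: "\<phi> \<in> local_space S" "homogeneous l \<phi>" "x = local_class S \<phi>"
    by blast
  then obtain p b where p: "p \<in> carrier R" "keys b \<subseteq> S" "local_coeff S p b = \<phi>"
    and hom: "p \<in> polynomial_component X (l + (\<Sum>v\<in>X. int_exponent b v))"
    using exists_fraction[OF assms \<phi>(1)] by blast
  have "x = fraction M (monomials S) (I +>\<^bsub>R\<^esub> p) (Poly_Mapping.single b 1)"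
    using fraction_eq_local_class[OF assms p(1,2)] p(3) \<phi>(3) by simp
  moreover have "Poly_Mapping.single b (1 :: 'k) \<in> polynomial_component X (\<Sum>v\<in>X. int_exponent b v)"
    using p(2) assms by (auto simp: polynomial_component_iff)
  moreover have "Poly_Mapping.single b (1 :: 'k) \<in> monomials S"
    using p(2) by (auto simp: monomials_def)
  ultimately show "x \<in> localization_component (polynomial_component X) M (residue_component X I) (monomials S) l"
    unfolding localization_component_def residue_component_def mem_Collect_eq
    by (intro exI[of _ "I +>\<^bsub>R\<^esub> p"] exI[of _ "Poly_Mapping.single b 1"]
        exI[of _ "l + (\<Sum>v\<in>X. int_exponent b v)"] exI[of _ "\<Sum>v\<in>X. int_exponent b v"])
      (use hom in auto)
qed

end


section \<open>The Cech complex of a Stanley-Reisner ring\<close>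

text \<open>The list \<open>vs\<close> orders the variables of the Cech complex.\<close>

locale stanley_reisner_cech = stanley_reisner "set vs" D I
  for vs :: "'x list" and D :: "'x set set" and I :: "('x, 'k :: field) mpol set" +
  assumes distinct: "distinct vs"
begin

text \<open>The \<open>p\<close>-element sets of positions in \<open>vs\<close>, which index the summands of the \<open>p\<close>-th Cech module.\<close>

definition indices :: "nat \<Rightarrow> nat set set" where
  "indices p = {\<sigma>. \<sigma> \<subseteq> {..<length vs} \<and> card \<sigma> = p}"

lemma cech_indices_eq [simp]: "cech_indices (map pvar vs) p = indices p"
  by (simp add: cech_indices_def indices_def)

text \<open>The vertices at a set of positions.\<close>

definition verts :: "nat set \<Rightarrow> 'x set" where
  "verts \<sigma> = (!) vs ` \<sigma>"

lemma idx_iff: "\<sigma> \<in> indices p \<longleftrightarrow> \<sigma> \<subseteq> {..<length vs} \<and> card \<sigma> = p"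
  by (simp add: indices_def)

lemma finite_idx: "\<sigma> \<in> indices p \<Longrightarrow> finite \<sigma>"
  by (auto simp: idx_iff intro: finite_subset)

lemma finite_indices: "finite (indices p)"
  by (rule finite_subset[of _ "Pow {..<length vs}"]) (auto simp: idx_iff)

lemma idx_face: "\<tau> \<in> indices (Suc p) \<Longrightarrow> i \<in> \<tau> \<Longrightarrow> \<tau> - {i} \<in> indices p"
  using finite_idx by (auto simp: idx_iff)

lemma verts_subset: "\<sigma> \<subseteq> {..<length vs} \<Longrightarrow> verts \<sigma> \<subseteq> set vs"
  by (auto simp: verts_def)

lemma verts_mono: "\<sigma> \<subseteq> \<tau> \<Longrightarrow> verts \<sigma> \<subseteq> verts \<tau>"
  by (auto simp: verts_def)

lemma verts_idx: "\<sigma> \<in> indices p \<Longrightarrow> verts \<sigma> \<subseteq> set vs"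
  by (simp add: idx_iff verts_subset)

lemma nth_in_verts: "\<sigma> \<subseteq> {..<length vs} \<Longrightarrow> i < length vs \<Longrightarrow> vs ! i \<in> verts \<sigma> \<longleftrightarrow> i \<in> \<sigma>"
  using distinct by (auto simp: verts_def nth_eq_iff_index_eq)

lemma pvar_power: "pvar v [^]\<^bsub>R\<^esub> (m :: nat) = Poly_Mapping.single (Poly_Mapping.single v m) 1"
  by (induction m) (simp_all add: pvar_def mult_single flip: single_add)

lemma finprod_powers:
  "finite \<sigma> \<Longrightarrow> \<sigma> \<subseteq> {..<length vs} \<Longrightarrow>
   finprod R (\<lambda>i. (map pvar vs ! i) [^]\<^bsub>R\<^esub> (a i :: nat)) \<sigma> =
   Poly_Mapping.single (\<Sum>i\<in>\<sigma>. Poly_Mapping.single (vs ! i) (a i)) 1"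
proof (induction \<sigma> rule: finite_induct)
  case (insert i \<sigma>)
  have mem: "(map pvar vs ! k) [^]\<^bsub>R\<^esub> a k \<in> carrier R" if "k < length vs" for k
    using that by (simp add: pvar_power)
  have "finprod R (\<lambda>i. (map pvar vs ! i) [^]\<^bsub>R\<^esub> a i) (insert i \<sigma>) =
      (map pvar vs ! i) [^]\<^bsub>R\<^esub> a i \<otimes>\<^bsub>R\<^esub> finprod R (\<lambda>i. (map pvar vs ! i) [^]\<^bsub>R\<^esub> a i) \<sigma>"
    using insert.hyps insert.prems mem by (intro R.finprod_insert) auto
  then show ?case
    using insert by (simp add: pvar_power mult_single)
qed simp

lemma denominators_eq:
  assumes "\<sigma> \<subseteq> {..<length vs}"
  shows "cech_denominators R (map pvar vs) \<sigma> = monomials (verts \<sigma>)"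
proof -
  have fin: "finite \<sigma>"
    using assms by (rule finite_subset) simp
  have keys: "keys (\<Sum>i\<in>\<sigma>. Poly_Mapping.single (vs ! i) (a i)) \<subseteq> verts \<sigma>" for a :: "nat \<Rightarrow> nat"
    using keys_sum[of "\<lambda>i. Poly_Mapping.single (vs ! i) (a i)" \<sigma>] by (fastforce simp: verts_def split: if_splits)
  have surj: "(\<Sum>i\<in>\<sigma>. Poly_Mapping.single (vs ! i) (lookup b (vs ! i))) = b" if "keys b \<subseteq> verts \<sigma>" for b
  proof (rule poly_mapping_eqI)
    fix v
    have inj: "inj_on ((!) vs) \<sigma>"
      using distinct assms by (intro inj_on_nth) auto
    have "lookup (\<Sum>i\<in>\<sigma>. Poly_Mapping.single (vs ! i) (lookup b (vs ! i))) v =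
        (\<Sum>i\<in>\<sigma>. if vs ! i = v then lookup b v else 0)"
      by (auto simp: lookup_sum lookup_single when_def intro!: sum.cong)
    also have "\<dots> = (\<Sum>u\<in>verts \<sigma>. if u = v then lookup b v else 0)"
      by (simp add: verts_def sum.reindex[OF inj])
    also have "\<dots> = lookup b v"
      using that fin by (auto simp: verts_def in_keys_iff)
    finally show "lookup (\<Sum>i\<in>\<sigma>. Poly_Mapping.single (vs ! i) (lookup b (vs ! i))) v = lookup b v" .
  qed
  show ?thesis
  proof (intro equalityI subsetI)
    fix u :: "('x, 'k) mpol" assume "u \<in> monomials (verts \<sigma>)"
    then obtain b where b: "keys b \<subseteq> verts \<sigma>" "u = Poly_Mapping.single b 1"
      by (auto simp: monomials_def)
    have "u = Poly_Mapping.single (\<Sum>i\<in>\<sigma>. Poly_Mapping.single (vs ! i) (lookup b (vs ! i))) 1"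
      by (simp only: surj[OF b(1)] b(2))
    then show "u \<in> cech_denominators R (map pvar vs) \<sigma>"
      unfolding cech_denominators_def finprod_powers[OF fin assms]
      by (intro CollectI exI[of _ "\<lambda>i. lookup b (vs ! i)"]) simp
  next
    fix u :: "('x, 'k) mpol" assume "u \<in> cech_denominators R (map pvar vs) \<sigma>"
    then show "u \<in> monomials (verts \<sigma>)"
      unfolding cech_denominators_def monomials_def finprod_powers[OF fin assms] using keys by blast
  qed
qed

lemma summand_eq:
  "\<sigma> \<in> indices p \<Longrightarrow> cech_summand R M (map pvar vs) \<sigma> = localization R M (monomials (verts \<sigma>))"
  by (simp add: cech_summand_def idx_iff denominators_eq)

text \<open>The \<open>p\<close>-th Cech module in terms of coefficient functions. Families are extended by \<open>0\<close> outside the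
  index set, so that they can be added and compared as functions.\<close>

definition cochain_space :: "nat \<Rightarrow> (nat set \<Rightarrow> ('x \<Rightarrow> int) \<Rightarrow> 'k) set" where
  "cochain_space p =
     {\<phi>. (\<forall>\<sigma>\<in>indices p. \<phi> \<sigma> \<in> local_space (verts \<sigma>)) \<and> (\<forall>\<sigma>. \<sigma> \<notin> indices p \<longrightarrow> \<phi> \<sigma> = 0)}"

text \<open>The Cech cochain with given coefficient functions.\<close>

definition cochain :: "nat \<Rightarrow> (nat set \<Rightarrow> ('x \<Rightarrow> int) \<Rightarrow> 'k) \<Rightarrow>
    nat set \<Rightarrow> (('x, 'k) mpol set \<times> ('x, 'k) mpol) set" where
  "cochain p \<phi> = (\<lambda>\<sigma>\<in>indices p. local_class (verts \<sigma>) (\<phi> \<sigma>))"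

abbreviation "cech p \<equiv> cech_module R M (map pvar vs) p"

lemma cochain_image:
  assumes "\<And>\<sigma>. \<sigma> \<in> indices p \<Longrightarrow> A \<sigma> \<subseteq> local_space (verts \<sigma>)"
  shows "(\<Pi>\<^sub>E \<sigma>\<in>indices p. local_class (verts \<sigma>) ` A \<sigma>) =
    cochain p ` {\<phi> \<in> cochain_space p. \<forall>\<sigma>\<in>indices p. \<phi> \<sigma> \<in> A \<sigma>}"
proof (intro equalityI subsetI)
  fix f assume f: "f \<in> (\<Pi>\<^sub>E \<sigma>\<in>indices p. local_class (verts \<sigma>) ` A \<sigma>)"
  then have "\<forall>\<sigma>\<in>indices p. \<exists>\<phi>\<in>A \<sigma>. f \<sigma> = local_class (verts \<sigma>) \<phi>"
    by auto
  then obtain \<psi> where \<psi>: "\<And>\<sigma>. \<sigma> \<in> indices p \<Longrightarrow> \<psi> \<sigma> \<in> A \<sigma> \<and> f \<sigma> = local_class (verts \<sigma>) (\<psi> \<sigma>)"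
    by metis
  let ?\<phi> = "\<lambda>\<sigma>. if \<sigma> \<in> indices p then \<psi> \<sigma> else 0"
  have "?\<phi> \<in> {\<phi> \<in> cochain_space p. \<forall>\<sigma>\<in>indices p. \<phi> \<sigma> \<in> A \<sigma>}"
    using \<psi> assms by (auto simp: cochain_space_def)
  moreover have "f = cochain p ?\<phi>"
    using f \<psi> by (intro ext) (auto simp: cochain_def PiE_def extensional_def)
  ultimately show "f \<in> cochain p ` {\<phi> \<in> cochain_space p. \<forall>\<sigma>\<in>indices p. \<phi> \<sigma> \<in> A \<sigma>}"
    by blast
qed (auto simp: cochain_def)

lemma cech_carrier: "carrier (cech p) = cochain p ` cochain_space p"
proof -
  have "carrier (cech p) = (\<Pi>\<^sub>E \<sigma>\<in>indices p. carrier (cech_summand R M (map pvar vs) \<sigma>))"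
    by (simp add: cech_module_def)
  also have "\<dots> = (\<Pi>\<^sub>E \<sigma>\<in>indices p. local_class (verts \<sigma>) ` local_space (verts \<sigma>))"
    by (intro PiE_cong) (simp add: summand_eq localization_carrier verts_idx)
  also have "\<dots> = cochain p ` {\<phi> \<in> cochain_space p. \<forall>\<sigma>\<in>indices p. \<phi> \<sigma> \<in> local_space (verts \<sigma>)}"
    by (rule cochain_image) simp
  also have "{\<phi> \<in> cochain_space p. \<forall>\<sigma>\<in>indices p. \<phi> \<sigma> \<in> local_space (verts \<sigma>)} = cochain_space p"
    by (auto simp: cochain_space_def)
  finally show ?thesis .
qed

lemma inj_cochain: "inj_on (cochain p) (cochain_space p)"
proof (rule inj_onI)
  fix \<phi> \<psi> assume mem: "\<phi> \<in> cochain_space p" "\<psi> \<in> cochain_space p" and eq: "cochain p \<phi> = cochain p \<psi>"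
  show "\<phi> = \<psi>"
  proof
    fix \<sigma>
    show "\<phi> \<sigma> = \<psi> \<sigma>"
    proof (cases "\<sigma> \<in> indices p")
      case True
      then have "local_class (verts \<sigma>) (\<phi> \<sigma>) = local_class (verts \<sigma>) (\<psi> \<sigma>)"
        using fun_cong[OF eq, of \<sigma>] by (simp add: cochain_def)
      then show ?thesis
        using inj_onD[OF inj_local_class[OF verts_idx[OF True]]] mem True by (auto simp: cochain_space_def)
    next
      case False
      then show ?thesis
        using mem by (simp add: cochain_space_def)
    qed
  qed
qed

lemma cochain_space_zero: "0 \<in> cochain_space p"
  by (simp add: cochain_space_def local_space_zero)

lemma cochain_space_add:
  "\<phi> \<in> cochain_space p \<Longrightarrow> \<psi> \<in> cochain_space p \<Longrightarrow> \<phi> + \<psi> \<in> cochain_space p"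
  by (auto simp: cochain_space_def local_space_add)

lemma cochain_space_smult: "\<phi> \<in> cochain_space p \<Longrightarrow> (\<lambda>\<sigma> a. c * \<phi> \<sigma> a) \<in> cochain_space p"
  by (auto simp: cochain_space_def local_space_smult fun_eq_iff)

lemma cochain_space_diff:
  "\<phi> \<in> cochain_space p \<Longrightarrow> \<psi> \<in> cochain_space p \<Longrightarrow> \<phi> - \<psi> \<in> cochain_space p"
  using cochain_space_add[of \<phi> p "\<lambda>\<sigma> a. (- 1) * \<psi> \<sigma> a"] cochain_space_smult[of \<psi> p "- 1"]
  by (simp add: plus_fun_def fun_diff_def)

lemma cochain_add:
  assumes "\<phi> \<in> cochain_space p" "\<psi> \<in> cochain_space p"
  shows "cochain p \<phi> \<oplus>\<^bsub>cech p\<^esub> cochain p \<psi> = cochain p (\<phi> + \<psi>)"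
  unfolding cech_module_def cochain_def using assms
  by (auto simp: summand_eq local_class_add verts_idx cochain_space_def fun_eq_iff)

lemma cochain_zero: "\<zero>\<^bsub>cech p\<^esub> = cochain p 0"
  unfolding cech_module_def cochain_def
  by (auto simp: summand_eq local_class_zero verts_idx fun_eq_iff)

lemma cochain_smult:
  assumes "\<phi> \<in> cochain_space p"
  shows "pconst c \<odot>\<^bsub>cech p\<^esub> cochain p \<phi> = cochain p (\<lambda>\<sigma> a. c * \<phi> \<sigma> a)"
  unfolding cech_module_def cochain_def using assms
  by (auto simp: summand_eq local_class_smult verts_idx cochain_space_def fun_eq_iff)

text \<open>The sets of positions at which the Laurent monomial \<open>x\<^sup>a\<close> is part of the basis of the localization.\<close>

definition cells :: "('x \<Rightarrow> int) \<Rightarrow> nat set set" where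
  "cells a = {\<sigma>. \<sigma> \<subseteq> {..<length vs} \<and> a \<in> local_exponents (verts \<sigma>)}"

lemma cell_family_cells: "cell_family (cells a)"
proof
  show "finite \<sigma>" if "\<sigma> \<in> cells a" for \<sigma>
    using that by (auto simp: cells_def intro: finite_subset)
  show "\<rho> \<in> cells a" if "\<sigma> \<in> cells a" "\<tau> \<in> cells a" "\<sigma> \<subseteq> \<rho>" "\<rho> \<subseteq> \<tau>" for \<sigma> \<tau> \<rho>
  proof -
    have "{v. a v \<noteq> 0} \<union> verts \<rho> \<in> D"
      using that verts_mono[OF \<open>\<rho> \<subseteq> \<tau>\<close>]
      by (auto simp: cells_def local_exponents_def intro: face_mono[of "{v. a v \<noteq> 0} \<union> verts \<tau>"])
    then show ?thesis
      using that verts_mono[OF \<open>\<sigma> \<subseteq> \<rho>\<close>] by (auto simp: cells_def local_exponents_def)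
  qed
qed

lemma cochain_space_iff:
  "\<phi> \<in> cochain_space p \<longleftrightarrow> (\<forall>\<sigma>. finite {a. \<phi> \<sigma> a \<noteq> 0}) \<and>
    (\<forall>\<sigma> a. \<phi> \<sigma> a \<noteq> 0 \<longrightarrow> \<sigma> \<in> cells a \<and> card \<sigma> = p)"
proof
  assume \<phi>: "\<phi> \<in> cochain_space p"
  have "finite {a. \<phi> \<sigma> a \<noteq> 0}" for \<sigma>
    using \<phi> by (cases "\<sigma> \<in> indices p") (auto simp: cochain_space_def local_space_def)
  moreover have "\<sigma> \<in> cells a \<and> card \<sigma> = p" if "\<phi> \<sigma> a \<noteq> 0" for \<sigma> a
    using \<phi> that
    by (cases "\<sigma> \<in> indices p") (auto simp: cochain_space_def local_space_def supported_on_def cells_def idx_iff)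
  ultimately show "(\<forall>\<sigma>. finite {a. \<phi> \<sigma> a \<noteq> 0}) \<and> (\<forall>\<sigma> a. \<phi> \<sigma> a \<noteq> 0 \<longrightarrow> \<sigma> \<in> cells a \<and> card \<sigma> = p)"
    by blast
next
  assume *: "(\<forall>\<sigma>. finite {a. \<phi> \<sigma> a \<noteq> 0}) \<and> (\<forall>\<sigma> a. \<phi> \<sigma> a \<noteq> 0 \<longrightarrow> \<sigma> \<in> cells a \<and> card \<sigma> = p)"
  show "\<phi> \<in> cochain_space p"
    unfolding cochain_space_def local_space_def supported_on_def
    using * by (fastforce simp: cells_def idx_iff)
qed

text \<open>The Cech differential in terms of coefficient functions. It acts on each exponent separately.\<close>

definition coboundary :: "(nat set \<Rightarrow> ('x \<Rightarrow> int) \<Rightarrow> 'k) \<Rightarrow> nat set \<Rightarrow> ('x \<Rightarrow> int) \<Rightarrow> 'k" where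
  "coboundary \<phi> = (\<lambda>\<tau> a. cell_coboundary (cells a) (\<lambda>\<sigma>. \<phi> \<sigma> a) \<tau>)"

lemma coboundary_cochain_space:
  assumes "\<phi> \<in> cochain_space p"
  shows "coboundary \<phi> \<in> cochain_space (Suc p)"
  unfolding cochain_space_iff
proof (intro conjI allI impI)
  have *: "\<exists>i\<in>\<tau>. \<phi> (\<tau> - {i}) a \<noteq> 0" if nz: "coboundary \<phi> \<tau> a \<noteq> 0" for \<tau> a
  proof (rule ccontr)
    assume "\<not> (\<exists>i\<in>\<tau>. \<phi> (\<tau> - {i}) a \<noteq> 0)"
    then have "coboundary \<phi> \<tau> a = 0"
      by (simp add: coboundary_def cell_coboundary_def)
    with nz show False
      by contradiction
  qed
  show "finite {a. coboundary \<phi> \<tau> a \<noteq> 0}" for \<tau>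
  proof (cases "finite \<tau>")
    case True
    have "{a. coboundary \<phi> \<tau> a \<noteq> 0} \<subseteq> (\<Union>i\<in>\<tau>. {a. \<phi> (\<tau> - {i}) a \<noteq> 0})"
      using * by blast
    moreover have "finite (\<Union>i\<in>\<tau>. {a. \<phi> (\<tau> - {i}) a \<noteq> 0})"
      using True assms by (simp add: cochain_space_iff)
    ultimately show ?thesis
      by (rule finite_subset)
  qed (simp add: coboundary_def cell_coboundary_def)
  fix \<tau> a assume nz: "coboundary \<phi> \<tau> a \<noteq> 0"
  then show cell: "\<tau> \<in> cells a"
    by (auto simp: coboundary_def cell_coboundary_def split: if_splits)
  then have "finite \<tau>"
    by (auto simp: cells_def intro: finite_subset)
  moreover obtain i where i: "i \<in> \<tau>" "\<phi> (\<tau> - {i}) a \<noteq> 0"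
    using *[OF nz] by blast
  moreover have "card (\<tau> - {i}) = p"
    using assms i(2) unfolding cochain_space_iff by blast
  ultimately show "card \<tau> = Suc p"
    by (metis card_Suc_Diff1)
qed

lemma coboundary_diff: "coboundary (\<phi> - \<psi>) = coboundary \<phi> - coboundary \<psi>"
proof (intro ext)
  fix \<tau> a
  interpret cell_family "cells a"
    by (rule cell_family_cells)
  show "coboundary (\<phi> - \<psi>) \<tau> a = (coboundary \<phi> - coboundary \<psi>) \<tau> a"
    by (simp add: coboundary_def coboundary_diff)
qed

lemma coboundary_add: "coboundary (\<phi> + \<psi>) = coboundary \<phi> + coboundary \<psi>"
proof (intro ext)
  fix \<tau> a
  interpret cell_family "cells a"
    by (rule cell_family_cells)
  show "coboundary (\<phi> + \<psi>) \<tau> a = (coboundary \<phi> + coboundary \<psi>) \<tau> a"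
    by (simp add: coboundary_def coboundary_add)
qed

lemma coboundary_smult: "coboundary (\<lambda>\<sigma> a. c * \<phi> \<sigma> a) = (\<lambda>\<tau> a. c * coboundary \<phi> \<tau> a)"
  by (intro ext) (simp add: coboundary_def cell_coboundary_def sum_distrib_left mult.left_commute)

lemma cochain_supported: "\<phi> \<in> cochain_space p \<Longrightarrow> supported_on (\<lambda>\<sigma>. \<phi> \<sigma> a) (cells a)"
  by (auto simp: cochain_space_iff supported_on_def)

lemma differential_cochain:
  assumes "\<phi> \<in> cochain_space p"
  shows "cech_differential R M (map pvar vs) p (cochain p \<phi>) = cochain (Suc p) (coboundary \<phi>)"
proof
  fix \<tau>
  show "cech_differential R M (map pvar vs) p (cochain p \<phi>) \<tau> = cochain (Suc p) (coboundary \<phi>) \<tau>"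
  proof (cases "\<tau> \<in> indices (Suc p)")
    case True
    have \<tau>: "\<tau> \<subseteq> {..<length vs}" "finite \<tau>" "verts \<tau> \<subseteq> set vs"
      using True finite_idx verts_idx by (auto simp: idx_iff)
    interpret loc: additive_image "local_space (verts \<tau>)" "localization R M (monomials (verts \<tau>))"
        "local_class (verts \<tau>)"
      by (rule additive_image_localization[OF \<tau>(3)])
    interpret loc: abelian_group "localization R M (monomials (verts \<tau>))"
      by (rule loc.abelian_group)
    define \<psi> where "\<psi> = (\<lambda>i. \<lambda>a. incidence_sign i \<tau> * restrict_coeffs (verts \<tau>) (\<phi> (\<tau> - {i})) a)"
    have face: "\<phi> (\<tau> - {i}) \<in> local_space (verts (\<tau> - {i}))" if "i \<in> \<tau>" for i
      using assms idx_face[OF True that] by (simp add: cochain_space_def)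
    have res: "restrict_coeffs (verts \<tau>) (\<phi> (\<tau> - {i})) \<in> local_space (verts \<tau>)" if "i \<in> \<tau>" for i
      by (rule restrict_coeffs_in_local_space[OF face[OF that] verts_mono]) blast
    have \<psi>: "\<psi> \<in> \<tau> \<rightarrow> local_space (verts \<tau>)"
      using res by (auto simp: \<psi>_def intro: local_space_smult)
    have map_eq: "localization_map M (monomials (verts \<tau>)) (cochain p \<phi> (\<tau> - {i})) =
        local_class (verts \<tau>) (restrict_coeffs (verts \<tau>) (\<phi> (\<tau> - {i})))" if "i \<in> \<tau>" for i
      using localization_map_local_class[OF verts_mono \<tau>(3) face[OF that]] idx_face[OF True that]
      by (simp add: cochain_def)
    have signed: "(let y = localization_map M (monomials (verts \<tau>)) (cochain p \<phi> (\<tau> - {i}))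
        in if even (card {k\<in>\<tau>. k < i}) then y
           else \<ominus>\<^bsub>localization R M (monomials (verts \<tau>))\<^esub> y) = local_class (verts \<tau>) (\<psi> i)"
      if "i \<in> \<tau>" for i
      using res[OF that] loc.minus_image[OF res[OF that]]
      by (auto simp: Let_def map_eq[OF that] \<psi>_def incidence_sign_def fun_Compl_def
          intro!: arg_cong[of _ _ "local_class (verts \<tau>)"])
    have "cech_differential R M (map pvar vs) p (cochain p \<phi>) \<tau> =
        finsum (localization R M (monomials (verts \<tau>))) (\<lambda>i. local_class (verts \<tau>) (\<psi> i)) \<tau>"
      using \<psi>
      unfolding cech_differential_def cech_indices_eq restrict_apply'[OF True] summand_eq[OF True]
        denominators_eq[OF \<tau>(1)]
      by (intro loc.finsum_cong' refl signed) (auto simp: loc.carrier_image)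
    also have "\<dots> = local_class (verts \<tau>) (\<Sum>i\<in>\<tau>. \<psi> i)"
      by (rule loc.finsum_image[OF \<psi> \<tau>(2)])
    also have "(\<Sum>i\<in>\<tau>. \<psi> i) = coboundary \<phi> \<tau>"
    proof
      fix a
      show "(\<Sum>i\<in>\<tau>. \<psi> i) a = coboundary \<phi> \<tau> a"
      proof (cases "{v. a v < 0} \<subseteq> verts \<tau>")
        case True
        then show ?thesis
          using \<tau>(1)
          by (simp add: sum_fun_apply \<psi>_def coboundary_def cell_coboundary_def cells_def
              local_exponents_def restrict_coeffs_def)
      next
        case False
        \<comment> \<open>A negative entry outside \<open>verts \<tau>\<close> excludes \<open>a\<close> from the summands of all faces of \<open>\<tau>\<close>.\<close>
        have "\<phi> (\<tau> - {i}) a = 0" for i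
        proof (rule ccontr)
          assume "\<phi> (\<tau> - {i}) a \<noteq> 0"
          then have "{v. a v < 0} \<subseteq> verts (\<tau> - {i})"
            using assms by (auto simp: cochain_space_iff cells_def local_exponents_def)
          then show False
            using False verts_mono[of "\<tau> - {i}" \<tau>] by blast
        qed
        then show ?thesis
          by (simp add: sum_fun_apply \<psi>_def coboundary_def cell_coboundary_def restrict_coeffs_def)
      qed
    qed
    finally show ?thesis
      using True by (simp add: cochain_def[of "Suc p"])
  next
    case False
    then show ?thesis
      by (simp add: cech_differential_def cochain_def)
  qed
qed


section \<open>Cohomology of the Cech complex\<close>

text \<open>The cocycles in terms of coefficient functions.\<close>

definition cocycle_space :: "nat \<Rightarrow> (nat set \<Rightarrow> ('x \<Rightarrow> int) \<Rightarrow> 'k) set" where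
  "cocycle_space p = {\<phi> \<in> cochain_space p. coboundary \<phi> = 0}"

text \<open>The coboundaries in terms of coefficient functions; there are none but \<open>0\<close> in cohomological degree \<open>0\<close>.\<close>

definition coboundary_space :: "nat \<Rightarrow> (nat set \<Rightarrow> ('x \<Rightarrow> int) \<Rightarrow> 'k) set" where
  "coboundary_space p = (case p of 0 \<Rightarrow> {0} | Suc q \<Rightarrow> coboundary ` cochain_space q)"

lemma cocycles_eq: "cech_cocycles R M (map pvar vs) p = cochain p ` cocycle_space p"
proof -
  have "cech_differential R M (map pvar vs) p (cochain p \<phi>) = \<zero>\<^bsub>cech (Suc p)\<^esub> \<longleftrightarrow> coboundary \<phi> = 0"
    if "\<phi> \<in> cochain_space p" for \<phi>
    using inj_on_eq_iff[OF inj_cochain coboundary_cochain_space[OF that] cochain_space_zero]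
    by (simp add: differential_cochain[OF that] cochain_zero)
  then show ?thesis
    unfolding cech_cocycles_def cech_carrier cocycle_space_def by blast
qed

lemma coboundaries_eq: "cech_coboundaries R M (map pvar vs) p = cochain p ` coboundary_space p"
  unfolding cech_coboundaries_def coboundary_space_def
  by (cases p) (auto simp: cochain_zero cech_carrier differential_cochain image_image)

lemma coboundary_space_cochain: "coboundary_space p \<subseteq> cochain_space p"
  by (cases p) (auto simp: coboundary_space_def cochain_space_zero coboundary_cochain_space)

lemma coboundary_space_zero: "0 \<in> coboundary_space p"
proof -
  have "coboundary 0 = 0"
    using coboundary_diff[of 0 0] by simp
  then show ?thesis
    using cochain_space_zero by (cases p) (auto simp: coboundary_space_def intro!: image_eqI[of _ _ 0])
qed

lemma coboundary_space_add:
  "\<phi> \<in> coboundary_space p \<Longrightarrow> \<psi> \<in> coboundary_space p \<Longrightarrow> \<phi> + \<psi> \<in> coboundary_space p"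
  by (cases p) (auto simp: coboundary_space_def cochain_space_add simp flip: coboundary_add)

lemma coboundary_space_smult:
  "\<phi> \<in> coboundary_space p \<Longrightarrow> (\<lambda>\<sigma> a. c * \<phi> \<sigma> a) \<in> coboundary_space p"
  by (cases p)
    (auto simp: coboundary_space_def cochain_space_smult fun_eq_iff simp flip: coboundary_smult)

lemma coboundary_space_diff:
  "\<phi> \<in> coboundary_space p \<Longrightarrow> \<psi> \<in> coboundary_space p \<Longrightarrow> \<phi> - \<psi> \<in> coboundary_space p"
  using coboundary_space_add[of \<phi> p "\<lambda>\<sigma> a. (- 1) * \<psi> \<sigma> a"] coboundary_space_smult[of \<psi> p "- 1"]
  by (simp add: plus_fun_def fun_diff_def)

text \<open>The cohomology class of the cochain with coefficient functions \<open>\<phi>\<close>, as a coset of the coboundaries.\<close>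

definition cohomology_class :: "nat \<Rightarrow> (nat set \<Rightarrow> ('x \<Rightarrow> int) \<Rightarrow> 'k) \<Rightarrow>
    (nat set \<Rightarrow> (('x, 'k) mpol set \<times> ('x, 'k) mpol) set) set" where
  "cohomology_class p \<phi> = (\<lambda>\<beta>. cochain p (\<beta> + \<phi>)) ` coboundary_space p"

lemma coset_eq:
  assumes "\<phi> \<in> cochain_space p"
  shows "cech_coboundaries R M (map pvar vs) p +>\<^bsub>cech p\<^esub> cochain p \<phi> = cohomology_class p \<phi>"
  unfolding coboundaries_eq a_r_coset_def' cohomology_class_def
  using coboundary_space_cochain[of p] assms by (auto simp: cochain_add subset_iff)

lemma cohomology_class_eq_iff:
  assumes "\<phi> \<in> cochain_space p" "\<psi> \<in> cochain_space p"
  shows "cohomology_class p \<phi> = cohomology_class p \<psi> \<longleftrightarrow> \<phi> - \<psi> \<in> coboundary_space p"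
proof
  assume "cohomology_class p \<phi> = cohomology_class p \<psi>"
  then have "cochain p (0 + \<phi>) \<in> cohomology_class p \<psi>"
    using coboundary_space_zero[of p] unfolding cohomology_class_def by blast
  then obtain \<beta> where \<beta>: "\<beta> \<in> coboundary_space p" "cochain p \<phi> = cochain p (\<beta> + \<psi>)"
    by (auto simp: cohomology_class_def)
  then have "\<phi> = \<beta> + \<psi>"
    using inj_onD[OF inj_cochain] assms coboundary_space_cochain cochain_space_add by blast
  then show "\<phi> - \<psi> \<in> coboundary_space p"
    using \<beta>(1) by simp
next
  have sub: "cohomology_class p \<phi> \<subseteq> cohomology_class p \<psi>" if "\<phi> - \<psi> \<in> coboundary_space p" for \<phi> \<psi>
  proof
    fix x assume "x \<in> cohomology_class p \<phi>"
    then obtain \<beta> where "\<beta> \<in> coboundary_space p" "x = cochain p (\<beta> + (\<phi> - \<psi>) + \<psi>)"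
      by (auto simp: cohomology_class_def)
    then show "x \<in> cohomology_class p \<psi>"
      using coboundary_space_add that unfolding cohomology_class_def by blast
  qed
  assume *: "\<phi> - \<psi> \<in> coboundary_space p"
  moreover have "\<psi> - \<phi> \<in> coboundary_space p"
    using coboundary_space_diff[OF coboundary_space_zero *] by simp
  ultimately show "cohomology_class p \<phi> = cohomology_class p \<psi>"
    using sub by blast
qed

lemma cohomology_class_add:
  assumes "\<phi> \<in> cochain_space p" "\<psi> \<in> cochain_space p"
  shows "cohomology_class p \<phi> <+>\<^bsub>cech p\<^esub> cohomology_class p \<psi> = cohomology_class p (\<phi> + \<psi>)"
proof -
  have *: "cochain p (\<beta> + \<phi>) \<oplus>\<^bsub>cech p\<^esub> cochain p (\<gamma> + \<psi>) = cochain p ((\<beta> + \<gamma>) + (\<phi> + \<psi>))"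
    if "\<beta> \<in> coboundary_space p" "\<gamma> \<in> coboundary_space p" for \<beta> \<gamma>
  proof -
    have "\<beta> + \<phi> \<in> cochain_space p" "\<gamma> + \<psi> \<in> cochain_space p"
      using that assms coboundary_space_cochain cochain_space_add by blast+
    then show ?thesis
      by (simp add: cochain_add add_ac)
  qed
  show ?thesis
  proof (intro equalityI subsetI)
    fix x assume "x \<in> cohomology_class p \<phi> <+>\<^bsub>cech p\<^esub> cohomology_class p \<psi>"
    then show "x \<in> cohomology_class p (\<phi> + \<psi>)"
      using * coboundary_space_add by (auto simp: set_add_def' cohomology_class_def)
  next
    fix x assume "x \<in> cohomology_class p (\<phi> + \<psi>)"
    then obtain \<beta> where "\<beta> \<in> coboundary_space p" "x = cochain p ((\<beta> + 0) + (\<phi> + \<psi>))"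
      by (auto simp: cohomology_class_def)
    then have "x = cochain p (\<beta> + \<phi>) \<oplus>\<^bsub>cech p\<^esub> cochain p (0 + \<psi>)"
      using *[OF _ coboundary_space_zero] by simp
    then show "x \<in> cohomology_class p \<phi> <+>\<^bsub>cech p\<^esub> cohomology_class p \<psi>"
      using \<open>\<beta> \<in> coboundary_space p\<close> coboundary_space_zero
      unfolding set_add_def' cohomology_class_def by blast
  qed
qed

lemma cohomology_class_smult:
  assumes "\<phi> \<in> cochain_space p"
  shows "(\<Union>x\<in>cohomology_class p \<phi>. cech_coboundaries R M (map pvar vs) p +>\<^bsub>cech p\<^esub> (pconst c \<odot>\<^bsub>cech p\<^esub> x)) =
    cohomology_class p (\<lambda>\<sigma> a. c * \<phi> \<sigma> a)"
proof -
  have "cech_coboundaries R M (map pvar vs) p +>\<^bsub>cech p\<^esub> (pconst c \<odot>\<^bsub>cech p\<^esub> x) =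
      cohomology_class p (\<lambda>\<sigma> a. c * \<phi> \<sigma> a)" if "x \<in> cohomology_class p \<phi>" for x
  proof -
    from that obtain \<beta> where \<beta>: "\<beta> \<in> coboundary_space p" "x = cochain p (\<beta> + \<phi>)"
      by (auto simp: cohomology_class_def)
    have mem: "\<beta> + \<phi> \<in> cochain_space p"
      using \<beta>(1) assms coboundary_space_cochain cochain_space_add by blast
    have "(\<lambda>\<sigma> a. c * (\<beta> + \<phi>) \<sigma> a) - (\<lambda>\<sigma> a. c * \<phi> \<sigma> a) = (\<lambda>\<sigma> a. c * \<beta> \<sigma> a)"
      by (simp add: fun_eq_iff algebra_simps)
    then show ?thesis
      using coboundary_space_smult[OF \<beta>(1), of c]
      by (simp add: \<beta>(2) cochain_smult[OF mem] coset_eq[OF cochain_space_smult[OF mem]]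
          cohomology_class_eq_iff[OF cochain_space_smult[OF mem] cochain_space_smult[OF assms]]
          del: plus_fun_apply)
  qed
  moreover have "cohomology_class p \<phi> \<noteq> {}"
    using coboundary_space_zero by (auto simp: cohomology_class_def)
  ultimately show ?thesis
    by auto
qed

text \<open>The cocycles of internal degree \<open>l\<close>.\<close>

definition homogeneous_cocycles :: "nat \<Rightarrow> int \<Rightarrow> (nat set \<Rightarrow> ('x \<Rightarrow> int) \<Rightarrow> 'k) set" where
  "homogeneous_cocycles p l = {\<phi> \<in> cocycle_space p. \<forall>\<sigma>. homogeneous l (\<phi> \<sigma>)}"

lemma component_eq:
  "cech_component R (polynomial_component (set vs)) (map pvar vs) M (residue_component (set vs) I) p l =
    cochain p ` {\<phi> \<in> cochain_space p. \<forall>\<sigma>. homogeneous l (\<phi> \<sigma>)}"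
proof -
  have "cech_component R (polynomial_component (set vs)) (map pvar vs) M (residue_component (set vs) I) p l =
      (\<Pi>\<^sub>E \<sigma>\<in>indices p. local_class (verts \<sigma>) ` {\<phi> \<in> local_space (verts \<sigma>). homogeneous l \<phi>})"
    unfolding cech_component_def cech_indices_eq
    by (intro PiE_cong) (simp add: idx_iff denominators_eq localization_component_local_class verts_subset)
  also have "\<dots> = cochain p `
      {\<phi> \<in> cochain_space p. \<forall>\<sigma>\<in>indices p. \<phi> \<sigma> \<in> {\<phi> \<in> local_space (verts \<sigma>). homogeneous l \<phi>}}"
    by (rule cochain_image) blast
  also have "{\<phi> \<in> cochain_space p. \<forall>\<sigma>\<in>indices p. \<phi> \<sigma> \<in> {\<phi> \<in> local_space (verts \<sigma>). homogeneous l \<phi>}} =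
      {\<phi> \<in> cochain_space p. \<forall>\<sigma>. homogeneous l (\<phi> \<sigma>)}"
    by (auto simp: cochain_space_def homogeneous_def)
  finally show ?thesis .
qed

lemma cohomology_degree_carrier:
  "carrier (residue_local_cohomology_degree vs I p l) = cohomology_class p ` homogeneous_cocycles p l"
proof -
  have "cech_cocycles R M (map pvar vs) p \<inter> cech_component R (polynomial_component (set vs)) (map pvar vs) M
      (residue_component (set vs) I) p l = cochain p ` homogeneous_cocycles p l"
    unfolding cocycles_eq component_eq
    by (subst inj_on_image_Int[OF inj_cochain, symmetric])
      (auto simp: homogeneous_cocycles_def cocycle_space_def)
  then have "carrier (residue_local_cohomology_degree vs I p l) =
      (\<lambda>\<phi>. cech_coboundaries R M (map pvar vs) p +>\<^bsub>cech p\<^esub> cochain p \<phi>) ` homogeneous_cocycles p l"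
    by (simp add: residue_local_cohomology_degree_def local_cohomology_component_def Let_def image_image)
  also have "\<dots> = cohomology_class p ` homogeneous_cocycles p l"
    by (intro image_cong refl coset_eq) (simp add: homogeneous_cocycles_def cocycle_space_def)
  finally show ?thesis .
qed

lemma cohomology_degree_ops:
  "\<zero>\<^bsub>residue_local_cohomology_degree vs I p l\<^esub> = cohomology_class p 0"
  "\<phi> \<in> cochain_space p \<Longrightarrow> \<psi> \<in> cochain_space p \<Longrightarrow>
    cohomology_class p \<phi> \<oplus>\<^bsub>residue_local_cohomology_degree vs I p l\<^esub> cohomology_class p \<psi> =
    cohomology_class p (\<phi> + \<psi>)"
  "\<phi> \<in> cochain_space p \<Longrightarrow>
    c \<odot>\<^bsub>residue_local_cohomology_degree vs I p l\<^esub> cohomology_class p \<phi> = cohomology_class p (\<lambda>\<sigma> a. c * \<phi> \<sigma> a)"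
proof -
  show "\<zero>\<^bsub>residue_local_cohomology_degree vs I p l\<^esub> = cohomology_class p 0"
    by (simp add: residue_local_cohomology_degree_def Let_def residue_local_cohomology_def
        local_cohomology_def quotient_module_def coboundaries_eq cohomology_class_def)
  show "cohomology_class p \<phi> \<oplus>\<^bsub>residue_local_cohomology_degree vs I p l\<^esub> cohomology_class p \<psi> =
    cohomology_class p (\<phi> + \<psi>)" if "\<phi> \<in> cochain_space p" "\<psi> \<in> cochain_space p"
    using cohomology_class_add[OF that]
    by (simp add: residue_local_cohomology_degree_def Let_def residue_local_cohomology_def
        local_cohomology_def quotient_module_def set_add_def')
  show "c \<odot>\<^bsub>residue_local_cohomology_degree vs I p l\<^esub> cohomology_class p \<phi> =
      cohomology_class p (\<lambda>\<sigma> a. c * \<phi> \<sigma> a)" if "\<phi> \<in> cochain_space p"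
    using cohomology_class_smult[OF that]
    by (simp add: residue_local_cohomology_degree_def Let_def residue_local_cohomology_def
        local_cohomology_def quotient_module_def a_r_coset_def')
qed

end


section \<open>Critical cells of a whiskered complex\<close>

text \<open>The two properties of the independence complex of a multi-clique-whiskered graph, with old vertices
  \<open>Y\<close>, on which the computation rests: whether a whisker can be added to a face depends on the old
  vertices of the face only, and a face that is not maximal can be extended by a whisker.\<close>

locale whiskered_complex = stanley_reisner_cech vs D I
  for vs :: "'x list" and D :: "'x set set" and I :: "('x, 'k :: field) mpol set" +
  fixes Y :: "'x set"
  assumes link: "F \<in> D \<Longrightarrow> w \<in> set vs - Y \<Longrightarrow> insert w F \<in> D \<longleftrightarrow> insert w (F \<inter> Y) \<in> D"
    and extend: "F \<in> D \<Longrightarrow> G \<in> D \<Longrightarrow> F \<subset> G \<Longrightarrow> \<exists>w\<in>set vs - Y. w \<notin> F \<and> insert w F \<in> D"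
begin

text \<open>The maximal faces.\<close>

definition facet :: "'x set \<Rightarrow> bool" where
  "facet F \<longleftrightarrow> F \<in> D \<and> (\<forall>G\<in>D. F \<subseteq> G \<longrightarrow> G = F)"

text \<open>The cells that survive the matching for the exponent \<open>a\<close>: the facets that contain the support of
  \<open>a\<close> and whose whiskers all lie in the support. There are none if \<open>a\<close> has a positive entry.\<close>

definition critical :: "('x \<Rightarrow> int) \<Rightarrow> nat set set" where
  "critical a = {\<sigma>. \<sigma> \<subseteq> {..<length vs} \<and> (\<forall>v. a v \<le> 0) \<and> facet (verts \<sigma>) \<and>
     verts \<sigma> - Y \<subseteq> {v. a v \<noteq> 0} \<and> {v. a v \<noteq> 0} \<subseteq> verts \<sigma>}"

lemma verts_insert: "verts (insert w \<sigma>) = insert (vs ! w) (verts \<sigma>)"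
  by (simp add: verts_def)

lemma verts_remove:
  "\<sigma> \<subseteq> {..<length vs} \<Longrightarrow> w < length vs \<Longrightarrow> verts (\<sigma> - {w}) = verts \<sigma> - {vs ! w}"
  using distinct by (auto simp: verts_def nth_eq_iff_index_eq subset_iff)

text \<open>A single layer suffices if \<open>a\<close> has a positive entry, with toggle element \<open>u\<close>.\<close>

lemma critical_layers_positive:
  assumes "a u > 0"
  shows "layered_cell_family (cells a) {} \<and> critical_cells (cells a) {} = critical a"
proof -
  interpret cell_family "cells a"
    by (rule cell_family_cells)
  have "\<sigma> \<notin> critical_cells (cells a) {}" for \<sigma>
  proof
    assume \<sigma>: "\<sigma> \<in> critical_cells (cells a) {}"
    then have "{v. a v \<noteq> 0} \<union> verts \<sigma> \<in> D"
      by (simp add: critical_cells_def cells_def local_exponents_def)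
    then have "u \<in> set vs"
      using face_vertices assms by fastforce
    then obtain w where w: "w < length vs" "vs ! w = u"
      by (auto simp: in_set_conv_nth)
    have "insert w \<rho> \<in> cells a \<and> \<rho> - {w} \<in> cells a" if \<rho>: "\<rho> \<in> cells a" for \<rho>
    proof -
      have "verts (insert w \<rho>) = insert u (verts \<rho>)" "verts (\<rho> - {w}) = verts \<rho> - {u}"
        using \<rho> w verts_insert verts_remove by (auto simp: cells_def)
      moreover have "{v. a v \<noteq> 0} \<union> insert u (verts \<rho>) = {v. a v \<noteq> 0} \<union> verts \<rho>"
        "{v. a v \<noteq> 0} \<union> (verts \<rho> - {u}) = {v. a v \<noteq> 0} \<union> verts \<rho>"
        using assms by auto
      moreover have "{v. a v < 0} \<subseteq> verts \<rho> - {u}"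
        using \<rho> assms by (auto simp: cells_def local_exponents_def)
      ultimately show ?thesis
        using \<rho> w(1) by (auto simp: cells_def local_exponents_def)
    qed
    then have "toggle_element (cells a) {} (\<sigma> \<inter> {}) w"
      by (simp add: toggle_element_def)
    with \<sigma> show False
      by (auto simp: critical_cells_def)
  qed
  moreover have "critical a = {}"
    using assms by (auto simp: critical_def not_le intro!: exI[of _ u])
  ultimately show ?thesis
    by (auto intro!: layered_cell_family.intro layered_cell_family_axioms.intro cell_family_axioms)
qed

text \<open>For \<open>a \<le> 0\<close> the layers are given by the old vertices, and the toggle elements are whiskers.\<close>

lemma critical_layers_nonpositive:
  assumes nonpos: "\<And>v. a v \<le> 0"
  defines "Z \<equiv> {i. i < length vs \<and> vs ! i \<in> Y}"
  shows "layered_cell_family (cells a) Z \<and> critical_cells (cells a) Z = critical a"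
proof -
  interpret cell_family "cells a"
    by (rule cell_family_cells)
  define N where "N = {v. a v \<noteq> 0}"
  have N: "{v. a v < 0} = N"
    using nonpos by (auto simp: N_def order.strict_iff_order)
  have cells_iff: "\<sigma> \<in> cells a \<longleftrightarrow> \<sigma> \<subseteq> {..<length vs} \<and> N \<subseteq> verts \<sigma> \<and> verts \<sigma> \<in> D" for \<sigma>
  proof -
    have "N \<union> verts \<sigma> = verts \<sigma>" if "N \<subseteq> verts \<sigma>"
      using that by blast
    then show ?thesis
      unfolding cells_def local_exponents_def mem_Collect_eq N unfolding N_def[symmetric] by auto
  qed
  have labels: "verts (\<sigma> \<inter> Z) = verts \<sigma> \<inter> Y" if "\<sigma> \<subseteq> {..<length vs}" for \<sigma>
    using that by (auto simp: verts_def Z_def)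
  have toggle: "toggle_element (cells a) Z (\<sigma> \<inter> Z) w"
    if w: "w < length vs" "vs ! w \<notin> Y" "vs ! w \<notin> N" and \<sigma>: "\<sigma> \<in> cells a"
      and face: "insert (vs ! w) (verts \<sigma>) \<in> D" for w \<sigma>
    unfolding toggle_element_def
  proof (intro conjI ballI impI)
    show "w \<notin> Z"
      using w by (simp add: Z_def)
    fix \<rho> assume \<rho>: "\<rho> \<in> cells a" "\<rho> \<inter> Z = \<sigma> \<inter> Z"
    have whisker: "vs ! w \<in> set vs - Y"
      using w by simp
    have "verts \<rho> \<inter> Y = verts \<sigma> \<inter> Y"
      using labels[of \<rho>] labels[of \<sigma>] \<rho> \<sigma> by (simp add: cells_iff)
    then have "insert (vs ! w) (verts \<rho>) \<in> D"
      using face link[OF _ whisker, of "verts \<sigma>"] link[OF _ whisker, of "verts \<rho>"] \<rho> \<sigma>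
      by (simp add: cells_iff)
    then show "insert w \<rho> \<in> cells a"
      using \<rho>(1) w(1) by (auto simp: cells_iff verts_insert)
    have "verts \<rho> - {vs ! w} \<in> D"
      by (rule face_mono[of "verts \<rho>"]) (use \<rho>(1) in \<open>auto simp: cells_iff\<close>)
    then show "\<rho> - {w} \<in> cells a"
      using \<rho>(1) w verts_remove[of \<rho> w] by (auto simp: cells_iff)
  qed
  have crit_eq: "critical_cells (cells a) Z = critical a"
  proof (intro equalityI subsetI)
    fix \<sigma> assume crit: "\<sigma> \<in> critical_cells (cells a) Z"
    then have \<sigma>: "\<sigma> \<in> cells a"
      by (simp add: critical_cells_def)
    have no_toggle: False
      if "v \<in> set vs - Y" "v \<notin> N" "insert v (verts \<sigma>) \<in> D" for v
      using that toggle[OF _ _ _ \<sigma>] crit by (auto simp: critical_cells_def in_set_conv_nth)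
    have "facet (verts \<sigma>)"
      unfolding facet_def
    proof (intro conjI ballI impI)
      show "verts \<sigma> \<in> D"
        using \<sigma> by (simp add: cells_iff)
      fix G assume "G \<in> D" "verts \<sigma> \<subseteq> G"
      show "G = verts \<sigma>"
      proof (rule ccontr)
        assume "G \<noteq> verts \<sigma>"
        then have "verts \<sigma> \<subset> G"
          using \<open>verts \<sigma> \<subseteq> G\<close> by blast
        then obtain v where "v \<in> set vs - Y" "v \<notin> verts \<sigma>" "insert v (verts \<sigma>) \<in> D"
          using extend[OF \<open>verts \<sigma> \<in> D\<close> \<open>G \<in> D\<close>] by blast
        then show False
          using no_toggle[of v] \<sigma> by (auto simp: cells_iff)
      qed
    qed
    moreover have "verts \<sigma> - Y \<subseteq> N"
    proof
      fix v assume v: "v \<in> verts \<sigma> - Y"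
      then have "insert v (verts \<sigma>) = verts \<sigma>"
        by blast
      moreover have "v \<in> set vs"
        using v \<sigma> verts_subset by (auto simp: cells_iff)
      ultimately show "v \<in> N"
        using no_toggle[of v] v \<sigma> by (auto simp: cells_iff)
    qed
    ultimately show "\<sigma> \<in> critical a"
      using \<sigma> nonpos by (simp add: critical_def cells_iff flip: N_def)
  next
    fix \<sigma> assume crit: "\<sigma> \<in> critical a"
    then have \<sigma>: "\<sigma> \<subseteq> {..<length vs}" "facet (verts \<sigma>)" "verts \<sigma> - Y \<subseteq> N" "N \<subseteq> verts \<sigma>"
      by (auto simp: critical_def N_def)
    then have cell: "\<sigma> \<in> cells a"
      by (simp add: cells_iff facet_def)
    have "\<not> toggle_element (cells a) Z (\<sigma> \<inter> Z) w" for w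
    proof
      assume "toggle_element (cells a) Z (\<sigma> \<inter> Z) w"
      then have w: "w \<notin> Z" "insert w \<sigma> \<in> cells a" "\<sigma> - {w} \<in> cells a"
        using cell by (auto simp: toggle_element_def)
      then have "w < length vs" "verts (insert w \<sigma>) \<in> D"
        by (auto simp: cells_iff)
      then have "verts (insert w \<sigma>) = verts \<sigma>"
        using \<sigma>(2) verts_mono[of \<sigma> "insert w \<sigma>"] by (auto simp: facet_def)
      then have "vs ! w \<in> verts \<sigma>"
        by (auto simp: verts_insert)
      moreover have "vs ! w \<notin> Y"
        using w(1) \<open>w < length vs\<close> by (simp add: Z_def)
      ultimately have "vs ! w \<in> N"
        using \<sigma>(3) by blast
      moreover have "N \<subseteq> verts \<sigma> - {vs ! w}"
        using w(3) verts_remove[OF \<sigma>(1) \<open>w < length vs\<close>] by (simp add: cells_iff)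
      ultimately show False
        by blast
    qed
    then show "\<sigma> \<in> critical_cells (cells a) Z"
      using cell by (simp add: critical_cells_def)
  qed
  have "\<tau> = \<sigma>" if "\<sigma> \<in> critical_cells (cells a) Z" "\<tau> \<in> cells a" "\<sigma> \<subseteq> \<tau>" for \<sigma> \<tau>
  proof -
    have "facet (verts \<sigma>)" "\<sigma> \<subseteq> {..<length vs}" "\<tau> \<subseteq> {..<length vs}" "verts \<tau> \<in> D"
      using that by (auto simp: crit_eq critical_def cells_iff)
    then have "verts \<tau> = verts \<sigma>"
      using verts_mono[OF \<open>\<sigma> \<subseteq> \<tau>\<close>] by (simp add: facet_def)
    then have "\<tau> \<subseteq> \<sigma>"
      using nth_in_verts[of \<sigma>] nth_in_verts[of \<tau>] \<open>\<tau> \<subseteq> {..<length vs}\<close> \<open>\<sigma> \<subseteq> {..<length vs}\<close>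
      by (metis lessThan_iff subset_iff)
    with \<open>\<sigma> \<subseteq> \<tau>\<close> show ?thesis
      by blast
  qed
  moreover have "finite Z"
    by (simp add: Z_def)
  ultimately have "layered_cell_family (cells a) Z"
    by (intro layered_cell_family.intro layered_cell_family_axioms.intro cell_family_axioms) auto
  with crit_eq show ?thesis
    by blast
qed

lemma critical_layers:
  obtains Z where "layered_cell_family (cells a) Z" "critical_cells (cells a) Z = critical a"
proof (cases "\<exists>u. a u > 0")
  case True
  then show thesis
    using critical_layers_positive that by blast
next
  case False
  then have "\<And>v. a v \<le> 0"
    by (simp add: not_less)
  then show thesis
    using critical_layers_nonpositive that by blast
qed

lemma critical_reduction:
  fixes f :: "nat set \<Rightarrow> 'k"
  assumes "supported_on f (cells a)" and "\<And>\<tau>. cell_coboundary (cells a) f \<tau> = 0"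
  shows "\<exists>g. supported_on g (cells a) \<and>
    supported_on (\<lambda>\<sigma>. f \<sigma> - cell_coboundary (cells a) g \<sigma>) (critical a)"
proof -
  obtain Z where Z: "layered_cell_family (cells a) Z" "critical_cells (cells a) Z = critical a"
    by (rule critical_layers)
  show ?thesis
    using layered_cell_family.reduce_to_critical[OF Z(1) assms] by (simp add: Z(2))
qed

lemma critical_coboundary:
  fixes g :: "nat set \<Rightarrow> 'k"
  assumes "supported_on g (cells a)" and "supported_on (cell_coboundary (cells a) g) (critical a)"
  shows "cell_coboundary (cells a) g \<tau> = 0"
proof -
  obtain Z where Z: "layered_cell_family (cells a) Z" "critical_cells (cells a) Z = critical a"
    by (rule critical_layers)
  show ?thesis
    using layered_cell_family.critical_coboundary_zero[OF Z(1)] assms by (simp add: Z(2))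
qed

lemma critical_cocycle:
  fixes f :: "nat set \<Rightarrow> 'k"
  assumes "supported_on f (critical a)"
  shows "cell_coboundary (cells a) f \<tau> = 0"
proof -
  obtain Z where Z: "layered_cell_family (cells a) Z" "critical_cells (cells a) Z = critical a"
    by (rule critical_layers)
  show ?thesis
    using layered_cell_family.coboundary_critical[OF Z(1)] assms by (simp add: Z(2))
qed

lemma critical_subset_cells: "critical a \<subseteq> cells a"
proof -
  obtain Z where "critical_cells (cells a) Z = critical a"
    by (rule critical_layers)
  then show ?thesis
    by (auto simp: critical_cells_def)
qed


section \<open>The dimension of the homogeneous components\<close>

text \<open>The basis of the part of degree \<open>l\<close> of the \<open>p\<close>-th cohomology: a critical cell of \<open>p\<close> elements
  and its exponent.\<close>

definition critical_pairs :: "nat \<Rightarrow> int \<Rightarrow> (nat set \<times> ('x \<Rightarrow> int)) set" where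
  "critical_pairs p l = {(\<sigma>, a). \<sigma> \<in> critical a \<and> card \<sigma> = p \<and> (\<Sum>v\<in>set vs. a v) = l}"

text \<open>The reductions for the individual exponents fit together to one Cech cochain \<open>g\<close>, which involves
  only the finitely many exponents that occur in \<open>\<phi>\<close>.\<close>

lemma critical_representative:
  assumes \<phi>: "\<phi> \<in> homogeneous_cocycles (Suc q) l"
  obtains g where "g \<in> cochain_space q"
    "\<And>\<sigma> a. (\<phi> - coboundary g) \<sigma> a \<noteq> 0 \<Longrightarrow> (\<sigma>, a) \<in> critical_pairs (Suc q) l"
proof -
  have cochain: "\<phi> \<in> cochain_space (Suc q)" and cocycle: "coboundary \<phi> = 0"
    and hom: "\<And>\<sigma>. homogeneous l (\<phi> \<sigma>)"
    using \<phi> by (auto simp: homogeneous_cocycles_def cocycle_space_def)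
  have "\<exists>g. supported_on g (cells a) \<and>
      supported_on (\<lambda>\<sigma>. \<phi> \<sigma> a - cell_coboundary (cells a) g \<sigma>) (critical a)" for a
    using critical_reduction[OF cochain_supported[OF cochain, of a]] fun_cong[OF fun_cong[OF cocycle], of _ a]
    by (simp add: coboundary_def)
  then obtain g where g: "\<And>a. supported_on (g a) (cells a)"
    "\<And>a. supported_on (\<lambda>\<sigma>. \<phi> \<sigma> a - cell_coboundary (cells a) (g a) \<sigma>) (critical a)"
    by metis
  \<comment> \<open>Only finitely many exponents and only cells of size \<open>q\<close> are needed.\<close>
  define h where "h = (\<lambda>\<sigma> a. if card \<sigma> = q \<and> (\<exists>\<rho>. \<phi> \<rho> a \<noteq> 0) then g a \<sigma> else 0)"
  have h: "h \<in> cochain_space q"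
    unfolding cochain_space_iff
  proof (intro conjI allI impI)
    fix \<sigma>
    have "\<rho> \<in> indices (Suc q)" if "\<phi> \<rho> a \<noteq> 0" for \<rho> a
      using cochain that by (auto simp: cochain_space_def)
    then have "{a. h \<sigma> a \<noteq> 0} \<subseteq> (\<Union>\<rho>\<in>indices (Suc q). {a. \<phi> \<rho> a \<noteq> 0})"
      by (auto simp: h_def)
    moreover have "finite (\<Union>\<rho>\<in>indices (Suc q). {a. \<phi> \<rho> a \<noteq> 0})"
      using cochain finite_indices by (simp add: cochain_space_iff)
    ultimately show "finite {a. h \<sigma> a \<noteq> 0}"
      by (rule finite_subset)
  next
    fix \<sigma> a assume "h \<sigma> a \<noteq> 0"
    then show "\<sigma> \<in> cells a" "card \<sigma> = q"
      using g(1)[of a] by (auto simp: h_def supported_on_def split: if_splits)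
  qed
  have "(\<sigma>, a) \<in> critical_pairs (Suc q) l" if nz: "(\<phi> - coboundary h) \<sigma> a \<noteq> 0" for \<sigma> a
  proof -
    have card: "card \<sigma> = Suc q"
      using cochain_space_diff[OF cochain coboundary_cochain_space[OF h]] nz
      by (simp add: cochain_space_iff)
    have ex: "\<exists>\<rho>. \<phi> \<rho> a \<noteq> 0"
    proof (rule ccontr)
      assume "\<nexists>\<rho>. \<phi> \<rho> a \<noteq> 0"
      then have "\<phi> \<sigma> a = 0" "coboundary h \<sigma> a = 0"
        by (auto simp: h_def coboundary_def cell_coboundary_def)
      with nz show False
        by simp
    qed
    have "finite \<sigma>"
      using card by (simp add: card_ge_0_finite)
    then have "cell_coboundary (cells a) (\<lambda>\<sigma>. h \<sigma> a) \<sigma> = cell_coboundary (cells a) (g a) \<sigma>"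
      using card ex by (auto simp: h_def cell_coboundary_def intro!: sum.cong)
    then have "\<phi> \<sigma> a - cell_coboundary (cells a) (g a) \<sigma> \<noteq> 0"
      using nz by (simp add: coboundary_def)
    then have "\<sigma> \<in> critical a"
      using g(2)[of a] by (auto simp: supported_on_def)
    moreover have "(\<Sum>v\<in>set vs. a v) = l"
      using ex hom by (auto simp: homogeneous_def)
    ultimately show ?thesis
      using card by (simp add: critical_pairs_def)
  qed
  with h show thesis
    by (rule that)
qed

lemma critical_cochain:
  assumes fin: "finite (critical_pairs p l)"
    and \<phi>: "\<And>\<sigma> a. \<phi> \<sigma> a \<noteq> 0 \<Longrightarrow> (\<sigma>, a) \<in> critical_pairs p l"
  shows "\<phi> \<in> homogeneous_cocycles p l"
proof -
  have "finite {a. \<phi> \<sigma> a \<noteq> 0}" for \<sigma>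
    by (rule finite_subset[OF _ finite_imageI[OF fin, of snd]]) (use \<phi> in force)
  moreover have "\<sigma> \<in> cells a \<and> card \<sigma> = p" if "\<phi> \<sigma> a \<noteq> 0" for \<sigma> a
    using \<phi>[OF that] critical_subset_cells by (auto simp: critical_pairs_def)
  ultimately have "\<phi> \<in> cochain_space p"
    by (simp add: cochain_space_iff)
  moreover have "coboundary \<phi> = 0"
  proof (intro ext)
    fix \<tau> a
    have "supported_on (\<lambda>\<sigma>. \<phi> \<sigma> a) (critical a)"
      using \<phi> by (auto simp: supported_on_def critical_pairs_def)
    then show "coboundary \<phi> \<tau> a = 0 \<tau> a"
      by (simp add: coboundary_def critical_cocycle)
  qed
  moreover have "homogeneous l (\<phi> \<sigma>)" for \<sigma>
    using \<phi> by (auto simp: homogeneous_def critical_pairs_def)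
  ultimately show ?thesis
    by (simp add: homogeneous_cocycles_def cocycle_space_def)
qed

lemma critical_coboundary_space:
  assumes "\<phi> \<in> coboundary_space p" and \<phi>: "\<And>\<sigma> a. \<phi> \<sigma> a \<noteq> 0 \<Longrightarrow> (\<sigma>, a) \<in> critical_pairs p l"
  shows "\<phi> = 0"
proof (cases p)
  case 0
  then show ?thesis
    using assms(1) by (simp add: coboundary_space_def)
next
  case (Suc q)
  then obtain g where g: "g \<in> cochain_space q" "\<phi> = coboundary g"
    using assms(1) by (auto simp: coboundary_space_def)
  show ?thesis
  proof (intro ext)
    fix \<tau> a
    have "supported_on (cell_coboundary (cells a) (\<lambda>\<sigma>. g \<sigma> a)) (critical a)"
      using \<phi> by (auto simp: supported_on_def critical_pairs_def g(2) coboundary_def)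
    then show "\<phi> \<tau> a = 0 \<tau> a"
      using critical_coboundary[OF cochain_supported[OF g(1)]] by (simp add: g(2) coboundary_def)
  qed
qed

text \<open>The cochains on critical pairs represent each class of degree \<open>l\<close> exactly once. They are encoded
  as vectors, along an enumeration \<open>e\<close> of the critical pairs.\<close>

lemma cohomology_degree_dim:
  assumes fin: "finite (critical_pairs (Suc q) l)"
  defines "H \<equiv> residue_local_cohomology_degree vs I (Suc q) l"
  shows "vectorspace.fin_dim class_ring H"
    and "vectorspace.dim class_ring H = card (critical_pairs (Suc q) l)"
proof -
  let ?P = "critical_pairs (Suc q) l"
  let ?N = "card ?P"
  obtain e where e: "bij_betw e ?P {0..<?N}"
    using ex_bij_betw_finite_nat[OF fin] by blast
  then have e_less: "e x < ?N" if "x \<in> ?P" for x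
    using that by (auto simp: bij_betw_def)
  interpret V: vec_space "TYPE('k)" ?N .
  define F where "F = (\<lambda>v \<sigma> a. if (\<sigma>, a) \<in> ?P then vec_index v (e (\<sigma>, a)) else (0 :: 'k))"
  have F_cocycle: "F v \<in> homogeneous_cocycles (Suc q) l" for v
    by (rule critical_cochain[OF fin]) (simp add: F_def split: if_splits)
  then have F_cochain: "F v \<in> cochain_space (Suc q)" for v
    by (simp add: homogeneous_cocycles_def cocycle_space_def)
  define T where "T = (\<lambda>v. cohomology_class (Suc q) (F v))"
  have inj: "inj_on T (carrier (module_vec TYPE('k) ?N))"
  proof (rule inj_onI)
    fix v w assume mem: "v \<in> carrier (module_vec TYPE('k) ?N)" "w \<in> carrier (module_vec TYPE('k) ?N)"
      and "T v = T w"
    then have "F v - F w \<in> coboundary_space (Suc q)"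
      by (simp add: T_def cohomology_class_eq_iff[OF F_cochain F_cochain])
    then have "F v - F w = 0"
      by (rule critical_coboundary_space) (simp add: F_def split: if_splits)
    then have eq: "F v = F w"
      by simp
    show "v = w"
    proof (rule eq_vecI)
      fix i assume "i < dim_vec w"
      then have "i \<in> e ` ?P"
        using e mem by (auto simp: bij_betw_def module_vec_simps)
      then obtain \<sigma> a where "(\<sigma>, a) \<in> ?P" "i = e (\<sigma>, a)"
        by auto
      then show "vec_index v i = vec_index w i"
        using fun_cong[OF fun_cong[OF eq, of \<sigma>], of a] by (simp add: F_def)
    qed (use mem in \<open>simp add: module_vec_simps\<close>)
  qed
  have image: "T ` carrier (module_vec TYPE('k) ?N) = carrier H"
  proof (intro equalityI subsetI)
    fix x assume "x \<in> T ` carrier (module_vec TYPE('k) ?N)"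
    then show "x \<in> carrier H"
      using F_cocycle by (auto simp: H_def cohomology_degree_carrier T_def)
  next
    fix x assume "x \<in> carrier H"
    then obtain \<phi> where \<phi>: "\<phi> \<in> homogeneous_cocycles (Suc q) l" "x = cohomology_class (Suc q) \<phi>"
      by (auto simp: H_def cohomology_degree_carrier)
    obtain g where g: "g \<in> cochain_space q"
      and crit: "\<And>\<sigma> a. (\<phi> - coboundary g) \<sigma> a \<noteq> 0 \<Longrightarrow> (\<sigma>, a) \<in> critical_pairs (Suc q) l"
      using critical_representative[OF \<phi>(1)] by blast
    define v where "v = vec ?N (\<lambda>i. case the_inv_into ?P e i of (\<sigma>, a) \<Rightarrow> (\<phi> - coboundary g) \<sigma> a)"
    have F_v: "F v = \<phi> - coboundary g"
    proof (intro ext)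
      fix \<sigma> a
      have "the_inv_into ?P e (e (\<sigma>, a)) = (\<sigma>, a)" if "(\<sigma>, a) \<in> ?P"
        using that e by (simp add: bij_betw_def the_inv_into_f_f)
      then show "F v \<sigma> a = (\<phi> - coboundary g) \<sigma> a"
        using crit[of \<sigma> a] e_less[of "(\<sigma>, a)"] by (auto simp: F_def v_def)
    qed
    have "\<phi> - F v \<in> coboundary_space (Suc q)"
      using g by (simp add: F_v coboundary_space_def)
    moreover have "\<phi> \<in> cochain_space (Suc q)"
      using \<phi>(1) by (simp add: homogeneous_cocycles_def cocycle_space_def)
    ultimately have "x = T v"
      by (simp add: \<phi>(2) T_def cohomology_class_eq_iff[OF _ F_cochain])
    moreover have "v \<in> carrier (module_vec TYPE('k) ?N)"
      by (simp add: v_def module_vec_simps)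
    ultimately show "x \<in> T ` carrier (module_vec TYPE('k) ?N)"
      by blast
  qed
  have add: "T (v \<oplus>\<^bsub>module_vec TYPE('k) ?N\<^esub> w) = T v \<oplus>\<^bsub>H\<^esub> T w"
    if "v \<in> carrier (module_vec TYPE('k) ?N)" "w \<in> carrier (module_vec TYPE('k) ?N)" for v w
  proof -
    have "F (v + w) = F v + F w"
      using that e_less by (auto simp: F_def fun_eq_iff module_vec_simps)
    then show ?thesis
      by (simp add: T_def H_def cohomology_degree_ops(2)[OF F_cochain F_cochain] module_vec_simps)
  qed
  have smult: "T (c \<odot>\<^bsub>module_vec TYPE('k) ?N\<^esub> v) = c \<odot>\<^bsub>H\<^esub> T v"
    if "v \<in> carrier (module_vec TYPE('k) ?N)" for c v
  proof -
    have "F (c \<cdot>\<^sub>v v) = (\<lambda>\<sigma> a. c * F v \<sigma> a)"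
      using that e_less by (auto simp: F_def fun_eq_iff module_vec_simps)
    then show ?thesis
      by (simp add: T_def H_def cohomology_degree_ops(3)[OF F_cochain] module_vec_simps)
  qed
  have zero: "T \<zero>\<^bsub>module_vec TYPE('k) ?N\<^esub> = \<zero>\<^bsub>H\<^esub>"
  proof -
    have "F (0\<^sub>v ?N) = 0"
      using e_less by (auto simp: F_def fun_eq_iff)
    then show ?thesis
      by (simp add: T_def H_def cohomology_degree_ops(1) module_vec_simps)
  qed
  show "vectorspace.fin_dim class_ring H"
    by (rule vectorspace_image(1)[OF vec_vs inj image add smult zero V.fin_dim])
  show "vectorspace.dim class_ring H = card ?P"
    using vectorspace_image(2)[OF vec_vs inj image add smult zero V.fin_dim] V.dim_is_n by simp
qed

end


section \<open>Edge ideals\<close>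

text \<open>The vertex sets that contain no edge.\<close>

definition independent_sets :: "'x set \<Rightarrow> 'x set set \<Rightarrow> 'x set set" where
  "independent_sets V E = {F. F \<subseteq> V \<and> (\<forall>e\<in>E. \<not> e \<subseteq> F)}"

lemma independent_sets_mono: "F \<in> independent_sets V E \<Longrightarrow> G \<subseteq> F \<Longrightarrow> G \<in> independent_sets V E"
  unfolding independent_sets_def by blast

lemma poly_mapping_eq_sum_monomials: "p = (\<Sum>e\<in>keys p. Poly_Mapping.single e (lookup p e))"
proof (rule poly_mapping_eqI)
  fix e
  have "lookup (\<Sum>e\<in>keys p. Poly_Mapping.single e (lookup p e)) e =
      (\<Sum>e'\<in>keys p. if e' = e then lookup p e else 0)"
    by (auto simp: lookup_sum lookup_single when_def intro!: sum.cong)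
  then show "lookup p e = lookup (\<Sum>e\<in>keys p. Poly_Mapping.single e (lookup p e)) e"
    by (simp add: in_keys_iff)
qed

text \<open>The edge ideal is the Stanley-Reisner ideal of the independence complex.\<close>

lemma edge_ideal_eq:
  assumes E: "E \<subseteq> nsets V 2"
  shows "(edge_ideal V E :: ('x, 'k :: field) mpol set) =
    {p \<in> carrier (polynomial_ring V). \<forall>e\<in>keys p. keys e \<notin> independent_sets V E}"
    (is "?J = ?I")
proof
  let ?R = "polynomial_ring V :: ('x, 'k) mpol ring"
  interpret cring ?R
    by (rule cring_polynomial_ring)
  let ?S = "{pvar u * pvar v | u v. {u, v} \<in> E} :: ('x, 'k) mpol set"
  have gen: "pvar u * pvar v = (Poly_Mapping.single (Poly_Mapping.single u 1 + Poly_Mapping.single v 1) 1 :: ('x, 'k) mpol)"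
    for u v :: 'x
    by (simp add: pvar_def mult_single)
  have keys_gen: "keys (Poly_Mapping.single u 1 + Poly_Mapping.single v (1 :: nat)) = {u, v}" for u v :: 'x
    by (auto simp: keys_add_exponent)
  have "pvar u * pvar v \<in> ?I" if "{u, v} \<in> E" for u v
  proof -
    have "{u, v} \<subseteq> V"
      using E that by (auto simp: nsets_def)
    moreover have "{u, v} \<notin> independent_sets V E"
      using that by (auto simp: independent_sets_def)
    ultimately show ?thesis
      by (simp add: gen keys_gen del: One_nat_def)
  qed
  then have "?S \<subseteq> ?I"
    by blast
  moreover have "ideal ?I ?R"
    by (rule ideal_nonfaces) (rule independent_sets_mono)
  ultimately show "?J \<subseteq> ?I"
    unfolding edge_ideal_def by (intro genideal_minimal)
  have "?S \<subseteq> carrier ?R"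
    using \<open>?S \<subseteq> ?I\<close> by blast
  then interpret J: ideal ?J ?R
    unfolding edge_ideal_def by (rule genideal_ideal)
  have gen_mem: "?S \<subseteq> ?J"
    unfolding edge_ideal_def using \<open>?S \<subseteq> carrier ?R\<close> by (rule genideal_self)
  show "?I \<subseteq> ?J"
  proof
    fix p assume p: "p \<in> ?I"
    have monomial: "Poly_Mapping.single e c \<in> ?J" if e: "keys e \<subseteq> V" "keys e \<notin> independent_sets V E" for e c
    proof -
      obtain d where d: "d \<in> E" "d \<subseteq> keys e"
        using e by (auto simp: independent_sets_def)
      then obtain u v where uv: "d = {u, v}" "u \<noteq> v"
        using E by (auto simp: nsets_def card_2_iff)
      let ?f = "e - (Poly_Mapping.single u 1 + Poly_Mapping.single v 1)"
      have "e = ?f + (Poly_Mapping.single u 1 + Poly_Mapping.single v 1)"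
      proof (rule poly_mapping_eqI)
        fix w
        have "lookup e u \<ge> 1" "lookup e v \<ge> 1"
          using d(2) uv(1) by (auto simp: in_keys_iff)
        then show "lookup e w = lookup (?f + (Poly_Mapping.single u 1 + Poly_Mapping.single v 1)) w"
          using uv(2) by (auto simp: lookup_add lookup_minus lookup_single when_def)
      qed
      then have "Poly_Mapping.single e c = Poly_Mapping.single ?f c * (pvar u * pvar v)"
        by (simp add: gen mult_single)
      moreover have "keys ?f \<subseteq> V"
        using e(1) by (auto simp: in_keys_iff lookup_minus)
      moreover have "pvar u * pvar v \<in> ?J"
        using gen_mem d(1) uv(1) by blast
      ultimately show ?thesis
        using J.I_l_closed[of "pvar u * pvar v" "Poly_Mapping.single ?f c"] by (simp split: if_splits)
    qed
    have "(\<Sum>e\<in>A. Poly_Mapping.single e (lookup p e)) \<in> ?J" if "finite A" "A \<subseteq> keys p" for A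
      using that
    proof (induction A rule: finite_induct)
      case empty
      then show ?case
        using J.zero_closed by simp
    next
      case (insert e A)
      then have "Poly_Mapping.single e (lookup p e) \<in> ?J"
        using p by (intro monomial) auto
      then show ?case
        using J.a_closed[of "Poly_Mapping.single e (lookup p e)"] insert by simp
    qed
    then show "p \<in> ?J"
      using poly_mapping_eq_sum_monomials[of p] by (metis finite_keys order_refl)
  qed
qed


section \<open>Independent sets of a multi-clique-whiskered graph\<close>

lemma whiskered_edges_subset:
  assumes "E \<subseteq> nsets V 2" "(\<Union>i\<in>{1..r}. W i) = V"
  shows "whiskered_edges E r W n \<subseteq> nsets (whiskered_vertices V r n) 2"
proof
  fix e assume "e \<in> whiskered_edges E r W n"
  then consider d where "d \<in> E" "e = Inl ` d"
    | x i k where "i \<in> {1..r}" "x \<in> W i" "k \<in> {1..n i}" "e = {Inl x, Inr (i, k)}"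
    unfolding whiskered_edges_def by blast
  then show "e \<in> nsets (whiskered_vertices V r n) 2"
  proof cases
    case 1
    then have "d \<subseteq> V" "finite d" "card d = 2"
      using assms(1) by (auto simp: nsets_def)
    then show ?thesis
      by (auto simp: nsets_def whiskered_vertices_def card_image 1(2))
  next
    case 2
    moreover have "x \<in> V"
      using 2(1,2) assms(2) by blast
    ultimately show ?thesis
      by (auto simp: whiskered_vertices_def)
  qed
qed

lemma whisker_edge:
  assumes "e \<in> whiskered_edges E r W n" "Inr (i, k) \<in> e"
  obtains x where "x \<in> W i" "e = {Inl x, Inr (i, k)}" "i \<in> {1..r}"
  using assms by (auto simp: whiskered_edges_def)

lemma independent_whiskered_link:
  fixes V :: "'v set" and E :: "'v set set" and r :: nat and W :: "nat \<Rightarrow> 'v set" and n :: "nat \<Rightarrow> nat"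
  defines "D \<equiv> independent_sets (whiskered_vertices V r n) (whiskered_edges E r W n)"
  assumes F: "F \<in> D"
    and W: "(\<Union>i\<in>{1..r}. W i) = V"
    and w: "w \<in> whiskered_vertices V r n - Inl ` V"
  shows "insert w F \<in> D \<longleftrightarrow> insert w (F \<inter> Inl ` V) \<in> D"
proof
  show "insert w F \<in> D \<Longrightarrow> insert w (F \<inter> Inl ` V) \<in> D"
    unfolding D_def by (erule independent_sets_mono) blast
next
  assume *: "insert w (F \<inter> Inl ` V) \<in> D"
  have False if e: "e \<in> whiskered_edges E r W n" "e \<subseteq> insert w F" for e
  proof (cases "w \<in> e")
    case True
    obtain i k where ik: "w = Inr (i, k)"
      using w by (auto simp: whiskered_vertices_def)
    then obtain x where x: "x \<in> W i" "e = {Inl x, Inr (i, k)}" "i \<in> {1..r}"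
      using whisker_edge[OF e(1)] True by blast
    then have "x \<in> V"
      using W by blast
    then have "e \<subseteq> insert w (F \<inter> Inl ` V)"
      using e(2) x(2) ik by auto
    then show False
      using * e(1) by (auto simp: D_def independent_sets_def)
  next
    case False
    then show False
      using e F by (auto simp: D_def independent_sets_def)
  qed
  then show "insert w F \<in> D"
    using F w by (auto simp: D_def independent_sets_def)
qed

text \<open>If \<open>F\<close> can be extended by an old vertex \<open>x\<close>, then \<open>F\<close> contains no vertex of the clique of \<open>x\<close>,
  and it can be extended by any whisker at this clique. There is one since \<open>n i > 0\<close>.\<close>

lemma independent_whiskered_extend:
  fixes V :: "'v set" and E :: "'v set set" and r :: nat and W :: "nat \<Rightarrow> 'v set" and n :: "nat \<Rightarrow> nat"
  defines "D \<equiv> independent_sets (whiskered_vertices V r n) (whiskered_edges E r W n)"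
  assumes F: "F \<in> D"
    and G: "G \<in> D" and less: "F \<subset> G"
    and W: "(\<Union>i\<in>{1..r}. W i) = V" and cliques: "\<forall>i\<in>{1..r}. clique (W i) E"
    and n: "\<forall>i\<in>{1..r}. n i > 0"
  shows "\<exists>w\<in>whiskered_vertices V r n - Inl ` V. w \<notin> F \<and> insert w F \<in> D"
proof -
  obtain v where v: "v \<in> G" "v \<notin> F"
    using less by blast
  show ?thesis
  proof (cases "v \<in> Inl ` V")
    case False
    have "insert v F \<in> D"
      using G unfolding D_def by (rule independent_sets_mono) (use v less in blast)
    moreover have "v \<in> whiskered_vertices V r n"
      using v G by (auto simp: D_def independent_sets_def)
    ultimately show ?thesis
      using v False by blast
  next
    case True
    then obtain x where x: "v = Inl x" "x \<in> V"
      by blast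
    then obtain i where i: "i \<in> {1..r}" "x \<in> W i"
      using W by blast
    let ?w = "Inr (i, 1) :: 'v + nat \<times> nat"
    have k: "1 \<in> {1..n i}"
      using n i(1) by (simp add: Suc_le_eq)
    have wV: "?w \<in> whiskered_vertices V r n - Inl ` V"
      using i(1) k by (auto simp: whiskered_vertices_def)
    have edge: "{Inl x, ?w} \<in> whiskered_edges E r W n"
      unfolding whiskered_edges_def using i k by blast
    have "?w \<notin> F"
    proof
      assume "?w \<in> F"
      then have "{Inl x, ?w} \<subseteq> G"
        using less v(1) x(1) by blast
      then show False
        using G edge by (auto simp: D_def independent_sets_def)
    qed
    moreover have False if e: "e \<in> whiskered_edges E r W n" "e \<subseteq> insert ?w F" for e
    proof (cases "?w \<in> e")
      case True
      then obtain y where y: "y \<in> W i" "e = {Inl y, ?w}"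
        using whisker_edge[OF e(1) True] by blast
      then have "Inl y \<in> F"
        using e(2) by auto
      then have "y \<noteq> x"
        using v(2) x(1) by blast
      then have "{x, y} \<in> E"
        using cliques i y(1) by (auto simp: clique_def)
      then have "Inl ` {x, y} \<in> whiskered_edges E r W n"
        by (simp only: whiskered_edges_def) blast
      moreover have "Inl ` {x, y} \<subseteq> G"
        using \<open>Inl y \<in> F\<close> less v(1) x(1) by auto
      ultimately show False
        using G by (auto simp: D_def independent_sets_def)
    next
      case False
      then show False
        using e F by (auto simp: D_def independent_sets_def)
    qed
    then have "insert ?w F \<in> D"
      using F wV by (auto simp: D_def independent_sets_def)
    ultimately show ?thesis
      using wV by blast
  qed
qed

text \<open>The minimal vertex covers are the complements of the maximal independent sets.\<close>

lemma minimal_vertex_cover_iff: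
  assumes "F \<subseteq> V" and E: "\<And>e. e \<in> E \<Longrightarrow> e \<subseteq> V"
  shows "V - F \<in> minimal_vertex_covers V E \<longleftrightarrow>
    F \<in> independent_sets V E \<and> (\<forall>G\<in>independent_sets V E. F \<subseteq> G \<longrightarrow> G = F)"
proof -
  have cover: "vertex_cover V E (V - G) \<longleftrightarrow> G \<in> independent_sets V E" if "G \<subseteq> V" for G
    using that E unfolding vertex_cover_def independent_sets_def by blast
  show ?thesis
  proof
    assume L: "V - F \<in> minimal_vertex_covers V E"
    have "G = F" if G: "G \<in> independent_sets V E" "F \<subseteq> G" for G
    proof (rule ccontr)
      assume "G \<noteq> F"
      moreover have "G \<subseteq> V"
        using G by (simp add: independent_sets_def)
      ultimately have "V - G \<subset> V - F" "vertex_cover V E (V - G)"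
        using G cover by auto
      then show False
        using L by (auto simp: minimal_vertex_covers_def)
    qed
    then show "F \<in> independent_sets V E \<and> (\<forall>G\<in>independent_sets V E. F \<subseteq> G \<longrightarrow> G = F)"
      using L cover[OF assms(1)] by (simp add: minimal_vertex_covers_def)
  next
    assume R: "F \<in> independent_sets V E \<and> (\<forall>G\<in>independent_sets V E. F \<subseteq> G \<longrightarrow> G = F)"
    have "\<not> vertex_cover V E C" if "C \<subset> V - F" for C
    proof
      assume "vertex_cover V E C"
      then have "V - C \<in> independent_sets V E"
        using cover[of "V - C"] that by (simp add: double_diff subset_iff vertex_cover_def)
      moreover have "F \<subseteq> V - C"
        using that assms(1) by blast
      ultimately have "V - C = F"
        using R by blast
      then show False
        using that by blast
    qed
    then show "V - F \<in> minimal_vertex_covers V E"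
      using R cover[OF assms(1)] by (simp add: minimal_vertex_covers_def)
  qed
qed


section \<open>Counting critical pairs\<close>

text \<open>Exponents with support \<open>S\<close> that are negative on \<open>S\<close>; up to signs, the compositions of \<open>m\<close> into
  positive parts indexed by \<open>S\<close>.\<close>

definition negative_compositions :: "'x set \<Rightarrow> int \<Rightarrow> ('x \<Rightarrow> int) set" where
  "negative_compositions S m =
     {a. (\<forall>v\<in>S. a v < 0) \<and> (\<forall>v. v \<notin> S \<longrightarrow> a v = 0) \<and> (\<Sum>v\<in>S. a v) = - m}"

lemma negative_compositions_nonpositive:
  assumes "finite S" "S \<noteq> {}" "m \<le> 0"
  shows "negative_compositions S m = {}"
proof -
  have "(\<Sum>v\<in>S. a v) < 0" if "\<forall>v\<in>S. a v < 0" for a :: "'a \<Rightarrow> int"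
    using that assms sum_strict_mono[of S a "\<lambda>_. 0"] by simp
  then show ?thesis
    using assms(3) by (force simp: negative_compositions_def)
qed

text \<open>The part at \<open>v\<close> is either \<open>1\<close> and can be omitted, or it can be lowered by \<open>1\<close>. This is the recurrence
  \<open>geometric_power_Suc_nth\<close> for the powers of \<open>X / (1 - X)\<close>.\<close>

lemma negative_compositions_insert:
  assumes "finite S" "v \<notin> S"
  shows "negative_compositions (insert v S) m =
    (\<lambda>a. a(v := - 1)) ` negative_compositions S (m - 1) \<union>
    (\<lambda>a. a(v := a v - 1)) ` negative_compositions (insert v S) (m - 1)"
proof (intro equalityI subsetI)
  fix a assume a: "a \<in> negative_compositions (insert v S) m"
  have S: "(\<Sum>u\<in>S. if u = v then c else a u) = (\<Sum>u\<in>S. a u)" for c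
    using assms(2) by (intro sum.cong) auto
  show "a \<in> (\<lambda>a. a(v := - 1)) ` negative_compositions S (m - 1) \<union>
    (\<lambda>a. a(v := a v - 1)) ` negative_compositions (insert v S) (m - 1)"
  proof (cases "a v = - 1")
    case True
    then have "a(v := 0) \<in> negative_compositions S (m - 1)"
      using a assms by (auto simp: negative_compositions_def S)
    moreover have "a = (a(v := 0))(v := - 1)"
      using True by auto
    ultimately show ?thesis
      by blast
  next
    case False
    then have "a v < - 1"
      using a by (auto simp: negative_compositions_def)
    then have "a(v := a v + 1) \<in> negative_compositions (insert v S) (m - 1)"
      using a assms by (auto simp: negative_compositions_def S)
    moreover have "a = (a(v := a v + 1))(v := (a(v := a v + 1)) v - 1)"
      by auto
    ultimately show ?thesis
      by blast
  qed
next
  fix a assume "a \<in> (\<lambda>a. a(v := - 1)) ` negative_compositions S (m - 1) \<union>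
    (\<lambda>a. a(v := a v - 1)) ` negative_compositions (insert v S) (m - 1)"
  moreover have "(\<Sum>u\<in>S. if u = v then c else b u) = (\<Sum>u\<in>S. b u)" for b :: "'a \<Rightarrow> int" and c
    using assms(2) by (intro sum.cong) auto
  ultimately show "a \<in> negative_compositions (insert v S) m"
    using assms by (auto simp: negative_compositions_def)
qed

text \<open>The geometric series in \<open>X = t\<^bsup>-1\<^esup>\<close> without its constant term.\<close>

abbreviation (input) geometric :: "rat fls" where
  "geometric \<equiv> fls_X / (1 - fls_X)"

lemma geometric_eq: "geometric = fls_X + fls_X * geometric"
proof -
  have "(1 - fls_X :: rat fls) \<noteq> 0"
    by (metis eq_iff_diff_eq_0 fls_X_subdegree fls_one_subdegree zero_neq_one)
  then show ?thesis
    by (simp add: field_simps)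
qed

lemma subdegree_geometric: "fls_subdegree geometric = 1"
proof -
  have nz: "(1 - fls_X :: rat fls) \<noteq> 0"
    by (metis eq_iff_diff_eq_0 fls_X_subdegree fls_one_subdegree zero_neq_one)
  have "fls_subdegree (1 - fls_X :: rat fls) = 0"
    by (rule fls_subdegree_eqI) auto
  moreover have "geometric * (1 - fls_X) = fls_X"
    using nz by simp
  moreover have "geometric \<noteq> 0"
    using nz by simp
  ultimately show ?thesis
    using fls_subdegree_mult[of geometric "1 - fls_X"] nz by simp
qed

lemma geometric_power_Suc_nth:
  "fls_nth (geometric ^ Suc k) m = fls_nth (geometric ^ k) (m - 1) + fls_nth (geometric ^ Suc k) (m - 1)"
proof -
  have "geometric ^ Suc k = (fls_X + fls_X * geometric) * geometric ^ k"
    by (subst geometric_eq[symmetric]) simp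
  also have "\<dots> = fls_X * (geometric ^ k + geometric ^ Suc k)"
    by (simp add: algebra_simps)
  finally have eq: "geometric ^ Suc k = fls_X * (geometric ^ k + geometric ^ Suc k)" .
  have "fls_nth (fls_X * f) m = fls_nth f (m - 1)" for f :: "rat fls"
    by (simp add: fls_X_times_conv_shift)
  then show ?thesis
    using arg_cong[OF eq, of "\<lambda>f. fls_nth f m"] by (simp only: fls_plus_nth)
qed

lemma card_negative_compositions:
  assumes "finite S"
  shows "finite (negative_compositions S m) \<and>
    of_nat (card (negative_compositions S m)) = fls_nth (geometric ^ card S) m"
  using assms
proof (induction S arbitrary: m rule: finite_induct)
  case empty
  have "negative_compositions ({} :: 'a set) m = (if m = 0 then {\<lambda>_. 0} else {})"
    by (auto simp: negative_compositions_def)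
  then show ?case
    by simp
next
  case (insert v S)
  let ?P = "\<lambda>m. finite (negative_compositions (insert v S) m) \<and>
    of_nat (card (negative_compositions (insert v S) m)) = fls_nth (geometric ^ card (insert v S)) m"
  have base: "?P m" if "m \<le> 0" for m
  proof -
    have "fls_nth (geometric ^ card (insert v S)) m = 0"
      using insert.hyps that by (intro fls_eq0_below_subdegree)
        (simp only: fls_subdegree_pow subdegree_geometric, simp)
    then show ?thesis
      using negative_compositions_nonpositive[of "insert v S" m] insert.hyps that by simp
  qed
  have "?P (int k)" for k
  proof (induction k)
    case 0
    then show ?case
      using base[of 0] by simp
  next
    case (Suc k)
    let ?A = "(\<lambda>a. a(v := - 1)) ` negative_compositions S (int k)"
    let ?B = "(\<lambda>a. a(v := a v - 1)) ` negative_compositions (insert v S) (int k)"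
    have "inj_on (\<lambda>a. a(v := - 1 :: int)) (negative_compositions S (int k))"
    proof (rule inj_onI)
      fix a b :: "'a \<Rightarrow> int"
      assume *: "a \<in> negative_compositions S (int k)" "b \<in> negative_compositions S (int k)"
        "a(v := - 1) = b(v := - 1)"
      have "a u = b u" for u
        using fun_cong[OF *(3), of u] *(1,2) insert.hyps by (cases "u = v") (auto simp: negative_compositions_def)
      then show "a = b"
        by blast
    qed
    moreover have "inj_on (\<lambda>a. a(v := a v - 1 :: int)) (negative_compositions (insert v S) (int k))"
    proof (rule inj_onI)
      fix a b :: "'a \<Rightarrow> int"
      assume *: "a(v := a v - 1) = b(v := b v - 1)"
      have "a u = b u" for u
        using fun_cong[OF *, of u] by (cases "u = v") auto
      then show "a = b"
        by blast
    qed
    moreover have "?A \<inter> ?B = {}"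
    proof -
      have "b v - 1 \<noteq> - 1" if "b \<in> negative_compositions (insert v S) (int k)" for b
        using that by (auto simp: negative_compositions_def)
      then show ?thesis
        by (auto dest!: fun_cong[of _ _ v])
    qed
    moreover have "negative_compositions (insert v S) (int (Suc k)) = ?A \<union> ?B"
      using negative_compositions_insert[OF insert.hyps, of "int (Suc k)"] by simp
    ultimately have "finite (negative_compositions (insert v S) (int (Suc k)))"
      "card (negative_compositions (insert v S) (int (Suc k))) =
        card (negative_compositions S (int k)) + card (negative_compositions (insert v S) (int k))"
      using insert.IH Suc.IH by (simp_all add: card_Un_disjoint card_image)
    then show ?case
      using insert.IH[of "int k"] Suc.IH insert.hyps
        geometric_power_Suc_nth[of "card S" "int (Suc k)"] by simp
  qed
  from this[of "nat m"] base[of m] show ?case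
    by (cases "m \<le> 0") simp_all
qed

lemma sum_Pow_card:
  fixes f :: "nat \<Rightarrow> 'a :: semiring_1"
  assumes "finite B" "card B \<le> N"
  shows "(\<Sum>T\<in>Pow B. f (card T)) = (\<Sum>i\<le>N. of_nat (card B choose i) * f i)"
proof -
  have "(\<Sum>T\<in>Pow B. f (card T)) = (\<Sum>i\<le>N. \<Sum>T | T \<in> Pow B \<and> card T = i. f (card T))"
    using assms by (intro sum.group[symmetric]) (auto intro: order.trans[OF card_mono])
  also have "\<dots> = (\<Sum>i\<le>N. of_nat (card B choose i) * f i)"
  proof (intro sum.cong refl)
    fix i
    have "(\<Sum>T | T \<in> Pow B \<and> card T = i. f (card T)) = of_nat (card {T. T \<subseteq> B \<and> card T = i}) * f i"
      by simp
    then show "(\<Sum>T | T \<in> Pow B \<and> card T = i. f (card T)) = of_nat (card B choose i) * f i"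
      by (simp only: n_subsets[OF assms(1)])
  qed
  finally show ?thesis .
qed

text \<open>The exponents of degree \<open>l\<close> that form critical pairs with the facet \<open>F\<close>, for the old vertices \<open>Y\<close>.\<close>

definition facet_exponents :: "'x set \<Rightarrow> 'x set \<Rightarrow> int \<Rightarrow> ('x \<Rightarrow> int) set" where
  "facet_exponents Y F l = {a. (\<forall>v. a v \<le> 0) \<and> F - Y \<subseteq> {v. a v \<noteq> 0} \<and> {v. a v \<noteq> 0} \<subseteq> F \<and> (\<Sum>v\<in>F. a v) = l}"

lemma card_facet_exponents:
  assumes "finite F"
  shows "finite (facet_exponents Y F l)"
    and "of_nat (card (facet_exponents Y F l)) =
      (\<Sum>T\<in>Pow (F \<inter> Y). fls_nth (geometric ^ (card F - card T)) (- l))"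
proof -
  have eq: "facet_exponents Y F l = (\<Union>T\<in>Pow (F \<inter> Y). negative_compositions (F - T) (- l))"
  proof (intro equalityI subsetI)
    fix a assume a: "a \<in> facet_exponents Y F l"
    let ?T = "{v\<in>F. a v = 0}"
    have nonpos: "a v \<le> 0" for v
      using a by (simp add: facet_exponents_def)
    have neg: "a v < 0" if "v \<in> F - ?T" for v
      by (rule order_le_neq_trans[OF nonpos]) (use that in blast)
    have zero: "a v = 0" if "v \<notin> F - ?T" for v
      using a that by (auto simp: facet_exponents_def)
    have "(\<Sum>v\<in>F - ?T. a v) = (\<Sum>v\<in>F. a v)"
      using assms by (intro sum.mono_neutral_left) auto
    also have "\<dots> = - (- l)"
      using a by (simp add: facet_exponents_def)
    finally have "a \<in> negative_compositions (F - ?T) (- l)"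
      unfolding negative_compositions_def using neg zero by blast
    moreover have "?T \<in> Pow (F \<inter> Y)"
      using a by (auto simp: facet_exponents_def)
    ultimately show "a \<in> (\<Union>T\<in>Pow (F \<inter> Y). negative_compositions (F - T) (- l))"
      by blast
  next
    fix a assume "a \<in> (\<Union>T\<in>Pow (F \<inter> Y). negative_compositions (F - T) (- l))"
    then obtain T where T: "T \<subseteq> F \<inter> Y" and a: "a \<in> negative_compositions (F - T) (- l)"
      by blast
    have neg: "v \<in> F - T \<Longrightarrow> a v < 0" and zero: "v \<notin> F - T \<Longrightarrow> a v = 0" for v
      using a by (auto simp: negative_compositions_def)
    have "(\<Sum>v\<in>F - T. a v) = (\<Sum>v\<in>F. a v)"
      using assms zero by (intro sum.mono_neutral_left) auto
    then have "(\<Sum>v\<in>F. a v) = l"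
      using a by (simp add: negative_compositions_def)
    moreover have "a v \<le> 0" for v
      using neg[of v] zero[of v] by (cases "v \<in> F - T") auto
    moreover have "F - Y \<subseteq> {v. a v \<noteq> 0}"
      using neg T by force
    moreover have "{v. a v \<noteq> 0} \<subseteq> F"
      using zero by blast
    ultimately show "a \<in> facet_exponents Y F l"
      by (simp add: facet_exponents_def)
  qed
  have fin: "finite (negative_compositions (F - T) (- l))" for T
    using card_negative_compositions[of "F - T"] assms by blast
  have disj: "negative_compositions (F - T) (- l) \<inter> negative_compositions (F - T') (- l) = {}"
    if "T \<in> Pow (F \<inter> Y)" "T' \<in> Pow (F \<inter> Y)" "T \<noteq> T'" for T T'
  proof -
    have "T = {v\<in>F. a v = 0}" if "a \<in> negative_compositions (F - T) (- l)" "T \<subseteq> F" for a and T :: "'a set"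
    proof (intro equalityI subsetI)
      fix v assume "v \<in> T"
      then show "v \<in> {v\<in>F. a v = 0}"
        using that by (auto simp: negative_compositions_def)
    next
      fix v assume v: "v \<in> {v\<in>F. a v = 0}"
      show "v \<in> T"
      proof (rule ccontr)
        assume "v \<notin> T"
        then have "a v < 0"
          using that(1) v unfolding negative_compositions_def by blast
        with v show False
          by simp
      qed
    qed
    then show ?thesis
      using that by blast
  qed
  show "finite (facet_exponents Y F l)"
    unfolding eq using fin assms by simp
  have "card (facet_exponents Y F l) = (\<Sum>T\<in>Pow (F \<inter> Y). card (negative_compositions (F - T) (- l)))"
    unfolding eq using fin disj assms by (intro card_UN_disjoint) auto
  then have "of_nat (card (facet_exponents Y F l)) =
      (\<Sum>T\<in>Pow (F \<inter> Y). of_nat (card (negative_compositions (F - T) (- l))) :: rat)"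
    by simp
  also have "\<dots> = (\<Sum>T\<in>Pow (F \<inter> Y). fls_nth (geometric ^ (card F - card T)) (- l))"
  proof (intro sum.cong refl)
    fix T assume "T \<in> Pow (F \<inter> Y)"
    then have "card (F - T) = card F - card T"
      using assms by (intro card_Diff_subset) (auto intro: finite_subset)
    then show "of_nat (card (negative_compositions (F - T) (- l))) =
        fls_nth (geometric ^ (card F - card T)) (- l)"
      using card_negative_compositions[of "F - T" "- l"] assms by simp
  qed
  finally show "of_nat (card (facet_exponents Y F l)) =
      (\<Sum>T\<in>Pow (F \<inter> Y). fls_nth (geometric ^ (card F - card T)) (- l))" .
qed

context whiskered_complex
begin

lemma critical_pairs_bij:
  "bij_betw (\<lambda>(\<sigma>, a). (verts \<sigma>, a)) (critical_pairs p l)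
    (SIGMA F:{F. facet F \<and> card F = p}. facet_exponents Y F l)"
proof (rule bij_betwI')
  have card_verts: "card (verts \<sigma>) = card \<sigma>" if "\<sigma> \<subseteq> {..<length vs}" for \<sigma>
    unfolding verts_def using that distinct by (intro card_image inj_on_nth) auto
  have sum_eq: "(\<Sum>v\<in>F. a v) = (\<Sum>v\<in>set vs. a v)" if "{v. a v \<noteq> 0} \<subseteq> F" "F \<subseteq> set vs"
    for F and a :: "'x \<Rightarrow> int"
    using that by (intro sum.mono_neutral_left) auto
  {
    fix x y assume "x \<in> critical_pairs p l" "y \<in> critical_pairs p l"
    then obtain \<sigma> a \<tau> b where xy: "x = (\<sigma>, a)" "y = (\<tau>, b)" "\<sigma> \<subseteq> {..<length vs}" "\<tau> \<subseteq> {..<length vs}"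
      by (auto simp: critical_pairs_def critical_def)
    have "\<sigma> = \<tau>" if "verts \<sigma> = verts \<tau>"
      using that nth_in_verts[OF xy(3)] nth_in_verts[OF xy(4)] xy(3,4) by blast
    then show "(case x of (\<sigma>, a) \<Rightarrow> (verts \<sigma>, a)) = (case y of (\<sigma>, a) \<Rightarrow> (verts \<sigma>, a)) \<longleftrightarrow> x = y"
      by (auto simp: xy)
  next
    fix x assume "x \<in> critical_pairs p l"
    then obtain \<sigma> a where x: "x = (\<sigma>, a)" and \<sigma>: "\<sigma> \<in> critical a" "card \<sigma> = p" "(\<Sum>v\<in>set vs. a v) = l"
      by (auto simp: critical_pairs_def)
    then have "\<sigma> \<subseteq> {..<length vs}"
      by (simp add: critical_def)
    then show "(case x of (\<sigma>, a) \<Rightarrow> (verts \<sigma>, a)) \<in> (SIGMA F:{F. facet F \<and> card F = p}. facet_exponents Y F l)"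
      using \<sigma> x card_verts sum_eq[of a "verts \<sigma>"] verts_subset[of \<sigma>]
      by (auto simp: critical_def facet_exponents_def)
  next
    fix y assume "y \<in> (SIGMA F:{F. facet F \<and> card F = p}. facet_exponents Y F l)"
    then obtain F a where y: "y = (F, a)" "facet F" "card F = p" "a \<in> facet_exponents Y F l"
      by auto
    define \<sigma> where "\<sigma> = {i. i < length vs \<and> vs ! i \<in> F}"
    have "F \<subseteq> set vs"
      using y(2) face_vertices by (simp add: facet_def)
    then have F: "verts \<sigma> = F"
      by (auto simp: verts_def \<sigma>_def in_set_conv_nth image_iff) (metis in_set_conv_nth subsetD)
    have \<sigma>: "\<sigma> \<subseteq> {..<length vs}"
      by (auto simp: \<sigma>_def)
    have "(\<sigma>, a) \<in> critical_pairs p l"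
      using y \<sigma> F card_verts[OF \<sigma>] sum_eq[of a F] \<open>F \<subseteq> set vs\<close>
      by (auto simp: critical_pairs_def critical_def facet_exponents_def)
    then show "\<exists>x\<in>critical_pairs p l. y = (case x of (\<sigma>, a) \<Rightarrow> (verts \<sigma>, a))"
      using F y(1) by (intro bexI[of _ "(\<sigma>, a)"]) auto
  }
qed

lemma card_critical_pairs:
  shows "finite (critical_pairs p l)"
    and "of_nat (card (critical_pairs p l)) =
      (\<Sum>F | facet F \<and> card F = p. \<Sum>T\<in>Pow (F \<inter> Y). fls_nth (geometric ^ (p - card T)) (- l))"
proof -
  have facets: "finite {F. facet F \<and> card F = p}"
    by (rule finite_subset[of _ "Pow (set vs)"]) (use face_vertices in \<open>auto simp: facet_def\<close>)
  have fin: "finite F" if "facet F" for F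
    using that face_vertices[of F] finite_subset[of F "set vs"] by (simp add: facet_def)
  have exps: "finite (facet_exponents Y F l)" if "facet F" for F
    using card_facet_exponents(1)[OF fin[OF that]] .
  then have "finite (SIGMA F:{F. facet F \<and> card F = p}. facet_exponents Y F l)"
    using facets by auto
  then show "finite (critical_pairs p l)"
    using bij_betw_finite[OF critical_pairs_bij] by blast
  have "card (critical_pairs p l) = (\<Sum>F | facet F \<and> card F = p. card (facet_exponents Y F l))"
    using bij_betw_same_card[OF critical_pairs_bij] exps facets by (simp add: card_SigmaI)
  then have "of_nat (card (critical_pairs p l)) =
      (\<Sum>F | facet F \<and> card F = p. of_nat (card (facet_exponents Y F l)) :: rat)"
    by simp
  also have "\<dots> = (\<Sum>F | facet F \<and> card F = p. \<Sum>T\<in>Pow (F \<inter> Y). fls_nth (geometric ^ (p - card T)) (- l))"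
    using card_facet_exponents(2)[OF fin] by (intro sum.cong) auto
  finally show "of_nat (card (critical_pairs p l)) =
      (\<Sum>F | facet F \<and> card F = p. \<Sum>T\<in>Pow (F \<inter> Y). fls_nth (geometric ^ (p - card T)) (- l))" .
qed

end


section \<open>Local cohomology of multi-clique-whiskered graphs\<close>

theorem corollary5p8:
  fixes V :: "'v set" and E :: "'v set set"
    and r :: nat and W :: "nat \<Rightarrow> 'v set" and n :: "nat \<Rightarrow> nat"
    and V\<Gamma> :: "('v + nat \<times> nat) set" and E\<Gamma> :: "('v + nat \<times> nat) set set"
    and vs :: "('v + nat \<times> nat) list"
    and I\<Gamma> :: "('v + nat \<times> nat, 'k :: field) mpol set"
    and j :: nat
  assumes "finite_simple_graph V E"
    and "clique_partition V E r W"
    and "\<forall>i\<in>{1..r}. n i > 0"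
    and "V\<Gamma> = whiskered_vertices V r n"
    and "E\<Gamma> = whiskered_edges E r W n"
    and "I\<Gamma> = edge_ideal V\<Gamma> E\<Gamma>"
    and "distinct vs" and "set vs = V\<Gamma>"
    and "j > 0"
  shows "(\<forall>l. vectorspace.fin_dim class_ring (residue_local_cohomology_degree vs I\<Gamma> j l)) \<and>
    hilbert_series (residue_local_cohomology_degree vs I\<Gamma> j) =
    series_in_inverse_variable
      (\<Sum>i\<le>card V. \<Sum>C\<in>{C \<in> minimal_vertex_covers V\<Gamma> E\<Gamma>. int (card C) = int (card V\<Gamma>) - int j}.
         of_nat (card (Inl ` V - C) choose i) * (fls_X / (1 - fls_X)) powi (int j - int i))"
proof -
  have V: "finite V" "E \<subseteq> nsets V 2" and W: "\<forall>i\<in>{1..r}. clique (W i) E" "(\<Union>i\<in>{1..r}. W i) = V"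
    using assms(1,2) by (auto simp: finite_simple_graph_def clique_partition_def)
  have edges: "E\<Gamma> \<subseteq> nsets V\<Gamma> 2"
    unfolding assms(4,5) by (rule whiskered_edges_subset[OF V(2) W(2)])
  have fin: "finite V\<Gamma>"
    unfolding assms(8)[symmetric] by simp
  define D where "D = independent_sets V\<Gamma> E\<Gamma>"
  let ?Y = "Inl ` V :: ('v + nat \<times> nat) set"
  interpret whiskered_complex vs D I\<Gamma> ?Y
  proof
    show "F \<subseteq> set vs" if "F \<in> D" for F
      using that by (simp add: D_def independent_sets_def assms(8))
    show "G \<in> D" if "F \<in> D" "G \<subseteq> F" for F G
      using that unfolding D_def by (rule independent_sets_mono)
    show "I\<Gamma> = {p \<in> carrier (polynomial_ring (set vs)). \<forall>e\<in>keys p. keys e \<notin> D}"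
      unfolding assms(6,8) D_def by (rule edge_ideal_eq[OF edges])
    show "insert w F \<in> D \<longleftrightarrow> insert w (F \<inter> ?Y) \<in> D" if "F \<in> D" "w \<in> set vs - ?Y" for F w
      using that independent_whiskered_link[OF _ W(2)] unfolding D_def assms(4,5,8) by blast
    show "\<exists>w\<in>set vs - ?Y. w \<notin> F \<and> insert w F \<in> D" if "F \<in> D" "G \<in> D" "F \<subset> G" for F G
      using that independent_whiskered_extend[OF _ _ _ W(2,1) assms(3)]
      unfolding D_def assms(4,5,8) by blast
  qed (use assms(7) in simp_all)
  obtain q where q: "j = Suc q"
    using assms(9) by (cases j) auto
  have fin_dim: "vectorspace.fin_dim class_ring (residue_local_cohomology_degree vs I\<Gamma> j l)"
    and dim: "vectorspace.dim class_ring (residue_local_cohomology_degree vs I\<Gamma> j l) = card (critical_pairs j l)" for l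
    using cohomology_degree_dim[of q l] card_critical_pairs(1) by (simp_all add: q)
  define \<C> where "\<C> = {C \<in> minimal_vertex_covers V\<Gamma> E\<Gamma>. int (card C) = int (card V\<Gamma>) - int j}"
  have facet_subset: "F \<subseteq> V\<Gamma>" if "facet F" for F
    using that face_vertices[of F] unfolding facet_def assms(8) by blast
  have covers: "bij_betw (\<lambda>F. V\<Gamma> - F) {F. facet F \<and> card F = j} \<C>"
  proof (rule bij_betw_imageI)
    show "inj_on (\<lambda>F. V\<Gamma> - F) {F. facet F \<and> card F = j}"
      using facet_subset by (intro inj_onI) blast
    have cover_iff: "V\<Gamma> - F \<in> minimal_vertex_covers V\<Gamma> E\<Gamma> \<longleftrightarrow> facet F" if "F \<subseteq> V\<Gamma>" for F
      unfolding facet_def unfolding D_def by (rule minimal_vertex_cover_iff[OF that]) (use edges in \<open>auto simp: nsets_def\<close>)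
    have card_iff: "int (card (V\<Gamma> - F)) = int (card V\<Gamma>) - int j \<longleftrightarrow> card F = j" if "F \<subseteq> V\<Gamma>" for F
      using that fin card_mono[OF fin that] by (auto simp: card_Diff_subset finite_subset of_nat_diff)
    show "(\<lambda>F. V\<Gamma> - F) ` {F. facet F \<and> card F = j} = \<C>"
    proof (intro equalityI subsetI)
      fix C assume "C \<in> (\<lambda>F. V\<Gamma> - F) ` {F. facet F \<and> card F = j}"
      then show "C \<in> \<C>"
        using facet_subset cover_iff card_iff by (auto simp: \<C>_def)
    next
      fix C assume C: "C \<in> \<C>"
      then have "C \<subseteq> V\<Gamma>"
        by (simp add: \<C>_def minimal_vertex_covers_def vertex_cover_def)
      then have "C = V\<Gamma> - (V\<Gamma> - C)"
        by blast
      moreover from this have "facet (V\<Gamma> - C)" "card (V\<Gamma> - C) = j"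
        using C cover_iff[of "V\<Gamma> - C"] card_iff[of "V\<Gamma> - C"] by (auto simp: \<C>_def)
      ultimately show "C \<in> (\<lambda>F. V\<Gamma> - F) ` {F. facet F \<and> card F = j}"
        by blast
    qed
  qed
  have facet_sum: "(\<Sum>T\<in>Pow (F \<inter> ?Y). fls_nth (geometric ^ (j - card T)) (- l)) =
      (\<Sum>i\<le>card V. of_nat (card (?Y - (V\<Gamma> - F)) choose i) * fls_nth (geometric powi (int j - int i)) (- l))"
    if F: "facet F" "card F = j" for F l
  proof -
    have finF: "finite F"
      using facet_subset[OF F(1)] fin by (rule finite_subset)
    have "card (F \<inter> ?Y) \<le> card ?Y"
      using V(1) by (intro card_mono) auto
    then have "card (F \<inter> ?Y) \<le> card V"
      using card_image_le[OF V(1), of "Inl :: 'v \<Rightarrow> 'v + nat \<times> nat"] by linarith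
    then have "(\<Sum>T\<in>Pow (F \<inter> ?Y). fls_nth (geometric ^ (j - card T)) (- l)) =
        (\<Sum>i\<le>card V. of_nat (card (F \<inter> ?Y) choose i) * fls_nth (geometric ^ (j - i)) (- l))"
      using finF by (intro sum_Pow_card[of _ _ "\<lambda>i. fls_nth (geometric ^ (j - i)) (- l)"]) auto
    also have "\<dots> = (\<Sum>i\<le>card V. of_nat (card (F \<inter> ?Y) choose i) * fls_nth (geometric powi (int j - int i)) (- l))"
    proof (intro sum.cong refl)
      fix i
      have "card (F \<inter> ?Y) \<le> j"
        using card_mono[OF finF, of "F \<inter> ?Y"] F(2) by simp
      then show "of_nat (card (F \<inter> ?Y) choose i) * fls_nth (geometric ^ (j - i)) (- l) =
          of_nat (card (F \<inter> ?Y) choose i) * fls_nth (geometric powi (int j - int i)) (- l)"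
        by (cases "i \<le> j") (simp_all add: binomial_eq_0 power_int_def nat_diff_distrib)
    qed
    finally have "(\<Sum>T\<in>Pow (F \<inter> ?Y). fls_nth (geometric ^ (j - card T)) (- l)) =
        (\<Sum>i\<le>card V. of_nat (card (F \<inter> ?Y) choose i) * fls_nth (geometric powi (int j - int i)) (- l))" .
    moreover have "?Y - (V\<Gamma> - F) = F \<inter> ?Y"
      by (auto simp: assms(4) whiskered_vertices_def)
    ultimately show ?thesis
      by (simp only:)
  qed
  have "hilbert_series (residue_local_cohomology_degree vs I\<Gamma> j) l =
      series_in_inverse_variable (\<Sum>i\<le>card V. \<Sum>C\<in>\<C>.
        of_nat (card (?Y - C) choose i) * geometric powi (int j - int i)) l" for l
  proof -
    have "hilbert_series (residue_local_cohomology_degree vs I\<Gamma> j) l =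
        (\<Sum>F | facet F \<and> card F = j. \<Sum>T\<in>Pow (F \<inter> ?Y). fls_nth (geometric ^ (j - card T)) (- l))"
      by (simp add: hilbert_series_def dim card_critical_pairs(2))
    also have "\<dots> = (\<Sum>F | facet F \<and> card F = j. \<Sum>i\<le>card V.
        of_nat (card (?Y - (V\<Gamma> - F)) choose i) * fls_nth (geometric powi (int j - int i)) (- l))"
      using facet_sum by (intro sum.cong) auto
    also have "\<dots> = (\<Sum>C\<in>\<C>. \<Sum>i\<le>card V.
        of_nat (card (?Y - C) choose i) * fls_nth (geometric powi (int j - int i)) (- l))"
      by (rule sum.reindex_bij_betw[OF covers])
    also have "\<dots> = (\<Sum>i\<le>card V. \<Sum>C\<in>\<C>.
        of_nat (card (?Y - C) choose i) * fls_nth (geometric powi (int j - int i)) (- l))"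
      by (rule sum.swap)
    finally show ?thesis
      by (simp add: series_in_inverse_variable_def fls_nth_sum)
  qed
  then show ?thesis
    using fin_dim unfolding \<C>_def by blast
qed

end
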